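(* Assume in addition to the setting in the context that: (1) $\xi_0,\dots,\xi_k$ are i.i.d. random variables; (2) $G_{\delta,L}(x,\xi)$ satisfies the light-tail condition $\mathbb{E}_\xi\left[\exp\left(\frac{\|G_{\delta,L}(x,\xi)-g_{\delta,L}(x)\|_*^2}{\sigma^2}\right)\right]\le\exp(1)$; (3) $Q$ is bounded and $D>0$ is a number with $\max_{x,y\in Q}\|x-y\|\le D$. Let $p\in[1,2]$, $a = 2^{\frac{2p-1}{2}}$, $b=2^{\frac{5-2p}{4}}p^{\frac{1-2p}{2}}$, let $R$ satisfy $\sqrt{2d(x^* )}\le R$, and for all $i\ge0$ let $$\alpha_i = \frac{1}{a}\left(\frac{i+p}{p}\right)^{p-1},\quad \beta_i = L+\frac{b\sigma}{R}(i+p+1)^{\frac{2p-1}{2}},\quad B_i = a\alpha_i^2=\frac1a\left(\frac{i+p}{p}\right)^{2p-2}.$$ Then for every $\Omega\ge0$ and $k\ge1$ the sequence $y_k$ generated by the Stochastic Intermediate Gradient Method (SIGM, described in the context) satisfies $$\mathbb{P}\left(\varphi(y_k)-\varphi^*>\frac{C_1LR^2}{k^p}+\frac{C_2(1+\Omega)\sigma R}{\sqrt k}+C_3k^{p-1}\delta+\frac{C_4D\sigma\sqrt\Omega}{\sqrt k}\right)$$ $$\le\mathbb{P}\Biggl(\varphi(y_k)-\varphi^*>\frac{LR^2p^p2^{\frac{2p-3}{2}}}{(k+p)^p}+\frac{(1+\Omega)\sigma R\,2^{\frac{3+2p}{4}}\sqrt p\,(k+p+2)^{p-\frac12}}{(k+p)^p}$$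 $$+2^{2p-1}\left(\left(\frac{k+p}{p}\right)^{p-1}+1\right)\delta+\frac{2D\sigma\sqrt{6\Omega p}}{\sqrt{k+p}}\Biggr)\le3\exp(-\Omega),$$ where $C_1=4\sqrt2$, $C_2=16\sqrt2$, $C_3=48$, $C_4=4\sqrt3$.
   Context: $E$ is a finite-dimensional real vector space with norm $\|\cdot\|$, $E^*$ its dual, $\langle g,x\rangle$ the value of $g\in E^*$ at $x\in E$, $\|g\|_*=\sup\{\langle g,y\rangle:\|y\|\le1\}$. The problem is $\min_{x\in Q}\{\varphi(x):=f(x)+h(x)\}$, with $Q\subset E$ closed convex, $h$ a simple convex function (the auxiliary minimization problems below are solvable), and $f$ convex. $x^*$ is a solution and $\varphi^*=\varphi(x^* )$. Stochastic inexact oracle: there are $L>0$, $\delta\ge0$, $\sigma\ge 0$ such that for every $x\in Q$ there exist $f_{\delta,L}(x)\in\mathbb{R}$, $g_{\delta,L}(x)\in E^*$ with $$0\le f(y)-f_{\delta,L}(x)-\langle g_{\delta,L}(x),y-x\rangle\le\frac L2\|x-y\|^2+\delta\quad\forall y\in Q.$$ The method uses stochastic approximations $F_{\delta,L}(x,\xi)$, $G_{\delta,L}(x,\xi)$, where $\xi$ is a random variable, such that $\mathbb{E}_\xi F_{\delta,L}(x,\xi)=f_{\delta,L}(x)$, $\mathbb{E}_\xi G_{\delta,L}(x,\xi)=g_{\delta,L}(x)$, $\mathbb{E}_\xi\|G_{\delta,L}(x,\xi)-g_{\delta,L}(x)\|_*^2\le\sigma^2$. Prox-function: $d$ is differentiable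 and strongly convex with parameter $1$ on $Q$ w.r.t. $\|\cdot\|$; $x_0$ is its minimizer on $Q$, $d(x_0)=0$, and $d(x)\ge\frac12\|x-x_0\|^2$ on $Q$. Bregman distance: $V(x,z)=d(x)-d(z)-\langle\nabla d(z),x-z\rangle$. SIGM: given sequences $\{\alpha_i\},\{\beta_i\},\{B_i\}$, put $A_k=\sum_{i=0}^k\alpha_i$, $\tau_i=\alpha_{i+1}/B_{i+1}$. Compute $x_0=\arg\min_{x\in Q}d(x)$, draw $\xi_0$, and set $y_0=\arg\min_{x\in Q}\{\beta_0d(x)+\alpha_0\langle G_{\delta,L}(x_0,\xi_0),x-x_0\rangle+\alpha_0h(x)\}$. For $k=0,1,\dots$: 1. $z_k=\arg\min_{x\in Q}\{\beta_kd(x)+\sum_{i=0}^k\alpha_i\langle G_{\delta,L}(x_i,\xi_i),x-x_i\rangle+A_kh(x)\}$; 2. $x_{k+1}=\tau_kz_k+(1-\tau_k)y_k$; draw $\xi_{k+1}$ and compute $G_{\delta,L}(x_{k+1},\xi_{k+1})$; 3. $\hat x_{k+1}=\arg\min_{x\in Q}\{\beta_kV(x,z_k)+\alpha_{k+1}\langle G_{\delta,L}(x_{k+1},\xi_{k+1}),x-z_k\rangle+\alpha_{k+1}h(x)\}$; 4. $w_{k+1}=\tau_k\hat x_{k+1}+(1-\tau_k)y_k$; 5. $y_{k+1}=\frac{A_{k+1}-B_{k+1}}{A_{k+1}}y_k+\frac{B_{k+1}}{A_{k+1}}w_{k+1}$. *)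

theory Defs
  imports "HOL-Analysis.Analysis" "HOL-Probability.Probability"
begin

text \<open>
  The space \<open>E\<close> is a type of class \<open>real_normed_vector\<close>, so its norm is arbitrary (not necessarily
  Euclidean). Its dual is the type \<open>E \<Rightarrow>\<^sub>L real\<close>, whose norm is the operator norm, that is the dual norm
  \<open>\<parallel>g\<parallel>\<^sub>* = sup {\<langle>g, y\<rangle> : \<parallel>y\<parallel> \<le> 1}\<close>.
\<close>

definition strongly_convex_on :: "'e::real_normed_vector set \<Rightarrow> real \<Rightarrow> ('e \<Rightarrow> real) \<Rightarrow> bool" where
  "strongly_convex_on Q m d \<longleftrightarrow> convex Q \<and>
    (\<forall>x\<in>Q. \<forall>y\<in>Q. \<forall>u\<ge>0. \<forall>v\<ge>0. u + v = 1 \<longrightarrow>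
      d (u *\<^sub>R x + v *\<^sub>R y) \<le> u * d x + v * d y - m / 2 * u * v * (norm (x - y))\<^sup>2)"

definition prox_function :: "'e::real_normed_vector set \<Rightarrow> ('e \<Rightarrow> real) \<Rightarrow> 'e \<Rightarrow> bool" where
  "prox_function Q d x0 \<longleftrightarrow>
    d differentiable_on Q \<and> strongly_convex_on Q 1 d \<and>
    is_arg_min d (\<lambda>u. u \<in> Q) x0 \<and> d x0 = 0 \<and>
    (\<forall>u\<in>Q. d u \<ge> 1 / 2 * (norm (u - x0))\<^sup>2)"

text \<open>
  The derivative of \<open>d\<close> at \<open>z\<close> within the convex set \<open>Q\<close> need not be unique if \<open>Q\<close> has empty interior,
  but its value on \<open>x - z\<close> is, for \<open>x\<close> and \<open>z\<close> in \<open>Q\<close>; only such arguments are used.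
\<close>

definition bregman_distance ::
    "'e::real_normed_vector set \<Rightarrow> ('e \<Rightarrow> real) \<Rightarrow> 'e \<Rightarrow> 'e \<Rightarrow> real" where
  "bregman_distance Q d x z = d x - d z - frechet_derivative d (at z within Q) (x - z)"

definition inexact_oracle ::
    "'e::real_normed_vector set \<Rightarrow> ('e \<Rightarrow> real) \<Rightarrow> real \<Rightarrow> real \<Rightarrow>
      ('e \<Rightarrow> real) \<Rightarrow> ('e \<Rightarrow> 'e \<Rightarrow>\<^sub>L real) \<Rightarrow> bool" where
  "inexact_oracle Q f L \<delta> fo go \<longleftrightarrow>
    (\<forall>x\<in>Q. \<forall>y\<in>Q.
      0 \<le> f y - fo x - blinfun_apply (go x) (y - x) \<and>
      f y - fo x - blinfun_apply (go x) (y - x) \<le> L / 2 * (norm (x - y))\<^sup>2 + \<delta>)"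

text \<open>
  \<open>P\<close> is the distribution of the noise variable. The expectation of the covector-valued variable
  \<open>G x\<close> is taken coordinatewise, i.e. after evaluation at every \<open>u\<close>, which for a finite-dimensional
  space is the expectation of a random covector. The nonnegative variable in the variance bound is
  integrated with the extended nonnegative integral, so the bound entails integrability. Joint
  measurability of \<open>G\<close> is what makes \<open>G (x\<^sub>k) (\<xi>\<^sub>k)\<close> a random covector at a random point \<open>x\<^sub>k\<close>.
\<close>

definition stochastic_approximation ::
    "'e::real_normed_vector set \<Rightarrow> 'w measure \<Rightarrow> real \<Rightarrow> ('e \<Rightarrow> real) \<Rightarrow> ('e \<Rightarrow> 'e \<Rightarrow>\<^sub>L real) \<Rightarrow>
      ('e \<Rightarrow> 'w \<Rightarrow> real) \<Rightarrow> ('e \<Rightarrow> 'w \<Rightarrow> 'e \<Rightarrow>\<^sub>L real) \<Rightarrow> bool" where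
  "stochastic_approximation Q P \<sigma> fo go F G \<longleftrightarrow>
    (\<lambda>(x, s). G x s) \<in> borel_measurable (restrict_space borel Q \<Otimes>\<^sub>M P) \<and>
    (\<forall>x\<in>Q.
      has_bochner_integral P (F x) (fo x) \<and>
      (\<forall>u. has_bochner_integral P (\<lambda>s. blinfun_apply (G x s) u) (blinfun_apply (go x) u)) \<and>
      (\<integral>\<^sup>+s. ennreal ((norm (G x s - go x))\<^sup>2) \<partial>P) \<le> ennreal (\<sigma>\<^sup>2))"

definition light_tail ::
    "'e::real_normed_vector set \<Rightarrow> 'w measure \<Rightarrow> real \<Rightarrow> ('e \<Rightarrow> 'e \<Rightarrow>\<^sub>L real) \<Rightarrow>
      ('e \<Rightarrow> 'w \<Rightarrow> 'e \<Rightarrow>\<^sub>L real) \<Rightarrow> bool" where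
  "light_tail Q P \<sigma> go G \<longleftrightarrow>
    (\<forall>x\<in>Q. (\<integral>\<^sup>+s. ennreal (exp ((norm (G x s - go x))\<^sup>2 / \<sigma>\<^sup>2)) \<partial>P) \<le> ennreal (exp 1))"

text \<open>
  \<open>sigm_run\<close> describes one sample path of the method, for a realisation \<open>s\<close> of the noise sequence:
  \<open>x\<close>, \<open>y\<close>, \<open>z\<close>, \<open>xh\<close>, \<open>w\<close> are sequences of iterates satisfying all the steps (\<open>xh 0\<close> and \<open>w 0\<close> are
  not used). Solvability of the auxiliary minimization problems is part of the predicate.
\<close>

definition sigm_run ::
    "'e::real_normed_vector set \<Rightarrow> ('e \<Rightarrow> real) \<Rightarrow> ('e \<Rightarrow> real) \<Rightarrow>
      (nat \<Rightarrow> real) \<Rightarrow> (nat \<Rightarrow> real) \<Rightarrow> (nat \<Rightarrow> real) \<Rightarrow>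
      ('e \<Rightarrow> 'w \<Rightarrow> 'e \<Rightarrow>\<^sub>L real) \<Rightarrow> (nat \<Rightarrow> 'w) \<Rightarrow>
      (nat \<Rightarrow> 'e) \<Rightarrow> (nat \<Rightarrow> 'e) \<Rightarrow> (nat \<Rightarrow> 'e) \<Rightarrow> (nat \<Rightarrow> 'e) \<Rightarrow> (nat \<Rightarrow> 'e) \<Rightarrow> bool" where
  "sigm_run Q d h \<alpha> \<beta> B G s x y z xh w \<longleftrightarrow>
    (let A = (\<lambda>k. \<Sum>i\<le>k. \<alpha> i);
         \<tau> = (\<lambda>i. \<alpha> (Suc i) / B (Suc i));
         g = (\<lambda>i. blinfun_apply (G (x i) (s i)))
     in
      is_arg_min d (\<lambda>u. u \<in> Q) (x 0) \<and>
      is_arg_min (\<lambda>u. \<beta> 0 * d u + \<alpha> 0 * g 0 (u - x 0) + \<alpha> 0 * h u) (\<lambda>u. u \<in> Q) (y 0) \<and>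
      (\<forall>k.
        is_arg_min (\<lambda>u. \<beta> k * d u + (\<Sum>i\<le>k. \<alpha> i * g i (u - x i)) + A k * h u)
          (\<lambda>u. u \<in> Q) (z k) \<and>
        x (Suc k) = \<tau> k *\<^sub>R z k + (1 - \<tau> k) *\<^sub>R y k \<and>
        is_arg_min (\<lambda>u. \<beta> k * bregman_distance Q d u (z k) +
            \<alpha> (Suc k) * g (Suc k) (u - z k) + \<alpha> (Suc k) * h u)
          (\<lambda>u. u \<in> Q) (xh (Suc k)) \<and>
        w (Suc k) = \<tau> k *\<^sub>R xh (Suc k) + (1 - \<tau> k) *\<^sub>R y k \<and>
        y (Suc k) = ((A (Suc k) - B (Suc k)) / A (Suc k)) *\<^sub>R y k
          + (B (Suc k) / A (Suc k)) *\<^sub>R w (Suc k)))"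

end

theory Submission
  imports Defs
begin

text \<open>
  Let \<open>\<Delta>\<^sub>i = G(x\<^sub>i, \<xi>\<^sub>i) - g(x\<^sub>i)\<close>. On every sample path an estimate-sequence induction gives
  \<open>A\<^sub>k (\<phi>(y\<^sub>k) - \<phi>*) \<le> \<beta>\<^sub>k d(x*) + \<Sum> B\<^sub>i \<delta> + \<Sum> B\<^sub>i \<parallel>\<Delta>\<^sub>i\<parallel>\<^sup>2 / (2 (a \<beta>\<^bsub>i-1\<^esub> - L)) + \<Sum> \<alpha>\<^sub>i \<langle>\<Delta>\<^sub>i, x* - z\<^bsub>i-1\<^esub>\<rangle>\<close>,
  with \<open>x\<^sub>0\<close> in place of \<open>z\<^bsub>-1\<^esub>\<close>. The quadratic sum has an exponential moment by convexity of \<open>exp\<close>,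
  so Markov's inequality bounds it with probability at least \<open>1 - exp (-\<Omega>)\<close>. The last sum is a
  martingale with light-tailed increments, since \<open>z\<^bsub>i-1\<^esub>\<close> depends only on the noise before step \<open>i\<close>;
  the inequality \<open>exp t \<le> t + exp (t\<^sup>2)\<close> bounds its conditional moment generating function and
  Chernoff's method gives another \<open>exp (-\<Omega>)\<close>. The moments can be computed because the iterates are
  measurable: a minimizer of a strongly convex function depends Lipschitz continuously on a linear
  perturbation. If \<open>\<sigma> = 0\<close>, the noise vanishes almost surely and only the deterministic part is left.
\<close>

section \<open>Finite-dimensional normed spaces\<close>

text \<open>Two competing costs fix the parameters. A larger \<open>\<beta>\<close> widens the gap
  \<open>a * \<beta> (i - 1) - L\<close> and so shrinks the quadratic noise sum, but it raises
  \<open>\<beta> k * d xs\<close>. The growth exponent \<open>p - 1 / 2\<close> balances the two,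
  and with the given \<open>b\<close> each takes (up to the factor \<open>1 + \<Omega>\<close>) at
  most half of \<open>b * \<sigma> * R * (k + p + 2) powr (p - 1 / 2)\<close>. The relation
  \<open>B i = a * (\<alpha> i)\<^sup>2\<close> is what makes \<open>a * \<beta> (i - 1)\<close> the
  curvature that a step can absorb. The martingale part has slack: Chernoff's method produces the
  constant 5, while the threshold provides 24 before the weights are compared.

  The obstacle on the probabilistic side is that the run is specified path by path: the iterates are
  merely minimizers for each sample, so their measurability has to be proved before any moment makes
  sense. The delicate iterate is \<open>xh\<close>, whose objective contains a derivative within
  \<open>Q\<close> at a random point, which is determined only on differences of points of
  \<open>Q\<close>. This is why coordinates are built from such differences.\<close>

lemma span_coefficient_bound:
  fixes v :: "'a::real_normed_vector"
  assumes cl: "closed (span S)" and v: "v \<notin> span S"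
  obtains \<epsilon> where "\<epsilon> > 0" "\<And>u c. u - c *\<^sub>R v \<in> span S \<Longrightarrow> \<epsilon> * \<bar>c\<bar> \<le> norm u"
proof
  have ne: "span S \<noteq> {}"
    using span_zero by blast
  \<comment> \<open>The constant is the distance from \<open>v\<close> to the closed subspace:
    dividing \<open>u - c *\<^sub>R v\<close> by \<open>- c\<close> gives a point of
    \<open>span S\<close> at distance \<open>norm u / \<bar>c\<bar>\<close> from
    \<open>v\<close>.\<close>
  show "infdist v (span S) > 0"
    using in_closed_iff_infdist_zero[OF cl ne, of v] v infdist_nonneg[of v "span S"] by linarith
  fix u c assume u: "u - c *\<^sub>R v \<in> span S"
  show "infdist v (span S) * \<bar>c\<bar> \<le> norm u"
  proof (cases "c = 0")
    case False
    have "(- 1 / c) *\<^sub>R (u - c *\<^sub>R v) \<in> span S"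
      using u by (rule span_scale)
    then have "infdist v (span S) \<le> dist v ((- 1 / c) *\<^sub>R (u - c *\<^sub>R v))"
      by (rule infdist_le)
    also have "\<dots> = norm ((1 / c) *\<^sub>R u)"
      using False by (simp add: dist_norm algebra_simps)
    also have "\<dots> = norm u / \<bar>c\<bar>"
      by simp
    finally show ?thesis
      using False by (simp add: field_simps)
  qed simp
qed

text \<open>When a vector \<open>v\<close> is added, the coefficient bound makes the
  \<open>v\<close>-coefficients of a convergent sequence Cauchy. The sequence then splits into two
  convergent parts, one of them in the smaller closed span.\<close>

lemma closed_span_finite:
  fixes S :: "'a::real_normed_vector set"
  assumes "finite S"
  shows "closed (span S)"
  using assms
proof (induction S)
  case empty
  then show ?case by simp
next
  case (insert v S)
  show ?case
  proof (cases "v \<in> span S")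
    case True
    then show ?thesis using insert.IH by (simp add: span_redundant)
  next
    case False
    obtain \<epsilon> where \<epsilon>: "\<epsilon> > 0" and bound: "\<And>u c. u - c *\<^sub>R v \<in> span S \<Longrightarrow> \<epsilon> * \<bar>c\<bar> \<le> norm u"
      by (rule span_coefficient_bound[OF insert.IH False]) blast
    show ?thesis
      unfolding closed_sequential_limits
    proof (intro allI impI, elim conjE)
      fix x l assume x: "\<forall>n. x n \<in> span (insert v S)" and lim: "x \<longlonglongrightarrow> l"
      have "\<exists>c. x n - c *\<^sub>R v \<in> span S" for n
        using x span_breakdown_eq[of "x n" v S] by blast
      then obtain c where c: "\<And>n. x n - c n *\<^sub>R v \<in> span S"
        by metis
      have diff: "\<epsilon> * \<bar>c m - c n\<bar> \<le> norm (x m - x n)" for m n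
      proof (rule bound)
        have "(x m - c m *\<^sub>R v) - (x n - c n *\<^sub>R v) \<in> span S"
          by (rule span_diff[OF c c])
        then show "x m - x n - (c m - c n) *\<^sub>R v \<in> span S"
          by (simp add: algebra_simps)
      qed
      have "Cauchy c"
      proof (rule metric_CauchyI)
        fix e :: real assume "e > 0"
        moreover have "Cauchy x" using lim by (rule LIMSEQ_imp_Cauchy)
        ultimately obtain N where N: "\<And>m n. m \<ge> N \<Longrightarrow> n \<ge> N \<Longrightarrow> dist (x m) (x n) < \<epsilon> * e"
          using \<epsilon> metric_CauchyD[of x "\<epsilon> * e"] by auto
        have "dist (c m) (c n) < e" if "m \<ge> N" "n \<ge> N" for m n
        proof -
          have "\<epsilon> * \<bar>c m - c n\<bar> < \<epsilon> * e"
            using diff[of m n] N[OF that] by (simp add: dist_norm)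
          then show ?thesis using \<epsilon> by (simp add: dist_real_def)
        qed
        then show "\<exists>M. \<forall>m\<ge>M. \<forall>n\<ge>M. dist (c m) (c n) < e" by blast
      qed
      then obtain k where "c \<longlonglongrightarrow> k"
        using Cauchy_convergent_iff convergent_def by blast
      then have "(\<lambda>n. x n - c n *\<^sub>R v) \<longlonglongrightarrow> l - k *\<^sub>R v"
        using lim by (intro tendsto_intros)
      then have "l - k *\<^sub>R v \<in> span S"
        by (rule closed_sequentially[OF insert.IH c])
      then show "l \<in> span (insert v S)"
        using span_breakdown_eq[of l v S] by blast
    qed
  qed
qed

text \<open>The basis vector \<open>e\<close> has positive distance from the closed span of the
  others, and the reciprocal of this distance bounds its coordinate functional.\<close>

lemma bounded_linear_representation:
  fixes C :: "'a::real_normed_vector set"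
  assumes fin: "finite C" and ind: "independent C" and span: "span C = UNIV" and e: "e \<in> C"
  shows "bounded_linear (\<lambda>u. representation C u e)"
proof -
  have "e \<notin> span (C - {e})"
    using ind e unfolding dependent_def by blast
  then obtain \<epsilon> where \<epsilon>: "\<epsilon> > 0"
    and bound: "\<And>u c. u - c *\<^sub>R e \<in> span (C - {e}) \<Longrightarrow> \<epsilon> * \<bar>c\<bar> \<le> norm u"
    by (rule span_coefficient_bound[OF closed_span_finite[OF finite_Diff[OF fin]]]) blast
  show ?thesis
  proof (rule bounded_linear_intro)
    show "representation C (x + y) e = representation C x e + representation C y e" for x y
      using real_vector.representation_add[OF ind, of y x] span by (simp add: add.commute)
    show "representation C (r *\<^sub>R x) e = r *\<^sub>R representation C x e" for r x
      using real_vector.representation_scale[OF ind, of x r] span by simp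
    fix u
    have "u = (\<Sum>b\<in>C. representation C u b *\<^sub>R b)"
      using real_vector.sum_representation_eq[OF ind, of u C] span fin by simp
    also have "\<dots> = representation C u e *\<^sub>R e + (\<Sum>b\<in>C - {e}. representation C u b *\<^sub>R b)"
      using fin e by (rule sum.remove)
    finally have "u - representation C u e *\<^sub>R e = (\<Sum>b\<in>C - {e}. representation C u b *\<^sub>R b)"
      by (metis add_diff_cancel_left')
    also have "\<dots> \<in> span (C - {e})"
      by (intro span_sum span_scale span_base)
    finally show "norm (representation C u e) \<le> norm u * (1 / \<epsilon>)"
      using bound[of u] \<epsilon> by (simp add: field_simps)
  qed
qed

text \<open>The vectors \<open>v i\<close> are taken from \<open>V\<close> itself, because for
  \<open>V\<close> the set of differences of points of \<open>Q\<close> only values on such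
  differences will be known to be measurable. The basis of \<open>span V\<close> is extended to one
  of the whole space so that the \<open>c i\<close> are functionals defined everywhere.\<close>

lemma finite_dim_coordinates:
  fixes E V :: "'a::real_normed_vector set"
  assumes E: "finite E" "span E = UNIV"
  obtains n :: nat and v :: "nat \<Rightarrow> 'a" and c :: "nat \<Rightarrow> 'a \<Rightarrow>\<^sub>L real"
  where "\<forall>i<n. v i \<in> V"
    and "\<forall>u\<in>span V. u = (\<Sum>i<n. blinfun_apply (c i) u *\<^sub>R v i)"
proof -
  obtain C0 where C0: "C0 \<subseteq> V" "independent C0" "V \<subseteq> span C0"
    using real_vector.maximal_independent_subset[of V] by blast
  obtain C where C: "C0 \<subseteq> C" "independent C" "UNIV \<subseteq> span C"
    by (rule real_vector.maximal_independent_subset_extend[OF subset_UNIV C0(2)])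
  have finC: "finite C"
    using real_vector.independent_span_bound[OF E(1) C(2)] E(2) by simp
  then have finC0: "finite C0"
    using C(1) finite_subset by blast
  have bl: "bounded_linear (\<lambda>u. representation C u e)" if "e \<in> C0" for e
    using bounded_linear_representation finC C that by blast
  obtain w where w: "bij_betw w {..<card C0} C0"
    using ex_bij_betw_nat_finite[OF finC0] by (auto simp: atLeast0LessThan)
  have wC0: "w i \<in> C0" if "i < card C0" for i
    using w that by (auto simp: bij_betw_def)
  show thesis
  proof (rule that[of "card C0" w "\<lambda>i. Blinfun (\<lambda>u. representation C u (w i))"]; intro allI impI ballI)
    show "w i \<in> V" if "i < card C0" for i
      using wC0[OF that] C0 by blast
    fix u assume "u \<in> span V"
    then have u: "u \<in> span C0"
      using real_vector.span_minimal[OF C0(3)] by blast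
    have "u = (\<Sum>e\<in>C0. representation C0 u e *\<^sub>R e)"
      using real_vector.sum_representation_eq[OF C0(2) u finC0] by simp
    also have "\<dots> = (\<Sum>e\<in>C0. representation C u e *\<^sub>R e)"
      using real_vector.representation_extend[OF C(2) u C(1)] by simp
    also have "\<dots> = (\<Sum>i<card C0. representation C u (w i) *\<^sub>R w i)"
      by (rule sum.reindex_bij_betw[OF w, symmetric])
    also have "\<dots> = (\<Sum>i<card C0. blinfun_apply (Blinfun (\<lambda>u. representation C u (w i))) u *\<^sub>R w i)"
      using bl wC0 by (intro sum.cong) (auto simp: bounded_linear_Blinfun_apply)
    finally show "u = (\<Sum>i<card C0. blinfun_apply (Blinfun (\<lambda>u. representation C u (w i))) u *\<^sub>R w i)" .
  qed
qed

text \<open>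
  The library rules on measurability of sums require a second-countable codomain, which an abstract
  normed space is not known to be; they are recovered here from coordinates, that is, by factoring
  through the second-countable space \<open>nat \<Rightarrow> real\<close>.
\<close>

lemma borel_measurable_lincomb:
  fixes v :: "nat \<Rightarrow> 'a::real_normed_vector"
  assumes r: "\<And>i. i < n \<Longrightarrow> r i \<in> borel_measurable N"
  shows "(\<lambda>\<omega>. \<Sum>i<n. r i \<omega> *\<^sub>R v i) \<in> borel_measurable N"
proof -
  have "(\<lambda>\<omega> i. if i < n then r i \<omega> else 0) \<in> borel_measurable N"
  proof (rule measurable_coordinatewise_then_product)
    show "(\<lambda>\<omega>. if i < n then r i \<omega> else 0) \<in> borel_measurable N" for i
      using r[of i] by (cases "i < n") auto
  qed
  moreover have "(\<lambda>c :: nat \<Rightarrow> real. \<Sum>i<n. c i *\<^sub>R v i) \<in> borel_measurable borel"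
    by (intro borel_measurable_continuous_onI continuous_intros
        continuous_on_product_then_coordinatewise[OF continuous_on_id])
  ultimately have "(\<lambda>\<omega>. \<Sum>i<n. (if i < n then r i \<omega> else 0) *\<^sub>R v i) \<in> borel_measurable N"
    by (rule measurable_compose)
  then show ?thesis
    by simp
qed

lemma borel_measurable_blinfun_apply:
  fixes c :: "'a::real_normed_vector \<Rightarrow>\<^sub>L 'b::real_normed_vector"
  assumes "f \<in> borel_measurable N"
  shows "(\<lambda>\<omega>. blinfun_apply c (f \<omega>)) \<in> borel_measurable N"
  by (rule measurable_compose[OF assms borel_measurable_continuous_onI])
    (intro continuous_intros)

lemma borel_measurable_blinfun_eval:
  fixes g :: "'o \<Rightarrow> 'a::real_normed_vector \<Rightarrow>\<^sub>L 'b::real_normed_vector"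
  assumes "g \<in> borel_measurable N"
  shows "(\<lambda>\<omega>. blinfun_apply (g \<omega>) u) \<in> borel_measurable N"
  by (rule measurable_compose[OF assms borel_measurable_continuous_onI])
    (intro continuous_intros)

context
  fixes E :: "'a::real_normed_vector set"
  assumes E: "finite E" "span E = UNIV"
begin

lemma borel_measurable_add_scaleR_finite_dim:
  fixes f g :: "'o \<Rightarrow> 'a"
  assumes "f \<in> borel_measurable N" "g \<in> borel_measurable N"
  shows "(\<lambda>\<omega>. r *\<^sub>R f \<omega> + s *\<^sub>R g \<omega>) \<in> borel_measurable N"
proof -
  obtain n :: nat and v :: "nat \<Rightarrow> 'a" and c
    where "\<forall>i<n. v i \<in> UNIV"
      and "\<forall>u\<in>span UNIV. u = (\<Sum>i<n. blinfun_apply (c i) u *\<^sub>R v i)"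
    by (rule finite_dim_coordinates[OF E]) (rule that)
  then have vc: "u = (\<Sum>i<n. blinfun_apply (c i) u *\<^sub>R v i)" for u
    by simp
  have "(\<lambda>\<omega>. \<Sum>i<n. (r * c i (f \<omega>) + s * c i (g \<omega>)) *\<^sub>R v i) \<in> borel_measurable N"
    by (intro borel_measurable_lincomb borel_measurable_add borel_measurable_times
        borel_measurable_const borel_measurable_blinfun_apply assms)
  moreover have "(\<Sum>i<n. (r * c i (f \<omega>) + s * c i (g \<omega>)) *\<^sub>R v i) = r *\<^sub>R f \<omega> + s *\<^sub>R g \<omega>" for \<omega>
    using vc[of "r *\<^sub>R f \<omega> + s *\<^sub>R g \<omega>", symmetric] by (simp add: blinfun.bilinear_simps)
  ultimately show ?thesis by simp
qed

lemma borel_measurable_blinfun_finite_dim: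
  fixes g :: "'o \<Rightarrow> 'a \<Rightarrow>\<^sub>L real"
  assumes "\<And>u. (\<lambda>\<omega>. blinfun_apply (g \<omega>) u) \<in> borel_measurable N"
  shows "g \<in> borel_measurable N"
proof -
  obtain n :: nat and v :: "nat \<Rightarrow> 'a" and c
    where "\<forall>i<n. v i \<in> UNIV"
      and "\<forall>u\<in>span UNIV. u = (\<Sum>i<n. blinfun_apply (c i) u *\<^sub>R v i)"
    by (rule finite_dim_coordinates[OF E]) (rule that)
  then have vc: "u = (\<Sum>i<n. blinfun_apply (c i) u *\<^sub>R v i)" for u
    by simp
  have "(\<lambda>\<omega>. \<Sum>i<n. g \<omega> (v i) *\<^sub>R c i) \<in> borel_measurable N"
    by (intro borel_measurable_lincomb assms)
  moreover have "(\<Sum>i<n. g \<omega> (v i) *\<^sub>R c i) = g \<omega>" for \<omega>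
  proof (rule blinfun_eqI)
    fix u
    have "g \<omega> u = g \<omega> (\<Sum>i<n. c i u *\<^sub>R v i)"
      using vc[of u, symmetric] by simp
    also have "\<dots> = (\<Sum>i<n. g \<omega> (v i) *\<^sub>R c i) u"
      by (simp add: blinfun.bilinear_simps blinfun.sum_left blinfun.sum_right mult.commute)
    finally show "(\<Sum>i<n. g \<omega> (v i) *\<^sub>R c i) u = g \<omega> u" by simp
  qed
  ultimately show ?thesis by simp
qed

lemma borel_measurable_blinfun_apply_finite_dim:
  fixes g :: "'o \<Rightarrow> 'a \<Rightarrow>\<^sub>L real"
  assumes "\<And>u. (\<lambda>\<omega>. blinfun_apply (g \<omega>) u) \<in> borel_measurable N" and "f \<in> borel_measurable N"
  shows "(\<lambda>\<omega>. blinfun_apply (g \<omega>) (f \<omega>)) \<in> borel_measurable N"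
proof -
  obtain n :: nat and v :: "nat \<Rightarrow> 'a" and c
    where "\<forall>i<n. v i \<in> UNIV"
      and "\<forall>u\<in>span UNIV. u = (\<Sum>i<n. blinfun_apply (c i) u *\<^sub>R v i)"
    by (rule finite_dim_coordinates[OF E]) (rule that)
  then have vc: "u = (\<Sum>i<n. blinfun_apply (c i) u *\<^sub>R v i)" for u
    by simp
  have "(\<lambda>\<omega>. \<Sum>i<n. c i (f \<omega>) * g \<omega> (v i)) \<in> borel_measurable N"
    by (intro borel_measurable_sum borel_measurable_times borel_measurable_blinfun_apply assms)
  moreover have "(\<Sum>i<n. c i (f \<omega>) * g \<omega> (v i)) = g \<omega> (f \<omega>)" for \<omega>
    using arg_cong[OF vc[of "f \<omega>", symmetric], of "g \<omega>"]
    by (simp add: blinfun.bilinear_simps blinfun.sum_right)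
  ultimately show ?thesis by simp
qed

end

text \<open>The preimage of an open set under \<open>f\<close> is the preimage under
  \<open>S\<close> of a union of balls. This union is open however many balls it has, and it is
  taken in the target space of \<open>S\<close>, not in its range, which may fail to be a Borel
  set.\<close>

lemma borel_measurable_lipschitz_factor:
  fixes S :: "'o \<Rightarrow> 'a::metric_space" and f :: "'o \<Rightarrow> 'b::metric_space"
  assumes S: "S \<in> borel_measurable N"
    and lip: "\<And>\<omega> \<omega>'. \<omega> \<in> space N \<Longrightarrow> \<omega>' \<in> space N \<Longrightarrow> dist (f \<omega>) (f \<omega>') \<le> C * dist (S \<omega>) (S \<omega>')"
    and C: "C > 0"
  shows "f \<in> borel_measurable N"
proof (rule borel_measurableI)
  fix U :: "'b set" assume "open U"
  then obtain \<epsilon> where \<epsilon>: "\<And>u. u \<in> U \<Longrightarrow> \<epsilon> u > 0" "\<And>u v. u \<in> U \<Longrightarrow> dist v u < \<epsilon> u \<Longrightarrow> v \<in> U"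
    unfolding open_dist Ball_def by metis
  define W where "W = (\<Union>\<omega>\<in>{\<omega>\<in>space N. f \<omega> \<in> U}. ball (S \<omega>) (\<epsilon> (f \<omega>) / C))"
  have "f -` U \<inter> space N = S -` W \<inter> space N"
  proof (intro equalityI subsetI)
    fix \<omega> assume "\<omega> \<in> f -` U \<inter> space N"
    then show "\<omega> \<in> S -` W \<inter> space N"
      using \<epsilon>(1)[of "f \<omega>"] C unfolding W_def by auto
  next
    fix \<omega>' assume \<omega>': "\<omega>' \<in> S -` W \<inter> space N"
    then obtain \<omega> where \<omega>: "\<omega> \<in> space N" "f \<omega> \<in> U" "dist (S \<omega>) (S \<omega>') < \<epsilon> (f \<omega>) / C"
      unfolding W_def by auto
    have "dist (f \<omega>') (f \<omega>) \<le> C * dist (S \<omega>') (S \<omega>)"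
      using lip \<omega> \<omega>' by blast
    also have "\<dots> < \<epsilon> (f \<omega>)"
      using \<omega>(3) C by (simp add: field_simps dist_commute)
    finally show "\<omega>' \<in> f -` U \<inter> space N"
      using \<epsilon>(2)[OF \<omega>(2)] \<omega>' by auto
  qed
  moreover have "open W"
    unfolding W_def by auto
  ultimately show "f -` U \<inter> space N \<in> sets N"
    using measurable_sets[OF S, of W] by simp
qed

section \<open>Bregman distances and argmin maps\<close>

text \<open>On the segment from \<open>z\<close> to \<open>u\<close>, contained in \<open>Q\<close>
  by convexity, the chain rule turns a derivative within \<open>Q\<close> into a one-sided
  derivative of a real function. Hence its value on \<open>u - z\<close> does not depend on which
  derivative is selected.\<close>

lemma frechet_derivative_directional_limit:
  fixes d :: "'e::real_normed_vector \<Rightarrow> real"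
  assumes Q: "convex Q" and d: "d differentiable_on Q" and z: "z \<in> Q" and u: "u \<in> Q"
  shows "((\<lambda>t. (d (z + t *\<^sub>R (u - z)) - d z) / t)
    \<longlongrightarrow> frechet_derivative d (at z within Q) (u - z)) (at_right 0)"
proof -
  define \<gamma> where "\<gamma> = (\<lambda>t::real. z + t *\<^sub>R (u - z))"
  have \<gamma>Q: "\<gamma> ` {0..1} \<subseteq> Q"
  proof -
    have "\<gamma> t \<in> Q" if "t \<in> {0..1}" for t
      using convexD[OF Q z u, of "1 - t" t] that by (simp add: \<gamma>_def algebra_simps)
    then show ?thesis by blast
  qed
  have "d differentiable (at z within Q)"
    using d z by (simp add: differentiable_on_def)
  then have d': "(d has_derivative frechet_derivative d (at z within Q)) (at z within Q)"
    by (simp add: frechet_derivative_works)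
  have "(d has_derivative frechet_derivative d (at z within Q)) (at (\<gamma> 0) within \<gamma> ` {0..1})"
    using has_derivative_subset[OF d' \<gamma>Q] by (simp add: \<gamma>_def)
  moreover have "(\<gamma> has_derivative (\<lambda>t. t *\<^sub>R (u - z))) (at 0 within {0..1})"
    unfolding \<gamma>_def by (auto intro!: derivative_eq_intros)
  ultimately have "((\<lambda>t. d (\<gamma> t)) has_derivative
      (\<lambda>t. frechet_derivative d (at z within Q) (t *\<^sub>R (u - z)))) (at 0 within {0..1})"
    by (rule has_derivative_in_compose[rotated])
  moreover have "frechet_derivative d (at z within Q) (t *\<^sub>R (u - z))
      = t * frechet_derivative d (at z within Q) (u - z)" for t
    using linear_scale[OF has_derivative_linear[OF d'], of t "u - z"] by simp
  ultimately have "((\<lambda>t. d (\<gamma> t)) has_field_derivative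
      frechet_derivative d (at z within Q) (u - z)) (at 0 within {0..1})"
    unfolding has_field_derivative_def
    by (simp add: mult.commute[of "frechet_derivative d (at z within Q) (u - z)", abs_def])
  then show ?thesis
    by (simp add: has_field_derivative_iff at_within_Icc_at_right \<gamma>_def)
qed

lemma segment_eq: "z + t *\<^sub>R (u - z) = t *\<^sub>R u + (1 - t) *\<^sub>R (z::'e::real_vector)"
  by (simp add: algebra_simps)

text \<open>Divide the strong convexity inequality at \<open>z + t *\<^sub>R (u - z)\<close> by
  \<open>t\<close> and let \<open>t\<close> decrease to 0.\<close>

lemma bregman_distance_lower_bound:
  fixes d :: "'e::real_normed_vector \<Rightarrow> real"
  assumes d: "d differentiable_on Q" and sc: "strongly_convex_on Q m d"
    and z: "z \<in> Q" and u: "u \<in> Q"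
  shows "m / 2 * (norm (u - z))\<^sup>2 \<le> bregman_distance Q d u z"
proof -
  have Q: "convex Q" using sc by (simp add: strongly_convex_on_def)
  have "(d (z + t *\<^sub>R (u - z)) - d z) / t \<le> d u - d z - m / 2 * (1 - t) * (norm (u - z))\<^sup>2"
    if t: "0 < t" "t < 1" for t
  proof -
    have "d (t *\<^sub>R u + (1 - t) *\<^sub>R z)
        \<le> t * d u + (1 - t) * d z - m / 2 * t * (1 - t) * (norm (u - z))\<^sup>2"
      using sc z u t by (simp add: strongly_convex_on_def)
    then show ?thesis
      using t by (simp add: segment_eq field_simps)
  qed
  then have ev: "\<forall>\<^sub>F t in at_right 0. (d (z + t *\<^sub>R (u - z)) - d z) / t
      \<le> d u - d z - m / 2 * (1 - t) * (norm (u - z))\<^sup>2"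
    by (auto simp: eventually_at_right_field intro: exI[of _ 1])
  have "((\<lambda>t. d u - d z - m / 2 * (1 - t) * (norm (u - z))\<^sup>2)
      \<longlongrightarrow> d u - d z - m / 2 * (1 - 0) * (norm (u - z))\<^sup>2) (at_right 0)"
    by (intro tendsto_intros)
  from tendsto_le[OF _ this frechet_derivative_directional_limit[OF Q d z u] ev]
  show ?thesis by (simp add: bregman_distance_def)
qed

text \<open>First-order optimality with a nonsmooth summand: along the segment the increment of
  \<open>H\<close> is bounded by its chord, so only \<open>d\<close> has to be differentiated.
  Written with the Bregman distance, the condition becomes a growth bound around the
  minimizer.\<close>

lemma composite_argmin_bregman:
  fixes d :: "'e::real_normed_vector \<Rightarrow> real"
  assumes Q: "convex Q" and d: "d differentiable_on Q" and H: "convex_on Q H"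
    and min: "is_arg_min (\<lambda>u. \<beta> * d u + H u) (\<lambda>u. u \<in> Q) z" and u: "u \<in> Q"
  shows "\<beta> * d z + H z + \<beta> * bregman_distance Q d u z \<le> \<beta> * d u + H u"
proof -
  have z: "z \<in> Q" and le: "\<And>v. v \<in> Q \<Longrightarrow> \<beta> * d z + H z \<le> \<beta> * d v + H v"
    using min by (auto simp: is_arg_min_def not_less)
  have "0 \<le> \<beta> * ((d (z + t *\<^sub>R (u - z)) - d z) / t) + (H u - H z)" if t: "0 < t" "t < 1" for t
  proof -
    have "z + t *\<^sub>R (u - z) \<in> Q"
      using convexD[OF Q u z, of t "1 - t"] t by (simp add: segment_eq)
    then have "\<beta> * d z + H z \<le> \<beta> * d (z + t *\<^sub>R (u - z)) + H (z + t *\<^sub>R (u - z))"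
      by (rule le)
    moreover have "H (z + t *\<^sub>R (u - z)) \<le> t * H u + (1 - t) * H z"
      using convex_onD[OF H, of t z u] t z u by (simp add: segment_eq add.commute)
    ultimately have "0 \<le> \<beta> * (d (z + t *\<^sub>R (u - z)) - d z) + t * (H u - H z)"
      by (simp add: algebra_simps)
    then show ?thesis using t by (simp add: field_simps)
  qed
  then have ev: "\<forall>\<^sub>F t in at_right 0. 0 \<le> \<beta> * ((d (z + t *\<^sub>R (u - z)) - d z) / t) + (H u - H z)"
    by (auto simp: eventually_at_right_field intro: exI[of _ 1])
  have "((\<lambda>t. \<beta> * ((d (z + t *\<^sub>R (u - z)) - d z) / t) + (H u - H z))
      \<longlongrightarrow> \<beta> * frechet_derivative d (at z within Q) (u - z) + (H u - H z)) (at_right 0)"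
    by (intro tendsto_intros frechet_derivative_directional_limit Q d z u)
  from tendsto_lowerbound[OF this ev]
  have "0 \<le> \<beta> * frechet_derivative d (at z within Q) (u - z) + (H u - H z)"
    by simp
  then show ?thesis by (simp add: bregman_distance_def algebra_simps)
qed

lemma is_arg_min_shift:
  assumes "\<And>u v. P u \<Longrightarrow> P v \<Longrightarrow> J u - J v = J' u - (J' v :: real)"
  shows "is_arg_min J P z \<longleftrightarrow> is_arg_min J' P z"
proof -
  have "J u < J z \<longleftrightarrow> J' u < J' z" if "P u" "P z" for u
    using assms[OF that] by linarith
  then show ?thesis unfolding is_arg_min_def by blast
qed

text \<open>Apply the growth bound at each minimizer to the other one and add: \<open>d\<close> and
  \<open>H\<close> cancel, and only the difference of the linear parts survives.\<close>

lemma argmin_perturbation: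
  fixes d :: "'e::real_normed_vector \<Rightarrow> real" and g1 g2 :: "'e \<Rightarrow>\<^sub>L real"
  assumes d: "d differentiable_on Q" and sc: "strongly_convex_on Q 1 d" and \<beta>: "\<beta> \<ge> 0"
    and H: "convex_on Q H"
    and z1: "is_arg_min (\<lambda>u. \<beta> * d u + (H u + g1 u)) (\<lambda>u. u \<in> Q) z1"
    and z2: "is_arg_min (\<lambda>u. \<beta> * d u + (H u + g2 u)) (\<lambda>u. u \<in> Q) z2"
  shows "\<beta> * (norm (z1 - z2))\<^sup>2 \<le> (g1 - g2) (z2 - z1)"
proof -
  have Q: "convex Q" using sc by (simp add: strongly_convex_on_def)
  have zQ: "z1 \<in> Q" "z2 \<in> Q" using z1 z2 by (auto simp: is_arg_min_def)
  have cx: "convex_on Q (\<lambda>u. H u + blinfun_apply g u)" for g :: "'e \<Rightarrow>\<^sub>L real"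
    by (intro convex_on_add H convex_onI Q) (simp_all add: blinfun.bilinear_simps)
  have "\<beta> * (1 / 2 * (norm (z2 - z1))\<^sup>2) \<le> \<beta> * bregman_distance Q d z2 z1"
    "\<beta> * (1 / 2 * (norm (z1 - z2))\<^sup>2) \<le> \<beta> * bregman_distance Q d z1 z2"
    using mult_left_mono[OF bregman_distance_lower_bound[OF d sc] \<beta>] zQ by blast+
  moreover have
    "\<beta> * d z1 + (H z1 + g1 z1) + \<beta> * bregman_distance Q d z2 z1 \<le> \<beta> * d z2 + (H z2 + g1 z2)"
    "\<beta> * d z2 + (H z2 + g2 z2) + \<beta> * bregman_distance Q d z1 z2 \<le> \<beta> * d z1 + (H z1 + g2 z1)"
    using composite_argmin_bregman[OF Q d cx z1 zQ(2)] composite_argmin_bregman[OF Q d cx z2 zQ(1)]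
    by auto
  ultimately show ?thesis
    by (simp add: blinfun.bilinear_simps norm_minus_commute)
qed

text \<open>
  Since \<open>H\<close> need not be lower semicontinuous, measurable selection theorems do not apply; instead the minimizer is a Lipschitz function of the linear part. Only the values of
  \<open>g \<omega>\<close> on differences of points of \<open>Q\<close> are assumed measurable, because a derivative within \<open>Q\<close> is
  determined only there.
\<close>

lemma borel_measurable_argmin:
  fixes d :: "'e::real_normed_vector \<Rightarrow> real" and g :: "'o \<Rightarrow> 'e \<Rightarrow>\<^sub>L real"
  assumes E: "finite E" "span E = (UNIV :: 'e set)"
    and d: "d differentiable_on Q" and sc: "strongly_convex_on Q 1 d" and \<beta>: "\<beta> > 0"
    and H: "convex_on Q H"
    and g: "\<And>u v. u \<in> Q \<Longrightarrow> v \<in> Q \<Longrightarrow> (\<lambda>\<omega>. blinfun_apply (g \<omega>) (u - v)) \<in> borel_measurable N"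
    and J: "\<And>\<omega> u v. \<omega> \<in> space N \<Longrightarrow> u \<in> Q \<Longrightarrow> v \<in> Q \<Longrightarrow>
      J \<omega> u - J \<omega> v = \<beta> * (d u - d v) + (H u - H v) + g \<omega> (u - v)"
    and min: "\<And>\<omega>. \<omega> \<in> space N \<Longrightarrow> is_arg_min (J \<omega>) (\<lambda>u. u \<in> Q) (z \<omega>)"
  shows "z \<in> measurable N (restrict_space borel Q)"
proof -
  define V where "V = {u - v | u v. u \<in> Q \<and> v \<in> Q}"
  obtain n :: nat and v :: "nat \<Rightarrow> 'e" and c :: "nat \<Rightarrow> 'e \<Rightarrow>\<^sub>L real"
    where v: "\<forall>i<n. v i \<in> V"
      and vc: "\<forall>u\<in>span V. u = (\<Sum>i<n. blinfun_apply (c i) u *\<^sub>R v i)"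
    by (rule finite_dim_coordinates[OF E]) (rule that)
  \<comment> \<open>\<open>S \<omega>\<close> agrees with \<open>g \<omega>\<close> on differences
    of points of \<open>Q\<close>, hence gives the same minimizers, but it is assembled only from
    values known to be measurable. In other directions \<open>g \<omega>\<close> may depend on
    \<open>\<omega>\<close> in an arbitrary way.\<close>
  define S where "S \<omega> = (\<Sum>i<n. g \<omega> (v i) *\<^sub>R c i)" for \<omega>
  have S: "S \<in> borel_measurable N"
    unfolding S_def[abs_def]
  proof (rule borel_measurable_lincomb)
    fix i assume "i < n"
    then have "v i \<in> V" using v by blast
    then obtain u w where "u \<in> Q" "w \<in> Q" "v i = u - w"
      unfolding V_def by blast
    then show "(\<lambda>\<omega>. blinfun_apply (g \<omega>) (v i)) \<in> borel_measurable N"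
      using g[of u w] by simp
  qed
  have S_eq: "S \<omega> (u - w) = g \<omega> (u - w)" if "u \<in> Q" "w \<in> Q" for u w \<omega>
  proof -
    have "u - w = (\<Sum>i<n. c i (u - w) *\<^sub>R v i)"
      using that by (intro bspec[OF vc] span_base) (auto simp: V_def)
    then have "g \<omega> (u - w) = g \<omega> (\<Sum>i<n. c i (u - w) *\<^sub>R v i)" by (rule arg_cong)
    also have "\<dots> = S \<omega> (u - w)"
      by (simp add: S_def blinfun.sum_right blinfun.sum_left blinfun.scaleR_left blinfun.scaleR_right
          mult.commute)
    finally show ?thesis by simp
  qed
  have min': "is_arg_min (\<lambda>u. \<beta> * d u + (H u + S \<omega> u)) (\<lambda>u. u \<in> Q) (z \<omega>)" if "\<omega> \<in> space N" for \<omega>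
  proof -
    have "is_arg_min (J \<omega>) (\<lambda>u. u \<in> Q) (z \<omega>)
        \<longleftrightarrow> is_arg_min (\<lambda>u. \<beta> * d u + (H u + S \<omega> u)) (\<lambda>u. u \<in> Q) (z \<omega>)"
    proof (rule is_arg_min_shift)
      fix u w assume "u \<in> Q" "w \<in> Q"
      then show "J \<omega> u - J \<omega> w
          = (\<beta> * d u + (H u + S \<omega> u)) - (\<beta> * d w + (H w + S \<omega> w))"
        using J[OF that, of u w] S_eq[of u w \<omega>]
        by (simp add: blinfun.diff_right right_diff_distrib)
    qed
    then show ?thesis using min[OF that] by blast
  qed
  have "dist (z \<omega>) (z \<omega>') \<le> 1 / \<beta> * dist (S \<omega>) (S \<omega>')" if "\<omega> \<in> space N" "\<omega>' \<in> space N" for \<omega> \<omega>'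
  proof (cases "z \<omega> = z \<omega>'")
    case False
    have "\<beta> * (norm (z \<omega> - z \<omega>'))\<^sup>2 \<le> (S \<omega> - S \<omega>') (z \<omega>' - z \<omega>)"
      using \<beta> by (intro argmin_perturbation[OF d sc _ H] min' that) auto
    also have "\<dots> \<le> norm (S \<omega> - S \<omega>') * norm (z \<omega>' - z \<omega>)"
      using norm_blinfun[of "S \<omega> - S \<omega>'" "z \<omega>' - z \<omega>"] by simp
    finally have "(\<beta> * norm (z \<omega> - z \<omega>')) * norm (z \<omega> - z \<omega>')
        \<le> norm (S \<omega> - S \<omega>') * norm (z \<omega> - z \<omega>')"
      by (simp add: power2_eq_square norm_minus_commute mult.assoc)
    then have "\<beta> * norm (z \<omega> - z \<omega>') \<le> norm (S \<omega> - S \<omega>')"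
      using False by simp
    then show ?thesis
      using \<beta> by (simp add: dist_norm field_simps)
  qed (use \<beta> in simp)
  then have "z \<in> borel_measurable N"
    using \<beta> by (intro borel_measurable_lipschitz_factor[OF S, where C = "1 / \<beta>"]) auto
  moreover have "z \<in> space N \<rightarrow> Q"
    using min by (auto simp: is_arg_min_def)
  ultimately show ?thesis
    by (intro measurable_restrict_space2)
qed

text \<open>The derivative is a pointwise limit of difference quotients that are continuous in the
  base point on \<open>Q\<close>. These quotients are available only in directions
  \<open>u - z \<omega>\<close> staying in \<open>Q\<close>; a fixed direction \<open>u - v\<close>
  is the difference of two of them.\<close>

lemma borel_measurable_frechet_derivative_within:
  fixes d :: "'e::real_normed_vector \<Rightarrow> real"
  assumes Q: "convex Q" and d: "d differentiable_on Q"
    and z: "z \<in> measurable N (restrict_space borel Q)" and u: "u \<in> Q" "v \<in> Q"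
  shows "(\<lambda>\<omega>. frechet_derivative d (at (z \<omega>) within Q) (u - v)) \<in> borel_measurable N"
proof -
  have zQ: "z \<omega> \<in> Q" if "\<omega> \<in> space N" for \<omega>
    using measurable_space[OF z that] by (simp add: space_restrict_space)
  have dcont: "continuous_on Q d"
    using d by (rule differentiable_imp_continuous_on)
  have meas: "(\<lambda>\<omega>. frechet_derivative d (at (z \<omega>) within Q) (u - z \<omega>)) \<in> borel_measurable N"
    if u: "u \<in> Q" for u
  proof (rule borel_measurable_LIMSEQ_real)
    define t where "t n = 1 / real (Suc n)" for n
    have t: "0 < t n" "t n \<le> 1" for n by (auto simp: t_def)
    have tlim: "filterlim t (at_right 0) sequentially"
      unfolding t_def
      by (rule tendsto_imp_filterlim_at_right) (use LIMSEQ_inverse_real_of_nat in \<open>auto simp: inverse_eq_divide\<close>)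
    show "(\<lambda>n. (d (z \<omega> + t n *\<^sub>R (u - z \<omega>)) - d (z \<omega>)) / t n)
        \<longlonglongrightarrow> frechet_derivative d (at (z \<omega>) within Q) (u - z \<omega>)" if "\<omega> \<in> space N" for \<omega>
      by (rule filterlim_compose[OF frechet_derivative_directional_limit[OF Q d zQ[OF that] u] tlim])
    fix n
    have sub: "x + t n *\<^sub>R (u - x) \<in> Q" if "x \<in> Q" for x
      using convexD[OF Q u that, of "t n" "1 - t n"] t[of n] by (simp add: segment_eq)
    have "continuous_on Q (\<lambda>x. (d (x + t n *\<^sub>R (u - x)) - d x) / t n)"
      using sub t[of n]
      by (intro continuous_intros dcont continuous_on_compose2[OF dcont]) auto
    then show "(\<lambda>\<omega>. (d (z \<omega> + t n *\<^sub>R (u - z \<omega>)) - d (z \<omega>)) / t n) \<in> borel_measurable N"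
      by (rule measurable_compose[OF z borel_measurable_continuous_on_restrict])
  qed
  have "(\<lambda>\<omega>. frechet_derivative d (at (z \<omega>) within Q) (u - z \<omega>)
      - frechet_derivative d (at (z \<omega>) within Q) (v - z \<omega>)) \<in> borel_measurable N"
    by (intro borel_measurable_diff meas u)
  moreover have "frechet_derivative d (at (z \<omega>) within Q) (u - v)
      = frechet_derivative d (at (z \<omega>) within Q) (u - z \<omega>)
      - frechet_derivative d (at (z \<omega>) within Q) (v - z \<omega>)" if "\<omega> \<in> space N" for \<omega>
  proof -
    have "linear (frechet_derivative d (at (z \<omega>) within Q))"
      using d zQ[OF that]
      by (simp add: differentiable_on_def linear_frechet_derivative)
    from linear_diff[OF this, of "u - z \<omega>" "v - z \<omega>"] show ?thesis by simp
  qed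
  ultimately show ?thesis
    by (subst measurable_cong) auto
qed

section \<open>The estimate sequence along a sample path\<close>

lemma prox_function_argmin_unique:
  assumes prox: "prox_function Q d x0" and min: "is_arg_min d (\<lambda>u. u \<in> Q) u"
  shows "u = x0"
proof -
  have "d u \<le> d x0" and u: "u \<in> Q"
    using prox min by (auto simp: prox_function_def is_arg_min_def not_less)
  moreover have "1 / 2 * (norm (u - x0))\<^sup>2 \<le> d u" "d x0 = 0"
    using prox u by (auto simp: prox_function_def)
  ultimately have "(norm (u - x0))\<^sup>2 \<le> 0" by linarith
  then show ?thesis by simp
qed

text \<open>The bounds \<open>\<alpha> i \<le> B i\<close> and
  \<open>B i \<le> (\<Sum>j\<le>i. \<alpha> j)\<close> put the weights \<open>\<tau> i\<close> and
  \<open>B i / A i\<close> into the unit interval, so every update is a convex combination of points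
  of \<open>Q\<close>.\<close>

lemma sigm_run_feasible:
  fixes G :: "'e::real_normed_vector \<Rightarrow> 'w \<Rightarrow> 'e \<Rightarrow>\<^sub>L real"
  assumes Q: "convex Q" and run: "sigm_run Q d h \<alpha> \<beta> B G s x y z xh w"
    and \<alpha>: "\<And>i. 0 < \<alpha> i" "\<And>i. \<alpha> i \<le> B i" and BA: "\<And>i. B i \<le> (\<Sum>j\<le>i. \<alpha> j)"
  shows "x k \<in> Q" "y k \<in> Q" "z k \<in> Q" "xh (Suc k) \<in> Q" "w (Suc k) \<in> Q"
proof -
  have Bpos: "0 < B i" for i using \<alpha>[of i] by linarith
  have Apos: "0 < (\<Sum>j\<le>i. \<alpha> j)" for i using Bpos[of i] BA[of i] by linarith
  define \<tau> where "\<tau> i = \<alpha> (Suc i) / B (Suc i)" for i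
  have \<tau>: "0 \<le> \<tau> i" "\<tau> i \<le> 1" for i
    using \<alpha>[of "Suc i"] Bpos[of "Suc i"] by (auto simp: \<tau>_def)
  note run' = run[unfolded sigm_run_def Let_def is_arg_min_def, folded \<tau>_def]
  show zQ: "z k \<in> Q" and xhQ: "xh (Suc k) \<in> Q" for k
    using run' by blast+
  have wQ: "w (Suc k) \<in> Q" if "y k \<in> Q" for k
  proof -
    have "w (Suc k) = \<tau> k *\<^sub>R xh (Suc k) + (1 - \<tau> k) *\<^sub>R y k"
      using run' by blast
    then show ?thesis
      using convexD[OF Q xhQ that, of "\<tau> k" "1 - \<tau> k"] \<tau>[of k] by simp
  qed
  show yQ: "y k \<in> Q" for k
  proof (induction k)
    case 0
    then show ?case using run' by blast
  next
    case (Suc k)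
    define \<mu> where "\<mu> = B (Suc k) / (\<Sum>j\<le>Suc k. \<alpha> j)"
    have \<mu>: "0 \<le> \<mu>" "\<mu> \<le> 1"
      using Bpos[of "Suc k"] BA[of "Suc k"] Apos[of "Suc k"] by (auto simp: \<mu>_def)
    have "y (Suc k) = (((\<Sum>j\<le>Suc k. \<alpha> j) - B (Suc k)) / (\<Sum>j\<le>Suc k. \<alpha> j)) *\<^sub>R y k + \<mu> *\<^sub>R w (Suc k)"
      using run' unfolding \<mu>_def by blast
    moreover have "((\<Sum>j\<le>Suc k. \<alpha> j) - B (Suc k)) / (\<Sum>j\<le>Suc k. \<alpha> j) = 1 - \<mu>"
      using Apos[of "Suc k"] unfolding \<mu>_def by (simp add: diff_divide_distrib del: sum.atMost_Suc)
    ultimately show ?case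
      using convexD[OF Q Suc wQ[OF Suc], of "1 - \<mu>" \<mu>] \<mu> by simp
  qed
  show "w (Suc k) \<in> Q" by (rule wQ[OF yQ])
  show "x k \<in> Q"
  proof (cases k)
    case 0
    then show ?thesis using run' by blast
  next
    case (Suc j)
    have "x (Suc j) = \<tau> j *\<^sub>R z j + (1 - \<tau> j) *\<^sub>R y j"
      using run' by blast
    then show ?thesis
      using convexD[OF Q zQ yQ, of "\<tau> j" "1 - \<tau> j" j j] \<tau>[of j] Suc by simp
  qed
qed

text \<open>
  The error terms \<open>e\<close> cover both noisy and noiseless oracles: \<open>e i\<close> is the squared noise divided by
  twice the gap \<open>a * \<beta> (i - 1) - L\<close> if \<open>\<sigma> > 0\<close>, and \<open>e i = 0\<close> if the noise vanishes. The index
  \<open>i - 1\<close> is truncated, so that \<open>\<beta> 0\<close> serves both the initial step and the first iteration.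
\<close>

lemma sigm_estimate:
  fixes Q :: "'e::real_normed_vector set" and G :: "'e \<Rightarrow> 'w \<Rightarrow> 'e \<Rightarrow>\<^sub>L real"
  assumes f: "convex_on Q f" and h: "convex_on Q h"
    and prox: "prox_function Q d x0"
    and inexact: "inexact_oracle Q f L \<delta> fo go"
    and run: "sigm_run Q d h \<alpha> \<beta> B G s x y z xh w"
    and xs: "xs \<in> Q"
    and \<alpha>: "\<And>i. 0 < \<alpha> i" and a: "0 < a" and B: "\<And>i. B i = a * (\<alpha> i)\<^sup>2"
    and \<alpha>B: "\<And>i. \<alpha> i \<le> B i" and BA: "\<And>i. B i \<le> (\<Sum>j\<le>i. \<alpha> j)" and B0: "B 0 = \<alpha> 0"
    and \<beta>: "\<And>i. 0 \<le> \<beta> i" "\<And>i. \<beta> i \<le> \<beta> (Suc i)"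
    and e: "\<And>i r. 0 \<le> r \<Longrightarrow>
      norm (G (x i) (s i) - go (x i)) * r \<le> (a * \<beta> (i - 1) - L) / 2 * r\<^sup>2 + e i"
  shows "(\<Sum>i\<le>k. \<alpha> i) * (f (y k) + h (y k) - (f xs + h xs))
    \<le> \<beta> k * d xs + (\<Sum>i\<le>k. B i * (\<delta> + e i))
      + (\<Sum>i\<le>k. \<alpha> i * (G (x i) (s i) - go (x i)) (xs - (case i of 0 \<Rightarrow> x 0 | Suc j \<Rightarrow> z j)))"
proof -
  define A where "A k = (\<Sum>i\<le>k. \<alpha> i)" for k
  define \<tau> where "\<tau> i = \<alpha> (Suc i) / B (Suc i)" for i
  define g where "g i = G (x i) (s i)" for i
  define \<Delta> where "\<Delta> i = g i - go (x i)" for i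
  define v where "v i = (case i of 0 \<Rightarrow> x 0 | Suc j \<Rightarrow> z j)" for i
  have v_simps [simp]: "v 0 = x 0" "v (Suc i) = z i" for i
    by (simp_all add: v_def)
  have ddiff: "d differentiable_on Q" and sc: "strongly_convex_on Q 1 d"
    and x0: "x0 \<in> Q" "d x0 = 0" and dlow: "\<And>u. u \<in> Q \<Longrightarrow> 1 / 2 * (norm (u - x0))\<^sup>2 \<le> d u"
    using prox by (auto simp: prox_function_def is_arg_min_def)
  have Q: "convex Q" using sc by (simp add: strongly_convex_on_def)
  have d0: "0 \<le> d u" if "u \<in> Q" for u
    using dlow[OF that] by (meson order_trans zero_le_power2 mult_nonneg_nonneg zero_le_divide_1_iff zero_le_numeral)
  note run' = run[unfolded sigm_run_def Let_def, folded A_def \<tau>_def g_def]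
  have x_min: "is_arg_min d (\<lambda>u. u \<in> Q) (x 0)"
    and y_min: "is_arg_min (\<lambda>u. \<beta> 0 * d u + \<alpha> 0 * g 0 (u - x 0) + \<alpha> 0 * h u) (\<lambda>u. u \<in> Q) (y 0)"
    and z_min: "\<And>k. is_arg_min (\<lambda>u. \<beta> k * d u + (\<Sum>i\<le>k. \<alpha> i * g i (u - x i)) + A k * h u)
          (\<lambda>u. u \<in> Q) (z k)"
    and xS: "\<And>k. x (Suc k) = \<tau> k *\<^sub>R z k + (1 - \<tau> k) *\<^sub>R y k"
    and xh_min: "\<And>k. is_arg_min (\<lambda>u. \<beta> k * bregman_distance Q d u (z k) +
            \<alpha> (Suc k) * g (Suc k) (u - z k) + \<alpha> (Suc k) * h u) (\<lambda>u. u \<in> Q) (xh (Suc k))"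
    and wS: "\<And>k. w (Suc k) = \<tau> k *\<^sub>R xh (Suc k) + (1 - \<tau> k) *\<^sub>R y k"
    and yS: "\<And>k. y (Suc k) = ((A (Suc k) - B (Suc k)) / A (Suc k)) *\<^sub>R y k
          + (B (Suc k) / A (Suc k)) *\<^sub>R w (Suc k)"
    using run' by blast+
  have Bpos: "0 < B i" for i using \<alpha>[of i] \<alpha>B[of i] by linarith
  have Apos: "0 < A i" for i using Bpos[of i] BA[of i] by (simp add: A_def)
  have BA': "B i \<le> A i" for i using BA by (simp add: A_def)
  have \<tau>: "0 \<le> \<tau> k" "\<tau> k \<le> 1" "0 < \<tau> k" for k
    using \<alpha>[of "Suc k"] Bpos[of "Suc k"] \<alpha>B[of "Suc k"] by (auto simp: \<tau>_def)
  note feasible = sigm_run_feasible[OF Q run \<alpha> \<alpha>B BA]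
  note xQ = feasible(1) and yQ = feasible(2) and zQ = feasible(3) and xhQ = feasible(4) and wQ = feasible(5)
  have x_eq: "x 0 = x0" by (rule prox_function_argmin_unique[OF prox x_min])
  have lower: "fo (x i) + go (x i) (u - x i) \<le> f u" if "u \<in> Q" for u i
    using inexact xQ[of i] that unfolding inexact_oracle_def by (smt (verit))
  \<comment> \<open>Replacing the exact covector by the sampled one costs
    \<open>norm (\<Delta> i) * norm (u - x i)\<close>. Hypothesis \<open>e\<close> splits this cost:
    the curvature rises from \<open>L\<close> to \<open>a * \<beta> (i - 1)\<close>, and the
    remainder is charged to \<open>e i\<close>.\<close>
  have descent: "f u \<le> fo (x i) + g i (u - x i) + a * \<beta> (i - 1) / 2 * (norm (u - x i))\<^sup>2 + \<delta> + e i"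
    if "u \<in> Q" for u i
  proof -
    have "f u \<le> fo (x i) + go (x i) (u - x i) + L / 2 * (norm (x i - u))\<^sup>2 + \<delta>"
      using inexact xQ[of i] that unfolding inexact_oracle_def by (smt (verit))
    moreover have "go (x i) (u - x i) = g i (u - x i) - \<Delta> i (u - x i)"
      by (simp add: \<Delta>_def blinfun.diff_left)
    moreover have "- \<Delta> i (u - x i) \<le> norm (\<Delta> i) * norm (u - x i)"
      using norm_blinfun[of "\<Delta> i" "u - x i"] by (simp add: abs_le_iff)
    moreover have "norm (\<Delta> i) * norm (u - x i)
        \<le> (a * \<beta> (i - 1) - L) / 2 * (norm (u - x i))\<^sup>2 + e i"
      using e[of "norm (u - x i)" i] by (simp add: \<Delta>_def g_def)
    ultimately show ?thesis
      by (simp add: norm_minus_commute algebra_simps diff_divide_distrib)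
  qed
  \<comment> \<open>The estimate function: the objective of \<open>z k\<close> with the constants
    \<open>fo (x i)\<close> restored. The minimizer is unchanged, while the sum becomes a noisy
    lower model of \<open>f\<close>.\<close>
  define \<Psi> where
    "\<Psi> k u = \<beta> k * d u + ((\<Sum>i\<le>k. \<alpha> i * (fo (x i) + g i (u - x i))) + A k * h u)" for k u
  have \<Psi>_min: "is_arg_min (\<Psi> k) (\<lambda>u. u \<in> Q) (z k)" for k
  proof -
    have "is_arg_min (\<Psi> k) (\<lambda>u. u \<in> Q) (z k) \<longleftrightarrow>
      is_arg_min (\<lambda>u. \<beta> k * d u + (\<Sum>i\<le>k. \<alpha> i * g i (u - x i)) + A k * h u) (\<lambda>u. u \<in> Q) (z k)"
      by (rule is_arg_min_shift) (simp add: \<Psi>_def distrib_left sum.distrib)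
    then show ?thesis using z_min by blast
  qed
  have \<Psi>_le: "\<Psi> k (z k) \<le> \<Psi> k u" if "u \<in> Q" for k u
    using \<Psi>_min[of k] that by (auto simp: is_arg_min_def not_less)
  have \<Psi>_bregman: "\<Psi> k (z k) + \<beta> k * bregman_distance Q d u (z k) \<le> \<Psi> k u" if u: "u \<in> Q" for k u
  proof -
    have "convex_on Q (\<lambda>u. (\<Sum>i\<le>k. \<alpha> i * (fo (x i) + g i (u - x i))) + A k * h u)"
    proof (intro convex_on_add convex_on_cmul h)
      show "0 \<le> A k" using Apos[of k] by simp
      show "convex_on Q (\<lambda>u. \<Sum>i\<le>k. \<alpha> i * (fo (x i) + g i (u - x i)))"
        by (intro convex_onI Q)
          (simp add: blinfun.bilinear_simps algebra_simps sum.distrib sum_distrib_left sum_subtractf)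
    qed
    then show ?thesis
      using composite_argmin_bregman[OF Q ddiff _ \<Psi>_min[of k, unfolded \<Psi>_def[abs_def]] u]
      by (simp add: \<Psi>_def)
  qed
  \<comment> \<open>The linear noise is kept with its sign, not estimated by norms, so that its zero
    conditional mean can still be exploited later.\<close>
  have main: "A k * (f (y k) + h (y k))
      \<le> \<Psi> k (z k) + (\<Sum>i\<le>k. B i * (\<delta> + e i)) + (\<Sum>i\<le>k. \<alpha> i * \<Delta> i (x i - v i))" for k
  proof (induction k)
    case 0
    \<comment> \<open>Follows from \<open>B 0 = \<alpha> 0\<close>. At the start it turns the
      weighted curvature into \<open>\<beta> 0 / 2\<close>, which \<open>d (y 0)\<close> covers
      because \<open>x 0\<close> is the prox center.\<close>
    have a\<alpha>: "a * \<alpha> 0 = 1"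
      using B[of 0] B0 \<alpha>[of 0] by (simp add: power2_eq_square)
    have "\<beta> 0 * d (y 0) + \<alpha> 0 * g 0 (y 0 - x 0) + \<alpha> 0 * h (y 0)
        \<le> \<beta> 0 * d (z 0) + \<alpha> 0 * g 0 (z 0 - x 0) + \<alpha> 0 * h (z 0)"
      using y_min zQ[of 0] by (auto simp: is_arg_min_def not_less)
    then have "\<beta> 0 * d (y 0) + \<alpha> 0 * (fo (x 0) + g 0 (y 0 - x 0)) + \<alpha> 0 * h (y 0) \<le> \<Psi> 0 (z 0)"
      by (simp add: \<Psi>_def A_def algebra_simps)
    moreover have "\<beta> 0 * (1 / 2 * (norm (y 0 - x 0))\<^sup>2) \<le> \<beta> 0 * d (y 0)"
      unfolding x_eq by (rule mult_left_mono[OF dlow[OF yQ[of 0]] \<beta>(1)])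
    moreover have "\<alpha> 0 * f (y 0) \<le> \<alpha> 0 * (fo (x 0) + g 0 (y 0 - x 0)
        + a * \<beta> 0 / 2 * (norm (y 0 - x 0))\<^sup>2 + \<delta> + e 0)"
      using descent[OF yQ[of 0], of 0] \<alpha>[of 0] by (intro mult_left_mono) auto
    moreover have "\<alpha> 0 * (a * \<beta> 0 / 2 * (norm (y 0 - x 0))\<^sup>2)
        = \<beta> 0 * (1 / 2 * (norm (y 0 - x 0))\<^sup>2)"
    proof -
      have "\<alpha> 0 * (a * \<beta> 0 / 2 * (norm (y 0 - x 0))\<^sup>2)
          = (a * \<alpha> 0) * (\<beta> 0 * (1 / 2 * (norm (y 0 - x 0))\<^sup>2))"
        by simp
      then show ?thesis using a\<alpha> by simp
    qed
    ultimately have "\<alpha> 0 * (f (y 0) + h (y 0)) \<le> \<Psi> 0 (z 0) + \<alpha> 0 * (\<delta> + e 0)"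
      unfolding distrib_left by linarith
    then show ?case
      by (simp add: A_def B0)
  next
    case (Suc k)
    define \<alpha>' B' A' x' w' xh' z' g' \<Delta>' where defs: "\<alpha>' = \<alpha> (Suc k)" "B' = B (Suc k)" "A' = A (Suc k)"
      "x' = x (Suc k)" "w' = w (Suc k)" "xh' = xh (Suc k)" "z' = z (Suc k)" "g' = g (Suc k)"
      "\<Delta>' = \<Delta> (Suc k)"
    have pos: "0 < \<alpha>'" "0 < B'" "0 < A'" "\<alpha>' \<le> B'" "B' \<le> A'"
      using \<alpha> Bpos Apos \<alpha>B BA' by (auto simp: defs)
    have AS: "A k = A' - \<alpha>'" by (simp add: A_def defs)
    have \<tau>': "\<tau> k = \<alpha>' / B'" by (simp add: \<tau>_def defs)
    \<comment> \<open>Since \<open>d\<close> is nonnegative on \<open>Q\<close>,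
      \<open>\<beta> (Suc k)\<close> may be lowered to \<open>\<beta> k\<close>. The growth of
      \<open>\<Psi> k\<close> then yields a Bregman term at \<open>z'\<close>, and minimality of
      \<open>xh'\<close> moves it to \<open>xh'\<close>, from which \<open>w'\<close> is
      built.\<close>
    have "\<Psi> k z' + \<alpha>' * (fo x' + g' (z' - x') + h z') \<le> \<Psi> (Suc k) z'"
      using mult_right_mono[OF \<beta>(2)[of k] d0[OF zQ[of "Suc k"]]]
      by (simp add: \<Psi>_def defs A_def algebra_simps)
    moreover have "\<Psi> k (z k) + \<beta> k * bregman_distance Q d z' (z k) \<le> \<Psi> k z'"
      unfolding defs by (rule \<Psi>_bregman[OF zQ])
    moreover have "\<beta> k * bregman_distance Q d xh' (z k) + \<alpha>' * g' (xh' - z k) + \<alpha>' * h xh'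
        \<le> \<beta> k * bregman_distance Q d z' (z k) + \<alpha>' * g' (z' - z k) + \<alpha>' * h z'"
      using xh_min[of k] zQ[of "Suc k"] unfolding defs by (auto simp: is_arg_min_def not_less)
    ultimately have 1: "\<Psi> k (z k) + \<beta> k * bregman_distance Q d xh' (z k)
        + \<alpha>' * (fo x' + g' (xh' - x') + h xh') \<le> \<Psi> (Suc k) z'"
      by (simp add: blinfun.diff_right algebra_simps)
    have vec_x: "B' *\<^sub>R x' = \<alpha>' *\<^sub>R z k + (B' - \<alpha>') *\<^sub>R y k"
      and vec_w: "B' *\<^sub>R w' = \<alpha>' *\<^sub>R xh' + (B' - \<alpha>') *\<^sub>R y k"
      using pos xS[of k] wS[of k] unfolding \<tau>' by (simp_all add: defs scaleR_add_right right_diff_distrib)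
    \<comment> \<open>This turns the noise paired with \<open>y k\<close> into noise paired with \<open>z k\<close>: in the end it only
      meets \<open>xs - z k\<close>, which is bounded by the diameter.\<close>
    have lin_x: "(B' - \<alpha>') * l (y k - x') = \<alpha>' * l (x' - z k)" for l :: "'e \<Rightarrow>\<^sub>L real"
      using arg_cong[OF vec_x, of l] by (simp add: blinfun.bilinear_simps algebra_simps)
    have lin_w: "(B' - \<alpha>') * l (y k - x') + \<alpha>' * l (xh' - x') = B' * l (w' - x')" for l :: "'e \<Rightarrow>\<^sub>L real"
      using arg_cong[OF vec_w, of l] by (simp add: blinfun.bilinear_simps algebra_simps)
    \<comment> \<open>With \<open>B' = a * \<alpha>'\<^sup>2\<close> one has
      \<open>B' * (\<tau> k)\<^sup>2 = 1 / a\<close>, so the curvature weighted by \<open>B'\<close>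
      is exactly \<open>\<beta> k / 2\<close>, the amount strong convexity of \<open>d\<close>
      supplies.\<close>
    have 2: "B' * (a * \<beta> k / 2 * (norm (w' - x'))\<^sup>2) \<le> \<beta> k * bregman_distance Q d xh' (z k)"
    proof -
      have "w' - x' = \<tau> k *\<^sub>R (xh' - z k)"
        unfolding defs wS xS by (simp add: algebra_simps)
      then have "(norm (w' - x'))\<^sup>2 = (\<alpha>' / B')\<^sup>2 * (norm (xh' - z k))\<^sup>2"
        by (simp add: \<tau>' power_mult_distrib power_divide)
      moreover have "B' = a * \<alpha>'\<^sup>2" using B by (simp add: defs)
      ultimately have "B' * (a * \<beta> k / 2 * (norm (w' - x'))\<^sup>2) = \<beta> k * (1 / 2 * (norm (xh' - z k))\<^sup>2)"
        using pos a by (simp add: field_simps power2_eq_square)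
      also have "\<dots> \<le> \<beta> k * bregman_distance Q d xh' (z k)"
        unfolding defs
        by (rule mult_left_mono[OF bregman_distance_lower_bound[OF ddiff sc zQ xhQ] \<beta>(1)])
      finally show ?thesis .
    qed
    \<comment> \<open>The weight \<open>A' - \<alpha>'\<close> of the induction hypothesis splits
      into \<open>A' - B'\<close>, which stays at \<open>y k\<close>, and
      \<open>B' - \<alpha>'\<close>, for which \<open>f\<close> is bounded below by its model at
      \<open>x'\<close>.\<close>
    have 3: "(B' - \<alpha>') * (fo x' + go x' (y k - x')) \<le> (B' - \<alpha>') * f (y k)"
      using lower[OF yQ[of k], of "Suc k"] pos by (intro mult_left_mono) (auto simp: defs)
    have lin_y: "(B' - \<alpha>') * go x' (y k - x') = (B' - \<alpha>') * g' (y k - x') - \<alpha>' * \<Delta>' (x' - z k)"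
      unfolding lin_x[symmetric] by (simp add: defs \<Delta>_def blinfun.diff_left algebra_simps)
    have 4: "B' * h w' \<le> (B' - \<alpha>') * h (y k) + \<alpha>' * h xh'"
    proof -
      have "h w' \<le> (1 - \<tau> k) * h (y k) + \<tau> k * h xh'"
        using convex_onD[OF h \<tau>(1,2) yQ[of k] xhQ[of k], of k] by (simp add: defs wS add.commute)
      then have "B' * h w' \<le> B' * ((1 - \<tau> k) * h (y k) + \<tau> k * h xh')"
        using pos by (intro mult_left_mono) auto
      also have "\<dots> = (B' - \<alpha>') * h (y k) + \<alpha>' * h xh'"
        using pos by (simp add: \<tau>' field_simps)
      finally show ?thesis .
    qed
    have 5: "B' * f w' \<le> B' * (fo x' + g' (w' - x') + a * \<beta> k / 2 * (norm (w' - x'))\<^sup>2 + \<delta> + e (Suc k))"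
      using descent[OF wQ[of k], of "Suc k"] pos by (intro mult_left_mono) (auto simp: defs)
    have 6: "A' * F (y (Suc k)) \<le> (A' - B') * F (y k) + B' * F w'" if "convex_on Q F" for F
    proof -
      have "F (y (Suc k)) \<le> (1 - B' / A') * F (y k) + B' / A' * F w'"
        using convex_onD[OF that, of "B' / A'" "y k" w'] pos yQ[of k] wQ[of k] yS[of k]
        by (simp add: defs diff_divide_distrib)
      then have "A' * F (y (Suc k)) \<le> A' * ((1 - B' / A') * F (y k) + B' / A' * F w')"
        using pos by (intro mult_left_mono) auto
      also have "\<dots> = (A' - B') * F (y k) + B' * F w'"
        using pos by (simp add: field_simps)
      finally show ?thesis .
    qed
    have "A' * (f (y (Suc k)) + h (y (Suc k))) \<le> \<Psi> (Suc k) z'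
      + ((\<Sum>i\<le>k. B i * (\<delta> + e i)) + B' * (\<delta> + e (Suc k)))
      + ((\<Sum>i\<le>k. \<alpha> i * \<Delta> i (x i - v i)) + \<alpha>' * \<Delta>' (x' - z k))"
      using Suc.IH 1 2 3 lin_y 4 5 6[OF f] 6[OF h] lin_w[of g'] unfolding AS
      by (simp add: distrib_left left_diff_distrib)
    then show ?case by (simp add: defs)
  qed
  have "\<Psi> k (z k) \<le> \<Psi> k xs" by (rule \<Psi>_le[OF xs])
  also have "\<Psi> k xs \<le> \<beta> k * d xs + ((\<Sum>i\<le>k. \<alpha> i * (f xs + \<Delta> i (xs - x i))) + A k * h xs)"
  proof -
    have "\<alpha> i * (fo (x i) + g i (xs - x i)) \<le> \<alpha> i * (f xs + \<Delta> i (xs - x i))" for i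
      using lower[OF xs, of i] \<alpha>[of i] by (intro mult_left_mono) (auto simp: \<Delta>_def blinfun.diff_left)
    then show ?thesis
      unfolding \<Psi>_def by (intro add_mono sum_mono) auto
  qed
  also have "\<dots> = \<beta> k * d xs + A k * (f xs + h xs) + (\<Sum>i\<le>k. \<alpha> i * \<Delta> i (xs - x i))"
    by (simp add: distrib_left sum.distrib A_def sum_distrib_right)
  finally have "A k * (f (y k) + h (y k)) \<le> \<beta> k * d xs + A k * (f xs + h xs)
      + (\<Sum>i\<le>k. \<alpha> i * \<Delta> i (xs - x i)) + (\<Sum>i\<le>k. B i * (\<delta> + e i)) + (\<Sum>i\<le>k. \<alpha> i * \<Delta> i (x i - v i))"
    using main[of k] by linarith
  \<comment> \<open>The noise enters once through the induction and once through the model evaluated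
    at \<open>xs\<close>; in the sum \<open>x i\<close> cancels.\<close>
  moreover have "(\<Sum>i\<le>k. \<alpha> i * \<Delta> i (xs - x i)) + (\<Sum>i\<le>k. \<alpha> i * \<Delta> i (x i - v i))
      = (\<Sum>i\<le>k. \<alpha> i * \<Delta> i (xs - v i))"
    by (simp add: sum.distrib[symmetric] blinfun.diff_right algebra_simps)
  ultimately show ?thesis
    by (simp add: A_def \<Delta>_def g_def v_def right_diff_distrib)
qed

section \<open>Exponential moments and concentration\<close>

text \<open>For \<open>t \<le> 1\<close> the polynomial \<open>1 + t + t\<^sup>2\<close> lies
  between \<open>exp t\<close> and the right-hand side; for larger \<open>t\<close> already
  \<open>t \<le> t\<^sup>2\<close>.\<close>

lemma exp_le_add_exp_square: "exp t \<le> t + exp (t\<^sup>2)" for t :: real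
proof -
  have sq: "1 + t\<^sup>2 \<le> exp (t\<^sup>2)" by (rule exp_ge_add_one_self)
  consider "t \<ge> 1" | "0 \<le> t" "t \<le> 1" | "t \<le> 0" by linarith
  then show ?thesis
  proof cases
    case 1
    then have "t \<le> t\<^sup>2" by (simp add: power2_eq_square)
    then have "exp t \<le> exp (t\<^sup>2)" by simp
    then show ?thesis using 1 by linarith
  next
    case 2
    then show ?thesis using exp_bound[of t] sq by linarith
  next
    case 3
    have "exp t * (1 - t) \<le> exp t * exp (- t)"
      using exp_ge_add_one_self[of "- t"] by (intro mult_left_mono) auto
    then have "exp t * (1 - t) \<le> 1" by (simp flip: exp_add)
    \<comment> \<open>The product equals 1 minus the cube of \<open>t\<close>, and \<open>t\<close>
      is nonpositive here.\<close>
    moreover have "1 \<le> (1 + t + t\<^sup>2) * (1 - t)"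
    proof -
      have "0 \<le> t\<^sup>2 * (- t)"
        using 3 by (intro mult_nonneg_nonneg) auto
      then show ?thesis by (simp add: algebra_simps power2_eq_square)
    qed
    ultimately have "exp t * (1 - t) \<le> (1 + t + t\<^sup>2) * (1 - t)" by linarith
    then have "exp t \<le> 1 + t + t\<^sup>2" using 3 by simp
    then show ?thesis using sq by linarith
  qed
qed

text \<open>The cases are separated by \<open>\<theta> = (l * s)\<^sup>2\<close>. Small
  \<open>\<theta>\<close> needs the zero mean and gives the exponent \<open>\<theta>\<close>; large
  \<open>\<theta>\<close> gives \<open>\<theta> / 4 + 1\<close>, at most
  \<open>5 / 4 * \<theta>\<close> once \<open>\<theta> > 1\<close>. This is the origin of
  5/4.\<close>

lemma (in prob_space) nn_integral_exp_subgaussian: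
  fixes X :: "'a \<Rightarrow> real"
  assumes mean: "has_bochner_integral M X 0" and s: "s > 0"
    and tail: "(\<integral>\<^sup>+\<omega>. ennreal (exp ((X \<omega> / s)\<^sup>2)) \<partial>M) \<le> ennreal (exp 1)"
  shows "(\<integral>\<^sup>+\<omega>. ennreal (exp (l * X \<omega>)) \<partial>M) \<le> ennreal (exp (5 / 4 * (l * s)\<^sup>2))"
proof -
  have intX: "integrable M X" and EX: "expectation X = 0"
    using mean by (auto simp: has_bochner_integral_iff)
  have X [measurable]: "X \<in> borel_measurable M" using intX by auto
  define Y where "Y \<omega> = (X \<omega> / s)\<^sup>2" for \<omega>
  have Y [measurable]: "Y \<in> borel_measurable M" unfolding Y_def[abs_def] by measurable
  define \<theta> where "\<theta> = (l * s)\<^sup>2"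
  have \<theta>0: "0 \<le> \<theta>" by (simp add: \<theta>_def)
  have tail': "(\<integral>\<^sup>+\<omega>. ennreal (exp (Y \<omega>)) \<partial>M) \<le> ennreal (exp 1)"
    using tail by (simp add: Y_def)
  have intY: "integrable M (\<lambda>\<omega>. exp (Y \<omega>))"
    using tail' by (intro integrableI_nonneg) (auto intro: le_less_trans)
  have EY: "expectation (\<lambda>\<omega>. exp (Y \<omega>)) \<le> exp 1"
    using tail' nn_integral_eq_integral[OF intY] by simp
  show ?thesis
  proof (cases "\<theta> \<le> 1")
    case True
    \<comment> \<open>Factoring out \<open>exp \<theta>\<close> leaves
      \<open>exp (\<theta> * (Y \<omega> - 1))\<close>. Convexity between 0 and
      \<open>Y \<omega> - 1\<close> bounds it by an average of 1 and
      \<open>exp (Y \<omega> - 1)\<close>, whose expectation is at most 1.\<close>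
    have pw: "exp (l * X \<omega>) \<le> l * X \<omega> + exp \<theta> * (\<theta> * (exp (Y \<omega>) / exp 1) + (1 - \<theta>))" for \<omega>
    proof -
      have "(l * X \<omega>)\<^sup>2 = \<theta> * Y \<omega>"
        using s by (simp add: \<theta>_def Y_def power_mult_distrib power_divide)
      then have "exp (l * X \<omega>) \<le> l * X \<omega> + exp \<theta> * exp (\<theta> * (Y \<omega> - 1))"
        using exp_le_add_exp_square[of "l * X \<omega>"] by (simp add: algebra_simps flip: exp_add)
      also have "exp (\<theta> * (Y \<omega> - 1)) \<le> \<theta> * exp (Y \<omega> - 1) + (1 - \<theta>) * exp 0"
        using convex_onD[OF exp_convex \<theta>0 True, of 0 "Y \<omega> - 1"] by simp
      finally show ?thesis by (simp add: exp_diff)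
    qed
    have int: "integrable M (\<lambda>\<omega>. l * X \<omega> + exp \<theta> * (\<theta> * (exp (Y \<omega>) / exp 1) + (1 - \<theta>)))"
      using intX intY by simp
    have "(\<integral>\<^sup>+\<omega>. ennreal (exp (l * X \<omega>)) \<partial>M)
        \<le> (\<integral>\<^sup>+\<omega>. ennreal (l * X \<omega> + exp \<theta> * (\<theta> * (exp (Y \<omega>) / exp 1) + (1 - \<theta>))) \<partial>M)"
      by (intro nn_integral_mono ennreal_leI pw)
    also have "\<dots> = ennreal (expectation (\<lambda>\<omega>. l * X \<omega> + exp \<theta> * (\<theta> * (exp (Y \<omega>) / exp 1) + (1 - \<theta>))))"
      using pw by (intro nn_integral_eq_integral int AE_I2) (meson exp_ge_zero order_trans)
    also have "expectation (\<lambda>\<omega>. l * X \<omega> + exp \<theta> * (\<theta> * (exp (Y \<omega>) / exp 1) + (1 - \<theta>)))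
        = exp \<theta> * (\<theta> * (expectation (\<lambda>\<omega>. exp (Y \<omega>)) / exp 1) + (1 - \<theta>))"
      using intX intY EX by (simp add: prob_space)
    also have "\<dots> \<le> exp \<theta> * (\<theta> * 1 + (1 - \<theta>))"
      using EY \<theta>0 by (intro mult_left_mono add_right_mono) (auto simp: field_simps)
    also have "\<dots> \<le> exp (5 / 4 * \<theta>)" using \<theta>0 by simp
    finally show ?thesis by (simp add: \<theta>_def ennreal_leI)
  next
    case False
    \<comment> \<open>Young's inequality, split so that the random part has coefficient exactly 1
      and the assumed moment applies directly.\<close>
    have pw: "l * X \<omega> \<le> \<theta> / 4 + Y \<omega>" for \<omega>
    proof -
      have "l * X \<omega> = 2 * (l * s / 2) * (X \<omega> / s)" using s by simp
      also have "\<dots> \<le> (l * s / 2)\<^sup>2 + (X \<omega> / s)\<^sup>2" by (rule sum_squares_bound)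
      finally show ?thesis by (simp add: \<theta>_def Y_def power_divide)
    qed
    have "(\<integral>\<^sup>+\<omega>. ennreal (exp (l * X \<omega>)) \<partial>M)
        \<le> (\<integral>\<^sup>+\<omega>. ennreal (exp (\<theta> / 4)) * ennreal (exp (Y \<omega>)) \<partial>M)"
      using pw by (intro nn_integral_mono) (simp flip: ennreal_mult' exp_add)
    also have "\<dots> = ennreal (exp (\<theta> / 4)) * (\<integral>\<^sup>+\<omega>. ennreal (exp (Y \<omega>)) \<partial>M)"
      by (rule nn_integral_cmult) measurable
    also have "\<dots> \<le> ennreal (exp (\<theta> / 4)) * ennreal (exp 1)"
      by (intro mult_left_mono tail') auto
    also have "\<dots> = ennreal (exp (\<theta> / 4 + 1))"
      by (simp add: exp_add ennreal_mult')
    also have "\<dots> \<le> ennreal (exp (5 / 4 * \<theta>))"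
      using False by (intro ennreal_leI) simp
    finally show ?thesis by (simp add: \<theta>_def)
  qed
qed

lemma (in prob_space) prob_ge_le_exp_moment:
  fixes X :: "'a \<Rightarrow> real"
  assumes X [measurable]: "X \<in> borel_measurable M"
    and le: "(\<integral>\<^sup>+\<omega>. ennreal (exp (X \<omega>)) \<partial>M) \<le> ennreal (exp c)"
  shows "\<P>(\<omega> in M. t \<le> X \<omega>) \<le> exp (c - t)"
proof -
  have "emeasure M {\<omega>\<in>space M. t \<le> X \<omega>} = (\<integral>\<^sup>+\<omega>. indicator {\<omega>\<in>space M. t \<le> X \<omega>} \<omega> \<partial>M)"
    by simp
  also have "\<dots> \<le> (\<integral>\<^sup>+\<omega>. ennreal (exp (- t)) * ennreal (exp (X \<omega>)) \<partial>M)"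
    by (intro nn_integral_mono) (auto simp: indicator_def simp flip: ennreal_mult' exp_add)
  also have "\<dots> = ennreal (exp (- t)) * (\<integral>\<^sup>+\<omega>. ennreal (exp (X \<omega>)) \<partial>M)"
    by (rule nn_integral_cmult) measurable
  also have "\<dots> \<le> ennreal (exp (- t)) * ennreal (exp c)"
    by (intro mult_left_mono le) auto
  also have "\<dots> = ennreal (exp (c - t))"
    by (simp flip: ennreal_mult' exp_add)
  finally show ?thesis
    by (simp add: emeasure_eq_measure)
qed

text \<open>Valid under arbitrary dependence: after normalising the weights, Jensen bounds the
  exponential of the average by the average of the exponentials. Its moment is at most
  \<open>exp 1\<close>, and this 1 is compensated by the 1 in \<open>1 + \<Omega>\<close>.\<close>

lemma (in prob_space) prob_weighted_sum_light_tail: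
  fixes Y :: "nat \<Rightarrow> 'a \<Rightarrow> real"
  assumes Y [measurable]: "\<And>i. i < n \<Longrightarrow> Y i \<in> borel_measurable M"
    and tail: "\<And>i. i < n \<Longrightarrow> (\<integral>\<^sup>+\<omega>. ennreal (exp (Y i \<omega>)) \<partial>M) \<le> ennreal (exp 1)"
    and c: "\<And>i. i < n \<Longrightarrow> 0 \<le> c i" and C: "0 < (\<Sum>i<n. c i)"
  shows "\<P>(\<omega> in M. (1 + \<Omega>) * (\<Sum>i<n. c i) \<le> (\<Sum>i<n. c i * Y i \<omega>)) \<le> exp (- \<Omega>)"
proof -
  define C where "C = (\<Sum>i<n. c i)"
  have C0: "0 < C" using C by (simp add: C_def)
  have n: "n \<noteq> 0" using C by (cases n) auto
  have sum1: "(\<Sum>i<n. c i / C) = 1"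
    using C0 by (simp add: C_def flip: sum_divide_distrib)
  have pw: "exp (\<Sum>i<n. c i / C * Y i \<omega>) \<le> (\<Sum>i<n. c i / C * exp (Y i \<omega>))" for \<omega>
    using convex_on_sum[OF finite_lessThan _ exp_convex sum1, of "\<lambda>i. Y i \<omega>"] c C0 n
    by (auto simp: lessThan_empty_iff)
  have "(\<integral>\<^sup>+\<omega>. ennreal (exp (\<Sum>i<n. c i / C * Y i \<omega>)) \<partial>M)
      \<le> (\<integral>\<^sup>+\<omega>. (\<Sum>i<n. ennreal (c i / C) * ennreal (exp (Y i \<omega>))) \<partial>M)"
  proof (intro nn_integral_mono)
    fix \<omega>
    have "ennreal (exp (\<Sum>i<n. c i / C * Y i \<omega>)) \<le> ennreal (\<Sum>i<n. c i / C * exp (Y i \<omega>))"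
      by (intro ennreal_leI pw)
    also have "\<dots> = (\<Sum>i<n. ennreal (c i / C) * ennreal (exp (Y i \<omega>)))"
      using c C0 by (subst sum_ennreal[symmetric]) (auto simp flip: ennreal_mult' intro!: sum.cong)
    finally show "ennreal (exp (\<Sum>i<n. c i / C * Y i \<omega>))
        \<le> (\<Sum>i<n. ennreal (c i / C) * ennreal (exp (Y i \<omega>)))" .
  qed
  also have "\<dots> = (\<Sum>i<n. ennreal (c i / C) * (\<integral>\<^sup>+\<omega>. ennreal (exp (Y i \<omega>)) \<partial>M))"
    by (subst nn_integral_sum) (auto intro!: sum.cong nn_integral_cmult)
  also have "\<dots> \<le> (\<Sum>i<n. ennreal (c i / C) * ennreal (exp 1))"
    by (intro sum_mono mult_left_mono tail) auto
  also have "\<dots> = ennreal (exp 1)"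
  proof -
    have "(\<Sum>i<n. ennreal (c i / C) * ennreal (exp 1)) = ennreal (\<Sum>i<n. c i / C * exp 1)"
      using c C0 by (subst sum_ennreal[symmetric]) (auto simp flip: ennreal_mult' intro!: sum.cong)
    also have "(\<Sum>i<n. c i / C * exp 1) = exp (1::real)"
      by (simp only: sum_distrib_right[symmetric] sum1 mult_1)
    finally show ?thesis .
  qed
  finally have "\<P>(\<omega> in M. 1 + \<Omega> \<le> (\<Sum>i<n. c i / C * Y i \<omega>)) \<le> exp (1 - (1 + \<Omega>))"
    by (intro prob_ge_le_exp_moment) auto
  moreover have "(\<Sum>i<n. c i / C * Y i \<omega>) = (\<Sum>i<n. c i * Y i \<omega>) / C" for \<omega>
    by (simp add: sum_divide_distrib)
  ultimately show ?thesis
    using C0 by (simp add: C_def field_simps)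
qed

section \<open>Fresh noise, its past, and conditioning by freezing\<close>

locale iid_noise = prob_space M for M :: "'o measure" +
  fixes \<xi> :: "nat \<Rightarrow> 'o \<Rightarrow> 'w" and P :: "'w measure"
  assumes indep: "indep_vars (\<lambda>_. P) \<xi> UNIV" and distr: "\<And>i. distr M P (\<xi> i) = P"
begin

text \<open>The sigma-algebra generated by the first \<open>n\<close> noise variables, index
  \<open>n\<close> excluded. It is packed as a measure so that \<open>measurable (past n) N\<close>
  expresses adaptedness; probabilities are always taken in \<open>M\<close>.\<close>

definition past :: "nat \<Rightarrow> 'o measure" where
  "past n = vimage_algebra (space M) (\<lambda>\<omega>. \<lambda>i\<in>{..<n}. \<xi> i \<omega>) (\<Pi>\<^sub>M i\<in>{..<n}. P)"

lemma space_past [simp]: "space (past n) = space M"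
  by (simp add: past_def)

lemma noise_measurable [measurable]: "\<xi> i \<in> measurable M P"
  using indep by (simp add: indep_vars_def2)

lemma prob_space_noise: "prob_space P"
  using prob_space_distr[OF noise_measurable, of 0] by (simp add: distr)

lemma noise_measurable_past:
  assumes "i < n"
  shows "\<xi> i \<in> measurable (past n) P"
proof -
  have X: "(\<lambda>\<omega>. \<lambda>i\<in>{..<n}. \<xi> i \<omega>) \<in> measurable (past n) (\<Pi>\<^sub>M i\<in>{..<n}. P)"
    unfolding past_def
    by (intro measurable_vimage_algebra1 funcsetI, rule measurable_space[OF measurable_restrict[OF noise_measurable]])
  have "(\<lambda>\<omega>. (\<lambda>i\<in>{..<n}. \<xi> i \<omega>) i) \<in> measurable (past n) P"
    by (rule measurable_compose[OF X measurable_component_singleton]) (simp add: assms)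
  then show ?thesis using assms by simp
qed

lemma measurable_past_mono:
  assumes "f \<in> measurable (past m) N" "m \<le> n"
  shows "f \<in> measurable (past n) N"
proof -
  have "(\<lambda>\<omega>. \<omega>) \<in> measurable (past n) (past m)"
    unfolding past_def[of m]
    using \<open>m \<le> n\<close>
    by (intro measurable_vimage_algebra2 measurable_restrict noise_measurable_past) auto
  from measurable_compose[OF this assms(1)] show ?thesis .
qed

lemma id_measurable_past: "(\<lambda>\<omega>. \<omega>) \<in> measurable M (past n)"
  unfolding past_def by (intro measurable_vimage_algebra2 measurable_restrict) auto

lemma measurable_past_imp:
  assumes "f \<in> measurable (past n) N"
  shows "f \<in> measurable M N"
  using measurable_compose[OF id_measurable_past assms] .

lemma prob_past_noise:
  assumes a: "a \<in> sets (past n)" and C: "C \<in> sets P"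
  shows "prob (a \<inter> (\<xi> n -` C \<inter> space M)) = prob a * prob (\<xi> n -` C \<inter> space M)"
proof -
  let ?N = "\<lambda>I. \<Pi>\<^sub>M i\<in>I. P" and ?X = "\<lambda>I \<omega>. \<lambda>i\<in>I. \<xi> i \<omega>"
  have X: "?X I \<in> measurable M (?N I)" for I :: "nat set"
    by (rule measurable_restrict) simp
  obtain A where A: "A \<in> sets (?N {..<n})" "a = ?X {..<n} -` A \<inter> space M"
    using a measurable_space[OF X[of "{..<n}"]]
    unfolding past_def by (subst (asm) sets_vimage_algebra2) auto
  \<comment> \<open>Independence of blocks of indices speaks of tuples, so the condition on the
    single variable becomes a set of one-component tuples.\<close>
  define C' where "C' = (\<lambda>f. f n) -` C \<inter> space (?N {n})"
  have C': "C' \<in> sets (?N {n})"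
    unfolding C'_def by (rule measurable_sets[OF measurable_component_singleton[of n] C]) simp
  have eqC: "?X {n} -` C' \<inter> space M = \<xi> n -` C \<inter> space M"
    using measurable_space[OF X[of "{n}"]] by (auto simp: C'_def)
  have "indep_var (?N {..<n}) (?X {..<n}) (?N {n}) (?X {n})"
    using indep by (intro indep_var_restrict) auto
  from indep_varD[OF this A(1) C']
  have "prob ((\<lambda>\<omega>. (?X {..<n} \<omega>, ?X {n} \<omega>)) -` (A \<times> C') \<inter> space M)
      = prob a * prob (\<xi> n -` C \<inter> space M)"
    by (simp only: eqC A(2))
  moreover have "(\<lambda>\<omega>. (?X {..<n} \<omega>, ?X {n} \<omega>)) -` (A \<times> C') \<inter> space M
      = a \<inter> (?X {n} -` C' \<inter> space M)"
    unfolding A(2) by blast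
  ultimately show ?thesis by (simp only: eqC)
qed

text \<open>Both measures agree on rectangles by independence. The push-forward along the identity
  is \<open>M\<close> restricted to the past.\<close>

lemma distr_past_noise:
  "distr M (past n) (\<lambda>\<omega>. \<omega>) \<Otimes>\<^sub>M P = distr M (past n \<Otimes>\<^sub>M P) (\<lambda>\<omega>. (\<omega>, \<xi> n \<omega>))"
proof -
  interpret P: prob_space P by (rule prob_space_noise)
  have id [measurable]: "(\<lambda>\<omega>. \<omega>) \<in> measurable M (past n)" by (rule id_measurable_past)
  interpret past: prob_space "distr M (past n) (\<lambda>\<omega>. \<omega>)" by (rule prob_space_distr) measurable
  show ?thesis
  proof (rule pair_measure_eqI)
    show "sigma_finite_measure (distr M (past n) (\<lambda>\<omega>. \<omega>))" ..
    show "sigma_finite_measure P" ..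
    show "sets (distr M (past n) (\<lambda>\<omega>. \<omega>) \<Otimes>\<^sub>M P) = sets (distr M (past n \<Otimes>\<^sub>M P) (\<lambda>\<omega>. (\<omega>, \<xi> n \<omega>)))"
      by (simp cong: sets_pair_measure_cong)
    fix A C assume "A \<in> sets (distr M (past n) (\<lambda>\<omega>. \<omega>))" and C: "C \<in> sets P"
    then have A: "A \<in> sets (past n)" by simp
    have AM: "A \<subseteq> space M" using sets.sets_into_space[OF A] by simp
    have "emeasure (distr M (past n) (\<lambda>\<omega>. \<omega>)) A = prob A"
      using A AM by (simp add: emeasure_distr emeasure_eq_measure Int_absorb2)
    moreover have "emeasure P C = prob (\<xi> n -` C \<inter> space M)"
      using emeasure_distr[OF noise_measurable C, of n] by (simp add: distr emeasure_eq_measure)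
    moreover have "emeasure (distr M (past n \<Otimes>\<^sub>M P) (\<lambda>\<omega>. (\<omega>, \<xi> n \<omega>))) (A \<times> C)
        = prob (A \<inter> (\<xi> n -` C \<inter> space M))"
    proof -
      have "(\<lambda>\<omega>. (\<omega>, \<xi> n \<omega>)) -` (A \<times> C) \<inter> space M = A \<inter> (\<xi> n -` C \<inter> space M)"
        by blast
      then show ?thesis
        using A C by (subst emeasure_distr) (auto simp: emeasure_eq_measure)
    qed
    ultimately show "emeasure (distr M (past n) (\<lambda>\<omega>. \<omega>)) A * emeasure P C
        = emeasure (distr M (past n \<Otimes>\<^sub>M P) (\<lambda>\<omega>. (\<omega>, \<xi> n \<omega>))) (A \<times> C)"
      by (simp add: prob_past_noise[OF A C] ennreal_mult')
  qed
qed

text \<open>This takes the place of conditional expectation: the fresh sample is integrated under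
  \<open>P\<close> while everything determined by the past is frozen at \<open>\<omega>\<close>. It
  is Tonelli's theorem for the product measure just identified.\<close>

lemma nn_integral_past_noise:
  assumes \<Phi>: "\<Phi> \<in> borel_measurable (past n \<Otimes>\<^sub>M P)"
  shows "(\<integral>\<^sup>+\<omega>. \<Phi> (\<omega>, \<xi> n \<omega>) \<partial>M) = (\<integral>\<^sup>+\<omega>. \<integral>\<^sup>+s. \<Phi> (\<omega>, s) \<partial>P \<partial>M)"
proof -
  interpret P: prob_space P by (rule prob_space_noise)
  have id [measurable]: "(\<lambda>\<omega>. \<omega>) \<in> measurable M (past n)" by (rule id_measurable_past)
  have "(\<integral>\<^sup>+\<omega>. \<Phi> (\<omega>, \<xi> n \<omega>) \<partial>M)
      = (\<integral>\<^sup>+p. \<Phi> p \<partial>distr M (past n \<Otimes>\<^sub>M P) (\<lambda>\<omega>. (\<omega>, \<xi> n \<omega>)))"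
    using \<Phi> by (subst nn_integral_distr) auto
  also have "\<dots> = (\<integral>\<^sup>+p. \<Phi> p \<partial>(distr M (past n) (\<lambda>\<omega>. \<omega>) \<Otimes>\<^sub>M P))"
    by (simp add: distr_past_noise)
  also have "\<dots> = (\<integral>\<^sup>+\<omega>. \<integral>\<^sup>+s. \<Phi> (\<omega>, s) \<partial>P \<partial>distr M (past n) (\<lambda>\<omega>. \<omega>))"
    using \<Phi> by (intro P.nn_integral_fst[symmetric]) (simp cong: measurable_cong_sets)
  also have "\<dots> = (\<integral>\<^sup>+\<omega>. \<integral>\<^sup>+s. \<Phi> (\<omega>, s) \<partial>P \<partial>M)"
    using P.borel_measurable_nn_integral_fst[OF \<Phi>] by (subst nn_integral_distr) auto
  finally show ?thesis .
qed

lemma borel_measurable_past_noise: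
  assumes Z: "Z \<in> measurable (past i \<Otimes>\<^sub>M P) N" and "i < n"
  shows "(\<lambda>\<omega>. Z (\<omega>, \<xi> i \<omega>)) \<in> measurable (past n) N"
proof -
  have "(\<lambda>\<omega>. (\<omega>, \<xi> i \<omega>)) \<in> measurable (past n) (past i \<Otimes>\<^sub>M P)"
    using \<open>i < n\<close> measurable_past_mono[of "\<lambda>\<omega>. \<omega>" i "past i" n]
    by (intro measurable_Pair noise_measurable_past) auto
  from measurable_compose[OF this Z] show ?thesis .
qed

text \<open>Peel off the last increment. The partial sum before it depends only on the past, so it
  is constant in the inner integral, and the conditional bound \<open>exp (c n)\<close> is uniform
  in \<open>\<omega>\<close>.\<close>

lemma nn_integral_exp_sum_past_noise:
  fixes Z :: "nat \<Rightarrow> 'o \<times> 'w \<Rightarrow> real"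
  assumes Z: "\<And>i. Z i \<in> borel_measurable (past i \<Otimes>\<^sub>M P)"
    and le: "\<And>i \<omega>. \<omega> \<in> space M \<Longrightarrow> (\<integral>\<^sup>+s. ennreal (exp (Z i (\<omega>, s))) \<partial>P) \<le> ennreal (exp (c i))"
  shows "(\<integral>\<^sup>+\<omega>. ennreal (exp (\<Sum>i<n. Z i (\<omega>, \<xi> i \<omega>))) \<partial>M) \<le> ennreal (exp (\<Sum>i<n. c i))"
proof (induction n)
  case 0
  then show ?case by (simp add: emeasure_space_1)
next
  case (Suc n)
  define S where "S \<omega> = (\<Sum>i<n. Z i (\<omega>, \<xi> i \<omega>))" for \<omega>
  have S: "S \<in> borel_measurable (past n)"
    unfolding S_def[abs_def] by (intro borel_measurable_sum borel_measurable_past_noise Z) auto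
  have \<Phi>: "(\<lambda>(\<omega>, s). ennreal (exp (S \<omega>)) * ennreal (exp (Z n (\<omega>, s)))) \<in> borel_measurable (past n \<Otimes>\<^sub>M P)"
    using measurable_compose[OF measurable_fst S, of P] Z[of n] by (simp add: split_beta)
  have Zn: "(\<lambda>s. Z n (\<omega>, s)) \<in> borel_measurable P" if "\<omega> \<in> space M" for \<omega>
    using that by (intro measurable_compose[OF measurable_Pair1' Z]) auto
  have "(\<integral>\<^sup>+\<omega>. ennreal (exp (\<Sum>i<Suc n. Z i (\<omega>, \<xi> i \<omega>))) \<partial>M)
      = (\<integral>\<^sup>+\<omega>. ennreal (exp (S \<omega>)) * ennreal (exp (Z n (\<omega>, \<xi> n \<omega>))) \<partial>M)"
    by (simp add: S_def exp_add ennreal_mult')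
  also have "\<dots> = (\<integral>\<^sup>+\<omega>. \<integral>\<^sup>+s. ennreal (exp (S \<omega>)) * ennreal (exp (Z n (\<omega>, s))) \<partial>P \<partial>M)"
    using nn_integral_past_noise[OF \<Phi>] by simp
  also have "\<dots> = (\<integral>\<^sup>+\<omega>. ennreal (exp (S \<omega>)) * (\<integral>\<^sup>+s. ennreal (exp (Z n (\<omega>, s))) \<partial>P) \<partial>M)"
    using Zn by (intro nn_integral_cong nn_integral_cmult) auto
  also have "\<dots> \<le> (\<integral>\<^sup>+\<omega>. ennreal (exp (S \<omega>)) * ennreal (exp (c n)) \<partial>M)"
    by (intro nn_integral_mono mult_left_mono le) auto
  also have "\<dots> = (\<integral>\<^sup>+\<omega>. ennreal (exp (S \<omega>)) \<partial>M) * ennreal (exp (c n))"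
    using measurable_past_imp[OF S] by (intro nn_integral_multc) simp
  also have "\<dots> \<le> ennreal (exp (\<Sum>i<n. c i)) * ennreal (exp (c n))"
    using Suc.IH by (intro mult_right_mono) (auto simp: S_def)
  also have "\<dots> = ennreal (exp (\<Sum>i<Suc n. c i))"
    by (simp add: exp_add ennreal_mult')
  finally show ?case .
qed

lemma prob_martingale_sum_subgaussian:
  fixes Z :: "nat \<Rightarrow> 'o \<times> 'w \<Rightarrow> real"
  assumes Z: "\<And>i. Z i \<in> borel_measurable (past i \<Otimes>\<^sub>M P)"
    and mean: "\<And>i \<omega>. \<omega> \<in> space M \<Longrightarrow> has_bochner_integral P (\<lambda>s. Z i (\<omega>, s)) 0"
    and s: "\<And>i. 0 < s i"
    and tail: "\<And>i \<omega>. \<omega> \<in> space M \<Longrightarrow>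
      (\<integral>\<^sup>+r. ennreal (exp ((Z i (\<omega>, r) / s i)\<^sup>2)) \<partial>P) \<le> ennreal (exp 1)"
    and t: "0 \<le> t" "5 * \<Omega> * (\<Sum>i<n. (s i)\<^sup>2) \<le> t\<^sup>2" and n: "0 < n"
  shows "\<P>(\<omega> in M. t \<le> (\<Sum>i<n. Z i (\<omega>, \<xi> i \<omega>))) \<le> exp (- \<Omega>)"
proof (cases "t = 0")
  case True
  \<comment> \<open>For \<open>t = 0\<close> the optimal \<open>l\<close> would vanish, but then the
    hypothesis forces \<open>\<Omega> \<le> 0\<close> and the bound is trivial.\<close>
  have "0 < (\<Sum>i<n. (s i)\<^sup>2)" using n by (intro sum_pos zero_less_power s) auto
  then have "\<Omega> \<le> 0"
    using t True by (simp add: mult_le_0_iff)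
  then have "1 \<le> exp (- \<Omega>)" by simp
  then show ?thesis using prob_le_1 order_trans by blast
next
  case False
  interpret P: prob_space P by (rule prob_space_noise)
  define S where "S = (\<Sum>i<n. (s i)\<^sup>2)"
  have S: "0 < S" unfolding S_def using n by (intro sum_pos zero_less_power s) auto
  \<comment> \<open>The minimizer of the Chernoff exponent
    \<open>5 / 4 * l\<^sup>2 * S - l * t\<close>; the minimum is
    \<open>- (t\<^sup>2 / (5 * S))\<close>.\<close>
  define l where "l = 2 * t / (5 * S)"
  have l: "0 < l" using False t S by (simp add: l_def)
  have "(\<integral>\<^sup>+\<omega>. ennreal (exp (\<Sum>i<n. l * Z i (\<omega>, \<xi> i \<omega>))) \<partial>M)
      \<le> ennreal (exp (\<Sum>i<n. 5 / 4 * (l * s i)\<^sup>2))"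
    using Z mean s tail
    by (intro nn_integral_exp_sum_past_noise P.nn_integral_exp_subgaussian borel_measurable_times) auto
  then have "\<P>(\<omega> in M. l * t \<le> (\<Sum>i<n. l * Z i (\<omega>, \<xi> i \<omega>)))
      \<le> exp ((\<Sum>i<n. 5 / 4 * (l * s i)\<^sup>2) - l * t)"
    using Z
    by (intro prob_ge_le_exp_moment borel_measurable_sum borel_measurable_times
        measurable_past_imp[OF borel_measurable_past_noise[OF Z lessI]]) auto
  also have "(\<Sum>i<n. 5 / 4 * (l * s i)\<^sup>2) - l * t = - (t\<^sup>2 / (5 * S))"
  proof -
    have "(\<Sum>i<n. 5 / 4 * (l * s i)\<^sup>2) = 5 / 4 * l\<^sup>2 * S"
      by (simp add: S_def sum_distrib_left power_mult_distrib mult.assoc)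
    then show ?thesis
      using S by (simp add: l_def power2_eq_square field_simps)
  qed
  also have "exp (- (t\<^sup>2 / (5 * S))) \<le> exp (- \<Omega>)"
    using t S by (simp add: S_def[symmetric] field_simps)
  finally show ?thesis
    using l by (simp flip: sum_distrib_left)
qed

end

section \<open>Measurability of the iterates and of the oracle noise\<close>

text \<open>The shift of index matters: \<open>x n\<close> is fixed before \<open>\<xi> n\<close> is
  drawn, whereas \<open>y n\<close> and \<open>z n\<close> use it. Strong induction is required
  because the objective of \<open>z n\<close> contains all earlier sampled covectors.\<close>

lemma (in iid_noise) sigm_run_adapted:
  fixes Q :: "'e::real_normed_vector set" and G :: "'e \<Rightarrow> 'w \<Rightarrow> 'e \<Rightarrow>\<^sub>L real"
    and x y z xh w :: "nat \<Rightarrow> 'o \<Rightarrow> 'e"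
  assumes E: "finite E" "span E = (UNIV :: 'e set)"
    and h: "convex_on Q h" and prox: "prox_function Q d x0"
    and G: "(\<lambda>(x, s). G x s) \<in> borel_measurable (restrict_space borel Q \<Otimes>\<^sub>M P)"
    and \<alpha>: "\<And>i. 0 < \<alpha> i" "\<And>i. \<alpha> i \<le> B i" and BA: "\<And>i. B i \<le> (\<Sum>j\<le>i. \<alpha> j)"
    and \<beta>: "\<And>i. 0 < \<beta> i"
    and run: "\<And>\<omega>. \<omega> \<in> space M \<Longrightarrow> sigm_run Q d h \<alpha> \<beta> B G (\<lambda>i. \<xi> i \<omega>)
        (\<lambda>i. x i \<omega>) (\<lambda>i. y i \<omega>) (\<lambda>i. z i \<omega>) (\<lambda>i. xh i \<omega>) (\<lambda>i. w i \<omega>)"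
  shows "x n \<in> measurable (past n) (restrict_space borel Q) \<and>
    y n \<in> measurable (past (Suc n)) (restrict_space borel Q) \<and>
    z n \<in> measurable (past (Suc n)) (restrict_space borel Q)"
proof (induction n rule: less_induct)
  case (less n)
  have ddiff: "d differentiable_on Q" and sc: "strongly_convex_on Q 1 d"
    using prox by (auto simp: prox_function_def)
  have Q: "convex Q" using sc by (simp add: strongly_convex_on_def)
  have A: "0 < (\<Sum>j\<le>i. \<alpha> j)" for i using \<alpha>(1) by (intro sum_pos) auto
  note feasible = sigm_run_feasible[OF Q run \<alpha> BA]
  have step: "(\<lambda>\<omega>. r *\<^sub>R u \<omega> + r' *\<^sub>R v \<omega>) \<in> borel_measurable N"
    if "u \<in> measurable N (restrict_space borel Q)" "v \<in> measurable N (restrict_space borel Q)"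
    for u v :: "'o \<Rightarrow> 'e" and r r' and N
    using that by (intro borel_measurable_add_scaleR_finite_dim[OF E]) (auto simp: measurable_restrict_space2_iff)
  have oracle_value: "(\<lambda>\<omega>. blinfun_apply (G (x i \<omega>) (\<xi> i \<omega>)) u) \<in> borel_measurable (past (Suc n))"
    if i: "i \<le> n" and x: "x i \<in> measurable (past i) (restrict_space borel Q)" for i u
  proof -
    have "(\<lambda>\<omega>. (x i \<omega>, \<xi> i \<omega>)) \<in> measurable (past (Suc n)) (restrict_space borel Q \<Otimes>\<^sub>M P)"
      using i by (intro measurable_Pair measurable_past_mono[OF x] noise_measurable_past) auto
    from measurable_compose[OF this G] show ?thesis
      by (intro borel_measurable_blinfun_eval) simp
  qed
  have x: "x n \<in> measurable (past n) (restrict_space borel Q)"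
  proof (rule measurable_restrict_space2)
    show "x n \<in> space (past n) \<rightarrow> Q" using feasible(1) by auto
    show "x n \<in> borel_measurable (past n)"
    proof (cases n)
      case 0
      have "x 0 \<omega> = x0" if "\<omega> \<in> space M" for \<omega>
        using run[OF that] prox_function_argmin_unique[OF prox]
        by (auto simp: sigm_run_def Let_def)
      then show ?thesis unfolding 0 by (subst measurable_cong[of _ _ "\<lambda>_. x0"]) auto
    next
      case (Suc m)
      define \<tau> where "\<tau> = \<alpha> (Suc m) / B (Suc m)"
      have "(\<lambda>\<omega>. \<tau> *\<^sub>R z m \<omega> + (1 - \<tau>) *\<^sub>R y m \<omega>) \<in> borel_measurable (past (Suc m))"
        using less[of m] by (intro step) (auto simp: Suc)
      moreover have "x (Suc m) \<omega> = \<tau> *\<^sub>R z m \<omega> + (1 - \<tau>) *\<^sub>R y m \<omega>" if "\<omega> \<in> space M" for \<omega>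
        using run[OF that] unfolding sigm_run_def Let_def \<tau>_def by blast
      ultimately show ?thesis
        unfolding Suc by (subst measurable_cong[of _ _ "\<lambda>\<omega>. \<tau> *\<^sub>R z m \<omega> + (1 - \<tau>) *\<^sub>R y m \<omega>"]) auto
    qed
  qed
  have g: "(\<lambda>\<omega>. blinfun_apply (G (x i \<omega>) (\<xi> i \<omega>)) u) \<in> borel_measurable (past (Suc n))"
    if "i \<le> n" for i u
    using that less[of i] x by (cases "i = n") (auto intro!: oracle_value)
  have z: "z n \<in> measurable (past (Suc n)) (restrict_space borel Q)"
  proof (rule borel_measurable_argmin[OF E ddiff sc \<beta>[of n]])
    show "convex_on Q (\<lambda>u. (\<Sum>j\<le>n. \<alpha> j) * h u)"
      using A[of n] by (intro convex_on_cmul h) simp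
    show "(\<lambda>\<omega>. (\<Sum>i\<le>n. \<alpha> i *\<^sub>R G (x i \<omega>) (\<xi> i \<omega>)) (u - v)) \<in> borel_measurable (past (Suc n))" for u v
      using g by (simp add: blinfun.sum_left blinfun.scaleR_left)
    fix \<omega> assume \<omega>: "\<omega> \<in> space (past (Suc n))"
    show "is_arg_min (\<lambda>u. \<beta> n * d u + (\<Sum>i\<le>n. \<alpha> i * blinfun_apply (G (x i \<omega>) (\<xi> i \<omega>)) (u - x i \<omega>))
        + (\<Sum>j\<le>n. \<alpha> j) * h u) (\<lambda>u. u \<in> Q) (z n \<omega>)"
      using run[of \<omega>] \<omega> unfolding sigm_run_def Let_def by simp
    fix u v
    show "\<beta> n * d u + (\<Sum>i\<le>n. \<alpha> i * G (x i \<omega>) (\<xi> i \<omega>) (u - x i \<omega>)) + (\<Sum>j\<le>n. \<alpha> j) * h u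
        - (\<beta> n * d v + (\<Sum>i\<le>n. \<alpha> i * G (x i \<omega>) (\<xi> i \<omega>) (v - x i \<omega>)) + (\<Sum>j\<le>n. \<alpha> j) * h v)
      = \<beta> n * (d u - d v) + ((\<Sum>j\<le>n. \<alpha> j) * h u - (\<Sum>j\<le>n. \<alpha> j) * h v)
        + (\<Sum>i\<le>n. \<alpha> i *\<^sub>R G (x i \<omega>) (\<xi> i \<omega>)) (u - v)"
      by (simp add: blinfun.sum_left blinfun.scaleR_left blinfun.diff_right right_diff_distrib sum_subtractf)
  qed
  have y: "y n \<in> measurable (past (Suc n)) (restrict_space borel Q)"
  proof (cases n)
    case 0
    show ?thesis
    proof (rule borel_measurable_argmin[OF E ddiff sc \<beta>[of 0]])
      show "convex_on Q (\<lambda>u. \<alpha> 0 * h u)"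
        using \<alpha>(1)[of 0] by (intro convex_on_cmul h) simp
      show "(\<lambda>\<omega>. (\<alpha> 0 *\<^sub>R G (x 0 \<omega>) (\<xi> 0 \<omega>)) (u - v)) \<in> borel_measurable (past (Suc n))" for u v
        using g[of 0] by (simp add: blinfun.scaleR_left)
      fix \<omega> assume \<omega>: "\<omega> \<in> space (past (Suc n))"
      show "is_arg_min (\<lambda>u. \<beta> 0 * d u + \<alpha> 0 * blinfun_apply (G (x 0 \<omega>) (\<xi> 0 \<omega>)) (u - x 0 \<omega>)
          + \<alpha> 0 * h u) (\<lambda>u. u \<in> Q) (y n \<omega>)"
        using run[of \<omega>] \<omega> unfolding sigm_run_def Let_def 0 by simp
      fix u v
      show "\<beta> 0 * d u + \<alpha> 0 * G (x 0 \<omega>) (\<xi> 0 \<omega>) (u - x 0 \<omega>) + \<alpha> 0 * h u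
          - (\<beta> 0 * d v + \<alpha> 0 * G (x 0 \<omega>) (\<xi> 0 \<omega>) (v - x 0 \<omega>) + \<alpha> 0 * h v)
        = \<beta> 0 * (d u - d v) + (\<alpha> 0 * h u - \<alpha> 0 * h v) + (\<alpha> 0 *\<^sub>R G (x 0 \<omega>) (\<xi> 0 \<omega>)) (u - v)"
        by (simp add: blinfun.scaleR_left blinfun.diff_right right_diff_distrib)
    qed
  next
    case (Suc m)
    have zm: "z m \<in> measurable (past (Suc n)) (restrict_space borel Q)"
      and ym: "y m \<in> measurable (past (Suc n)) (restrict_space borel Q)"
      using less[of m] by (auto simp: Suc intro: measurable_past_mono)
    \<comment> \<open>Up to terms constant in \<open>u\<close>, the Bregman distance is
      \<open>d\<close> minus this functional, so the derivative at the random point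
      \<open>z m \<omega>\<close> joins the linear part of the objective of
      \<open>xh n\<close>.\<close>
    define D where "D \<omega> = Blinfun (frechet_derivative d (at (z m \<omega>) within Q))" for \<omega>
    have D: "blinfun_apply (D \<omega>) = frechet_derivative d (at (z m \<omega>) within Q)" if "\<omega> \<in> space M" for \<omega>
    proof -
      have "d differentiable (at (z m \<omega>) within Q)"
        using ddiff feasible(3)[OF that] by (simp add: differentiable_on_def)
      then show ?thesis
        unfolding D_def by (intro bounded_linear_Blinfun_apply)
          (simp add: frechet_derivative_works has_derivative_bounded_linear)
    qed
    have xh: "xh n \<in> measurable (past (Suc n)) (restrict_space borel Q)"
    proof (rule borel_measurable_argmin[OF E ddiff sc \<beta>[of m]])
      show "convex_on Q (\<lambda>u. \<alpha> n * h u)"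
        using \<alpha>(1)[of n] by (intro convex_on_cmul h) simp
      show "(\<lambda>\<omega>. (\<alpha> n *\<^sub>R G (x n \<omega>) (\<xi> n \<omega>) - \<beta> m *\<^sub>R D \<omega>) (u - v)) \<in> borel_measurable (past (Suc n))"
        if uv: "u \<in> Q" "v \<in> Q" for u v
      proof -
        have "(\<lambda>\<omega>. D \<omega> (u - v)) \<in> borel_measurable (past (Suc n))"
          using borel_measurable_frechet_derivative_within[OF Q ddiff zm uv]
          by (subst measurable_cong[of _ _ "\<lambda>\<omega>. frechet_derivative d (at (z m \<omega>) within Q) (u - v)"])
            (simp_all add: D)
        then show ?thesis
          using g[of n] by (simp add: blinfun.diff_left blinfun.scaleR_left)
      qed
      fix \<omega> assume "\<omega> \<in> space (past (Suc n))"
      then have \<omega>: "\<omega> \<in> space M" by simp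
      show "is_arg_min (\<lambda>u. \<beta> m * bregman_distance Q d u (z m \<omega>)
          + \<alpha> n * blinfun_apply (G (x n \<omega>) (\<xi> n \<omega>)) (u - z m \<omega>) + \<alpha> n * h u) (\<lambda>u. u \<in> Q) (xh n \<omega>)"
        using run[OF \<omega>] unfolding sigm_run_def Let_def Suc by blast
      fix u v
      show "\<beta> m * bregman_distance Q d u (z m \<omega>) + \<alpha> n * G (x n \<omega>) (\<xi> n \<omega>) (u - z m \<omega>) + \<alpha> n * h u
          - (\<beta> m * bregman_distance Q d v (z m \<omega>) + \<alpha> n * G (x n \<omega>) (\<xi> n \<omega>) (v - z m \<omega>) + \<alpha> n * h v)
        = \<beta> m * (d u - d v) + (\<alpha> n * h u - \<alpha> n * h v)
          + (\<alpha> n *\<^sub>R G (x n \<omega>) (\<xi> n \<omega>) - \<beta> m *\<^sub>R D \<omega>) (u - v)"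
        unfolding bregman_distance_def D[OF \<omega>, symmetric]
        by (simp add: blinfun.diff_left blinfun.scaleR_left blinfun.diff_right algebra_simps)
    qed
    define \<tau> where "\<tau> = \<alpha> (Suc m) / B (Suc m)"
    define w' where "w' \<omega> = \<tau> *\<^sub>R xh n \<omega> + (1 - \<tau>) *\<^sub>R y m \<omega>" for \<omega>
    have w_eq: "w n \<omega> = w' \<omega>" if "\<omega> \<in> space M" for \<omega>
      using run[OF that] unfolding sigm_run_def Let_def \<tau>_def w'_def Suc by blast
    have w: "w' \<in> measurable (past (Suc n)) (restrict_space borel Q)"
    proof (rule measurable_restrict_space2)
      show "w' \<in> space (past (Suc n)) \<rightarrow> Q"
        using feasible(5)[of _ m] w_eq by (auto simp: Suc)
      show "w' \<in> borel_measurable (past (Suc n))"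
        unfolding w'_def[abs_def] by (rule step[OF xh ym])
    qed
    define \<mu> \<nu> where "\<mu> = ((\<Sum>j\<le>Suc m. \<alpha> j) - B (Suc m)) / (\<Sum>j\<le>Suc m. \<alpha> j)"
      and "\<nu> = B (Suc m) / (\<Sum>j\<le>Suc m. \<alpha> j)"
    have y_eq: "y n \<omega> = \<mu> *\<^sub>R y m \<omega> + \<nu> *\<^sub>R w' \<omega>" if "\<omega> \<in> space M" for \<omega>
      unfolding w_eq[OF that, symmetric] using run[OF that]
      unfolding sigm_run_def Let_def \<mu>_def \<nu>_def Suc by blast
    show ?thesis
    proof (rule measurable_restrict_space2)
      show "y n \<in> space (past (Suc n)) \<rightarrow> Q" using feasible(2) by auto
      show "y n \<in> borel_measurable (past (Suc n))"
        using step[OF ym w, of \<mu> \<nu>]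
        by (subst measurable_cong[of _ _ "\<lambda>\<omega>. \<mu> *\<^sub>R y m \<omega> + \<nu> *\<^sub>R w' \<omega>"]) (simp_all add: y_eq)
    qed
  qed
  show ?case using x y z by blast
qed

text \<open>Measurability of \<open>go\<close> comes from unbiasedness: each evaluation
  \<open>go x u\<close> is an integral of the jointly measurable \<open>G\<close> over its second
  argument.\<close>

lemma borel_measurable_oracle_noise:
  fixes G :: "'e::real_normed_vector \<Rightarrow> 'w \<Rightarrow> 'e \<Rightarrow>\<^sub>L real"
  assumes E: "finite E" "span E = (UNIV :: 'e set)"
    and P: "prob_space P" and approx: "stochastic_approximation Q P \<sigma> fo go F G"
  shows "(\<lambda>(x, s). G x s - go x) \<in> borel_measurable (restrict_space borel Q \<Otimes>\<^sub>M P)"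
proof -
  interpret prob_space P by fact
  let ?N = "restrict_space borel Q"
  have G: "(\<lambda>(x, s). G x s) \<in> borel_measurable (?N \<Otimes>\<^sub>M P)"
    and mean: "\<And>x u. x \<in> Q \<Longrightarrow> has_bochner_integral P (\<lambda>s. blinfun_apply (G x s) u) (go x u)"
    using approx by (auto simp: stochastic_approximation_def)
  have Gu: "(\<lambda>(x, s). blinfun_apply (G x s) u) \<in> borel_measurable (?N \<Otimes>\<^sub>M P)" for u
    using borel_measurable_blinfun_eval[OF G, of u] by (simp add: split_beta)
  have "(\<lambda>x. \<integral>s. blinfun_apply (G x s) u \<partial>P) \<in> borel_measurable ?N" for u
    using Gu by (intro borel_measurable_lebesgue_integral) (simp add: split_beta)
  moreover have "(\<integral>s. blinfun_apply (G x s) u \<partial>P) = go x u" if "x \<in> space ?N" for x u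
    using has_bochner_integral_integral_eq[OF mean] that by (simp add: space_restrict_space)
  ultimately have go: "(\<lambda>x. blinfun_apply (go x) u) \<in> borel_measurable ?N" for u
    by (subst measurable_cong[of _ _ "\<lambda>x. \<integral>s. blinfun_apply (G x s) u \<partial>P"]) simp_all
  show ?thesis
  proof (rule borel_measurable_blinfun_finite_dim[OF E])
    fix u
    have "(\<lambda>p. blinfun_apply (G (fst p) (snd p)) u - blinfun_apply (go (fst p)) u)
        \<in> borel_measurable (?N \<Otimes>\<^sub>M P)"
      using Gu[of u] measurable_compose[OF measurable_fst go]
      by (intro borel_measurable_diff) (simp_all add: split_beta)
    then show "(\<lambda>p. blinfun_apply (case p of (x, s) \<Rightarrow> G x s - go x) u) \<in> borel_measurable (?N \<Otimes>\<^sub>M P)"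
      by (simp add: split_beta blinfun.diff_left)
  qed
qed

section \<open>The parameter sequences\<close>

text \<open>Consecutive ratios differ by \<open>1 / p\<close>, which cancels the factor
  \<open>p\<close> in the derivative of \<open>r powr p\<close>. By the mean value theorem each
  increment is therefore at most the next summand.\<close>

lemma powr_le_sum_powr:
  fixes p :: real
  assumes p: "1 \<le> p"
  shows "((real k + p) / p) powr p \<le> (\<Sum>i\<le>k. ((real i + p) / p) powr (p - 1))"
proof (induction k)
  case 0
  then show ?case using p by simp
next
  case (Suc k)
  define r where "r = (real k + p) / p"
  have r: "0 < r" using p by (simp add: r_def divide_simps)
  have rS: "(real (Suc k) + p) / p = r + 1 / p" by (simp add: r_def add_divide_distrib)
  have "\<exists>z>r. z < r + 1 / p \<and> (r + 1 / p) powr p - r powr p = (r + 1 / p - r) * (p * z powr (p - 1))"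
    using p r by (intro MVT2) (auto intro!: derivative_eq_intros)
  then obtain z where z: "r < z" "z < r + 1 / p"
    and eq: "(r + 1 / p) powr p - r powr p = (r + 1 / p - r) * (p * z powr (p - 1))"
    by blast
  have "(r + 1 / p) powr p - r powr p = z powr (p - 1)"
    using eq p by simp
  also have "\<dots> \<le> (r + 1 / p) powr (p - 1)"
    using z r p by (intro powr_mono2) auto
  finally show ?case
    using Suc.IH unfolding sum.atMost_Suc rS r_def[symmetric] by linarith
qed

text \<open>Splitting off the factor \<open>t powr (q - 1 / 2)\<close>, monotone in \<open>t\<close>
  because \<open>q \<ge> 1 / 2\<close>, reduces the claim to square roots. There it is the
  arithmetic-geometric mean inequality for \<open>t\<close> and \<open>t - 1\<close>.\<close>

lemma powr_diff_one_ge: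
  fixes t q :: real
  assumes t: "1 \<le> t" and q: "1 / 2 \<le> q"
  shows "t powr (q - 1) \<le> 2 * (t powr q - (t - 1) powr q)"
proof -
  define u where "u = t powr (q - 1 / 2)"
  have u: "0 < u" using t by (simp add: u_def)
  have "(t - 1) powr q = sqrt (t - 1) * (t - 1) powr (q - 1 / 2)"
    using t by (simp add: powr_half_sqrt[symmetric] flip: powr_add)
  also have "\<dots> \<le> sqrt (t - 1) * u"
    unfolding u_def using t q by (intro mult_left_mono powr_mono2) auto
  finally have 1: "(t - 1) powr q \<le> sqrt (t - 1) * u" .
  have 2: "t powr q = sqrt t * u"
    using t by (simp add: u_def powr_half_sqrt[symmetric] flip: powr_add)
  have 3: "t powr (q - 1) * sqrt t = u"
    using t by (simp add: u_def powr_half_sqrt[symmetric] flip: powr_add)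
  have 4: "1 \<le> 2 * (sqrt t * (sqrt t - sqrt (t - 1)))"
  proof -
    have "2 * (sqrt t * sqrt (t - 1)) \<le> sqrt t ^ 2 + sqrt (t - 1) ^ 2"
      using sum_squares_bound[of "sqrt t" "sqrt (t - 1)"] by simp
    then show ?thesis using t by (simp add: algebra_simps power2_eq_square)
  qed
  have "t powr (q - 1) * 1 \<le> t powr (q - 1) * (2 * (sqrt t * (sqrt t - sqrt (t - 1))))"
    by (intro mult_left_mono 4) simp
  also have "\<dots> = 2 * (t powr (q - 1) * sqrt t) * (sqrt t - sqrt (t - 1))" by simp
  also have "\<dots> = 2 * (sqrt t * u - sqrt (t - 1) * u)" unfolding 3 by (simp add: algebra_simps)
  also have "\<dots> \<le> 2 * (t powr q - (t - 1) powr q)"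
    using 1 2 by (intro mult_left_mono diff_mono) auto
  finally show ?thesis by simp
qed

lemma sum_powr_le_powr:
  fixes p :: real
  assumes p: "1 \<le> p"
  shows "(\<Sum>i\<le>k. (real i + p) powr (p - 3 / 2)) \<le> 2 * (real k + p) powr (p - 1 / 2)"
proof (induction k)
  case 0
  have "p powr (p - 3 / 2) \<le> p powr (p - 1 / 2)" using p by (intro powr_mono) auto
  then show ?case by (simp add: order_trans[OF _ mult_right_mono[of 1 2 "p powr (p - 1/2)"]])
next
  case (Suc k)
  have "(real (Suc k) + p) powr (p - 1 / 2 - 1)
      \<le> 2 * ((real (Suc k) + p) powr (p - 1 / 2) - (real (Suc k) + p - 1) powr (p - 1 / 2))"
    using p by (intro powr_diff_one_ge) auto
  then show ?case using Suc.IH by (simp add: algebra_simps)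
qed

locale sigm_parameters =
  fixes p a b L \<sigma> R :: real and \<alpha> \<beta> B :: "nat \<Rightarrow> real"
  assumes p: "1 \<le> p" "p \<le> 2" and L: "0 < L" and \<sigma>: "0 \<le> \<sigma>" and R: "0 < R"
    and a: "a = 2 powr ((2 * p - 1) / 2)"
    and b: "b = 2 powr ((5 - 2 * p) / 4) * p powr ((1 - 2 * p) / 2)"
    and \<alpha>: "\<And>i. \<alpha> i = 1 / a * ((real i + p) / p) powr (p - 1)"
    and \<beta>: "\<And>i. \<beta> i = L + b * \<sigma> / R * (real i + p + 1) powr ((2 * p - 1) / 2)"
    and B: "\<And>i. B i = a * (\<alpha> i)\<^sup>2"
begin

lemma a_ge_1: "1 \<le> a"
  unfolding a using p by (intro ge_one_powr_ge_zero) auto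

lemma b_pos: "0 < b"
  unfolding b using p by simp

lemma ratio_ge_1: "1 \<le> (real i + p) / p"
  using p by simp

lemma alpha_pos: "0 < \<alpha> i"
proof -
  have "0 < (real i + p) / p" using ratio_ge_1[of i] by linarith
  then have "0 < ((real i + p) / p) powr (p - 1)" by (metis powr_gt_zero less_irrefl)
  then show ?thesis unfolding \<alpha> using a_ge_1 by simp
qed

lemma B_eq: "B i = \<alpha> i * ((real i + p) / p) powr (p - 1)"
  unfolding B \<alpha> using a_ge_1 by (simp add: power2_eq_square)

lemma alpha_le_B: "\<alpha> i \<le> B i"
  using alpha_pos[of i] ge_one_powr_ge_zero[OF ratio_ge_1, of "p - 1" i] p
  by (simp add: B_eq)

lemma B_0: "B 0 = \<alpha> 0"
  using p by (simp add: B_eq)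

lemma sum_alpha_ge: "1 / a * ((real k + p) / p) powr p \<le> (\<Sum>i\<le>k. \<alpha> i)"
proof -
  have "1 / a * ((real k + p) / p) powr p \<le> 1 / a * (\<Sum>i\<le>k. ((real i + p) / p) powr (p - 1))"
    using a_ge_1 by (intro mult_left_mono powr_le_sum_powr p) auto
  then show ?thesis by (simp add: \<alpha> sum_distrib_left)
qed

lemma sum_alpha_pos: "0 < (\<Sum>i\<le>k. \<alpha> i)"
  by (intro sum_pos alpha_pos) auto

text \<open>\<open>B k\<close> has exponent \<open>2 * p - 2\<close> and the lower bound for the sum
  has exponent \<open>p\<close>; the assumption \<open>p \<le> 2\<close> compares them.\<close>

lemma B_le_sum_alpha: "B k \<le> (\<Sum>i\<le>k. \<alpha> i)"
proof -
  have "B k = 1 / a * ((real k + p) / p) powr (2 * p - 2)"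
    using ratio_ge_1[of k] unfolding B_eq \<alpha> by (simp add: mult.assoc flip: powr_add)
  also have "\<dots> \<le> 1 / a * ((real k + p) / p) powr p"
    using a_ge_1 p ratio_ge_1[of k] by (intro mult_left_mono powr_mono) auto
  also note sum_alpha_ge
  finally show ?thesis .
qed

lemma L_le_beta: "L \<le> \<beta> i"
  unfolding \<beta> using b_pos \<sigma> R by simp

lemma beta_mono: "\<beta> i \<le> \<beta> (Suc i)"
  unfolding \<beta> using b_pos \<sigma> R p
  by (intro add_left_mono mult_left_mono powr_mono2) auto

text \<open>The summand 1 inside \<open>\<beta>\<close> compensates the shift to
  \<open>i - 1\<close> for positive \<open>i\<close>; at \<open>i = 0\<close>, where the subtraction
  is truncated, it only helps. The \<open>L\<close> parts leave \<open>(a - 1) * L\<close>, which is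
  nonnegative.\<close>

lemma step_gap: "a * (b * \<sigma> / R) * (real i + p) powr (p - 1 / 2) \<le> a * \<beta> (i - 1) - L"
proof -
  have "(real i + p) powr (p - 1 / 2) \<le> (real (i - 1) + p + 1) powr (p - 1 / 2)"
    using p by (intro powr_mono2) auto
  then have "b * \<sigma> / R * (real i + p) powr (p - 1 / 2)
      \<le> b * \<sigma> / R * (real (i - 1) + p + 1) powr (p - 1 / 2)"
    using b_pos \<sigma> R by (intro mult_left_mono) auto
  also have "\<dots> = \<beta> (i - 1) - L"
    unfolding \<beta> by (simp add: diff_divide_distrib)
  finally have "b * \<sigma> / R * (real i + p) powr (p - 1 / 2) \<le> \<beta> (i - 1) - L" .
  then have "a * (b * \<sigma> / R * (real i + p) powr (p - 1 / 2)) \<le> a * (\<beta> (i - 1) - L)"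
    using a_ge_1 by (intro mult_left_mono) auto
  moreover have "1 * L \<le> a * L" using a_ge_1 L by (intro mult_right_mono) auto
  ultimately show ?thesis by (simp add: algebra_simps)
qed

lemma sum_B_le: "(\<Sum>i\<le>k. B i) \<le> (\<Sum>i\<le>k. \<alpha> i) * ((real k + p) / p) powr (p - 1)"
  unfolding sum_distrib_right
proof (intro sum_mono)
  fix i assume "i \<in> {..k}"
  then show "B i \<le> \<alpha> i * ((real k + p) / p) powr (p - 1)"
    unfolding B_eq using p alpha_pos[of i] ratio_ge_1[of i]
    by (intro mult_left_mono powr_mono2 divide_right_mono) auto
qed

text \<open>The exponent \<open>(2 * p - 3) / 2\<close> is one less than that of \<open>a\<close>,
  so multiplication by the lower bound for the sum of the weights leaves exactly 1/2.\<close>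

lemma deterministic_term:
  "L * R\<^sup>2 / 2 \<le> (\<Sum>i\<le>k. \<alpha> i)
    * (L * R\<^sup>2 * p powr p * 2 powr ((2 * p - 3) / 2) / (real k + p) powr p)"
proof -
  define W where "W = p powr p * 2 powr ((2 * p - 3) / 2) / (real k + p) powr p"
  have "1 / a * ((real k + p) / p) powr p * W = 2 powr ((2 * p - 3) / 2) / a"
    using p by (simp add: W_def powr_divide)
  also have "\<dots> = 2 powr ((2 * p - 3) / 2 - (2 * p - 1) / 2)"
    by (simp only: a powr_diff)
  also have "(2 * p - 3) / 2 - (2 * p - 1) / 2 = - 1"
    by (simp add: field_simps)
  also have "(2::real) powr (- 1) = 1 / 2"
    by (simp add: powr_minus)
  finally have "1 / 2 = 1 / a * ((real k + p) / p) powr p * W" by (rule sym)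
  also have "\<dots> \<le> (\<Sum>i\<le>k. \<alpha> i) * W"
    by (intro mult_right_mono sum_alpha_ge) (simp add: W_def)
  finally have "1 / 2 \<le> (\<Sum>i\<le>k. \<alpha> i) * W" .
  then have "L * R\<^sup>2 * (1 / 2) \<le> L * R\<^sup>2 * ((\<Sum>i\<le>k. \<alpha> i) * W)"
    using L R by (intro mult_left_mono) auto
  then show ?thesis by (simp add: W_def mult_ac)
qed

lemma ab_eq: "a * b = 2 powr ((2 * p + 3) / 4) * p powr (1 / 2 - p)"
proof -
  have "a * b = 2 powr ((2 * p - 1) / 2 + (5 - 2 * p) / 4) * p powr ((1 - 2 * p) / 2)"
    by (simp only: a b powr_add mult.assoc)
  moreover have "(2 * p - 1) / 2 + (5 - 2 * p) / 4 = (2 * p + 3) / 4" "(1 - 2 * p) / 2 = 1 / 2 - p"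
    by (simp_all add: field_simps)
  ultimately show ?thesis by simp
qed

text \<open>The threshold coefficient equals \<open>a * b\<close> up to powers of \<open>p\<close>
  and \<open>k + p\<close>; the lower bound for the sum of the weights turns it into exactly
  \<open>b\<close>.\<close>

lemma stochastic_term:
  "b * \<sigma> * R * (real k + p + 2) powr (p - 1 / 2)
    \<le> (\<Sum>i\<le>k. \<alpha> i) * (\<sigma> * R * 2 powr ((3 + 2 * p) / 4) * sqrt p
        * (real k + p + 2) powr (p - 1 / 2) / (real k + p) powr p)"
proof -
  define W where "W = 2 powr ((3 + 2 * p) / 4) * sqrt p / (real k + p) powr p"
  have "1 / a * ((real k + p) / p) powr p * W = 2 powr ((3 + 2 * p) / 4) * (sqrt p / p powr p) / a"
    using p by (simp add: W_def powr_divide)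
  also have "sqrt p / p powr p = p powr (1 / 2 - p)"
    using p by (simp add: powr_diff powr_half_sqrt)
  also have "2 powr ((3 + 2 * p) / 4) * p powr (1 / 2 - p) / a = b"
    using ab_eq a_ge_1 by (simp add: add.commute field_simps)
  finally have "b = 1 / a * ((real k + p) / p) powr p * W" by (rule sym)
  also have "\<dots> \<le> (\<Sum>i\<le>k. \<alpha> i) * W"
    using p by (intro mult_right_mono sum_alpha_ge) (simp add: W_def)
  finally have "b \<le> (\<Sum>i\<le>k. \<alpha> i) * W" .
  then have "b * (\<sigma> * R * (real k + p + 2) powr (p - 1 / 2))
      \<le> (\<Sum>i\<le>k. \<alpha> i) * W * (\<sigma> * R * (real k + p + 2) powr (p - 1 / 2))"
    using \<sigma> R by (intro mult_right_mono) auto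
  then show ?thesis by (simp add: W_def mult_ac)
qed

text \<open>\<open>B i\<close> grows with exponent \<open>2 * p - 2\<close> and the gap with
  \<open>p - 1 / 2\<close>, so the quotients have exponent \<open>p - 3 / 2\<close> and sum to
  exponent \<open>p - 1 / 2\<close>. What remains is to see that \<open>b\<close> is large
  enough.\<close>

lemma variance_term:
  assumes \<sigma>0: "0 < \<sigma>"
  shows "\<sigma>\<^sup>2 * (\<Sum>i\<le>k. B i / (2 * (a * \<beta> (i - 1) - L)))
    \<le> b * \<sigma> * R * (real k + p + 2) powr (p - 1 / 2) / 2"
proof -
  \<comment> \<open>Collects the factors independent of \<open>i\<close> after inserting the closed
    form of \<open>B i\<close> and the lower bound for the gap.\<close>
  define K where "K = \<sigma> * R * p powr (2 - 2 * p) / (2 * a\<^sup>2 * b)"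
  have K: "0 < K" unfolding K_def using \<sigma>0 R p a_ge_1 b_pos by simp
  have bound: "\<sigma>\<^sup>2 * (B i / (2 * (a * \<beta> (i - 1) - L))) \<le> K * (real i + p) powr (p - 3 / 2)" for i
  proof -
    have ip: "0 < real i + p" using p by simp
    define g where "g = a * (b * \<sigma> / R) * (real i + p) powr (p - 1 / 2)"
    have g: "0 < g" unfolding g_def using a_ge_1 b_pos \<sigma>0 R ip by simp
    have B_i: "B i = (real i + p) powr (2 * p - 2) * p powr (2 - 2 * p) / a"
    proof -
      have "B i = 1 / a * ((real i + p) / p) powr (2 * p - 2)"
        using ratio_ge_1[of i] unfolding B_eq \<alpha> by (simp add: mult.assoc flip: powr_add)
      also have "((real i + p) / p) powr (2 * p - 2) = (real i + p) powr (2 * p - 2) * p powr (- (2 * p - 2))"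
        using p by (simp only: powr_minus) (simp add: powr_divide field_simps)
      finally show ?thesis by simp
    qed
    have "B i / (2 * (a * \<beta> (i - 1) - L)) \<le> B i / (2 * g)"
      using step_gap[of i, folded g_def] g alpha_le_B[of i] alpha_pos[of i]
      by (intro frac_le) auto
    then have "\<sigma>\<^sup>2 * (B i / (2 * (a * \<beta> (i - 1) - L))) \<le> \<sigma>\<^sup>2 * (B i / (2 * g))"
      by (intro mult_left_mono) auto
    also have "\<sigma>\<^sup>2 * (B i / (2 * g))
        = K * ((real i + p) powr (2 * p - 2) / (real i + p) powr (p - 1 / 2))"
      using \<sigma>0 R a_ge_1 b_pos ip by (simp add: B_i K_def g_def field_simps power2_eq_square)
    also have "(real i + p) powr (2 * p - 2) / (real i + p) powr (p - 1 / 2) = (real i + p) powr (p - 3 / 2)"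
      by (simp add: powr_diff[symmetric])
    finally show ?thesis .
  qed
  have "\<sigma>\<^sup>2 * (\<Sum>i\<le>k. B i / (2 * (a * \<beta> (i - 1) - L))) \<le> (\<Sum>i\<le>k. K * (real i + p) powr (p - 3 / 2))"
    unfolding sum_distrib_left by (intro sum_mono bound)
  also have "\<dots> \<le> K * (2 * (real k + p) powr (p - 1 / 2))"
    unfolding sum_distrib_left[symmetric] using K p by (intro mult_left_mono sum_powr_le_powr) auto
  also have "\<dots> \<le> K * (2 * (real k + p + 2) powr (p - 1 / 2))"
    using K p by (intro mult_left_mono powr_mono2) auto
  also have "\<dots> = 2 * K * (real k + p + 2) powr (p - 1 / 2)" by simp
  also have "\<dots> \<le> b * \<sigma> * R / 2 * (real k + p + 2) powr (p - 1 / 2)"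
  proof (rule mult_right_mono)
    \<comment> \<open>The condition on \<open>b\<close>. Removing \<open>p powr (1 - 2 * p)\<close>
      from both sides leaves \<open>2 * p \<le> 2 powr ((2 * p + 3) / 2)\<close>, with 4 in
      between.\<close>
    have "2 * p powr (2 - 2 * p) \<le> (a * b)\<^sup>2"
    proof -
      have "2 * p \<le> 2 powr 2" using p by simp
      also have "\<dots> \<le> 2 powr ((2 * p + 3) / 2)" using p by (intro powr_mono) auto
      finally have "2 * p * p powr (1 - 2 * p) \<le> 2 powr ((2 * p + 3) / 2) * p powr (1 - 2 * p)"
        by (intro mult_right_mono) auto
      moreover have "2 * p powr (2 - 2 * p) = 2 * p * p powr (1 - 2 * p)"
        using p powr_add[of p 1 "1 - 2 * p"] by simp
      moreover have "2 powr ((2 * p + 3) / 2) * p powr (1 - 2 * p) = (a * b)\<^sup>2"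
        unfolding ab_eq power_mult_distrib
        by (simp add: power2_eq_square powr_add[symmetric])
      ultimately show ?thesis by (simp only:)
    qed
    then have "2 * p powr (2 - 2 * p) * (\<sigma> * R) \<le> (a * b)\<^sup>2 * (\<sigma> * R)"
      using \<sigma>0 R by (intro mult_right_mono) auto
    then show "2 * K \<le> b * \<sigma> * R / 2"
      unfolding K_def using a_ge_1 b_pos by (simp add: field_simps power2_eq_square)
  qed simp
  finally show ?thesis by simp
qed

text \<open>This is the condition of the Chernoff bound for \<open>s = D * \<sigma>\<close>. The
  squared weights sum to at most \<open>k + 1\<close> times the square of the largest bound, and the
  squared threshold factor is \<open>24 * \<Omega> * s\<^sup>2 / r\<close>; it remains to compare
  \<open>5 * (k + 1)\<close> with \<open>24 * r\<close>.\<close>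

lemma deviation_term:
  assumes \<Omega>: "0 \<le> \<Omega>"
  shows "5 * \<Omega> * (\<Sum>i\<le>k. (\<alpha> i * s)\<^sup>2)
    \<le> ((\<Sum>i\<le>k. \<alpha> i) * (2 * s * sqrt (6 * \<Omega> * p) / sqrt (real k + p)))\<^sup>2"
proof -
  define r where "r = (real k + p) / p"
  have r: "1 \<le> r" unfolding r_def by (rule ratio_ge_1)
  have kp: "0 < real k + p" using p by simp
  have 1: "(\<Sum>i\<le>k. (\<alpha> i)\<^sup>2) \<le> (1 / a)\<^sup>2 * (real k + 1) * r powr (2 * p - 2)"
  proof -
    have bound: "(\<alpha> i)\<^sup>2 \<le> (1 / a)\<^sup>2 * r powr (2 * p - 2)" if "i \<in> {..k}" for i
    proof -
      have "\<alpha> i \<le> 1 / a * r powr (p - 1)"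
        unfolding \<alpha> r_def using that a_ge_1 p
        by (intro mult_left_mono powr_mono2 divide_right_mono) auto
      then have "(\<alpha> i)\<^sup>2 \<le> (1 / a * r powr (p - 1))\<^sup>2"
        using alpha_pos[of i] by (intro power_mono) auto
      also have "\<dots> = (1 / a)\<^sup>2 * r powr (2 * p - 2)"
        unfolding power_mult_distrib by (simp add: power2_eq_square powr_add[symmetric])
      finally show ?thesis .
    qed
    have "(\<Sum>i\<le>k. (\<alpha> i)\<^sup>2) \<le> real (card {..k}) * ((1 / a)\<^sup>2 * r powr (2 * p - 2))"
      by (rule sum_bounded_above) (rule bound)
    then show ?thesis by (simp add: mult_ac add.commute)
  qed
  have 2: "(1 / a)\<^sup>2 * (r powr (2 * p - 2) * r\<^sup>2) \<le> (\<Sum>i\<le>k. \<alpha> i)\<^sup>2"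
  proof -
    have "(1 / a * r powr p)\<^sup>2 \<le> (\<Sum>i\<le>k. \<alpha> i)\<^sup>2"
      using sum_alpha_ge[of k] a_ge_1 by (intro power_mono) (auto simp: r_def)
    moreover have "r powr (2 * p - 2) * r\<^sup>2 = (r powr p)\<^sup>2"
      using r powr_add[of r "2 * p - 2" 2] powr_add[of r p p] by (simp add: power2_eq_square)
    ultimately show ?thesis by (simp only: power_mult_distrib)
  qed
  \<comment> \<open>Since \<open>p\<close> is between 1 and 2, \<open>r\<close> is at least half of
    \<open>k + 1\<close>, which even gives 12 in place of 5.\<close>
  have 3: "5 * (real k + 1) \<le> 24 * r"
  proof -
    have "12 * p * (real k + 1) \<le> 24 * (real k + p)"
      using p mult_mono[of p 2 "real k + 1" "real k + p"] by simp
    then have "12 * (real k + 1) \<le> 24 * r"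
      using p by (simp add: r_def field_simps)
    then show ?thesis by simp
  qed
  have sq: "(2 * s * sqrt (6 * \<Omega> * p) / sqrt (real k + p))\<^sup>2 = 24 * \<Omega> * s\<^sup>2 / r"
    using \<Omega> p kp by (simp add: power_divide power_mult_distrib r_def)
  have "5 * \<Omega> * (\<Sum>i\<le>k. (\<alpha> i * s)\<^sup>2) = 5 * \<Omega> * s\<^sup>2 * (\<Sum>i\<le>k. (\<alpha> i)\<^sup>2)"
    by (simp add: power_mult_distrib sum_distrib_left sum_distrib_right mult_ac)
  also have "\<dots> \<le> 5 * \<Omega> * s\<^sup>2 * ((1 / a)\<^sup>2 * (real k + 1) * r powr (2 * p - 2))"
    using 1 \<Omega> by (intro mult_left_mono) auto
  also have "\<dots> = 5 * (real k + 1) * (\<Omega> * s\<^sup>2 * ((1 / a)\<^sup>2 * r powr (2 * p - 2)))"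
    by simp
  also have "\<dots> \<le> 24 * r * (\<Omega> * s\<^sup>2 * ((1 / a)\<^sup>2 * r powr (2 * p - 2)))"
    using 3 \<Omega> by (intro mult_right_mono) auto
  also have "\<dots> = (1 / a)\<^sup>2 * (r powr (2 * p - 2) * r\<^sup>2) * (24 * \<Omega> * s\<^sup>2 / r)"
    using r by (simp add: field_simps power2_eq_square)
  also have "\<dots> \<le> (\<Sum>i\<le>k. \<alpha> i)\<^sup>2 * (24 * \<Omega> * s\<^sup>2 / r)"
    using \<Omega> r by (intro mult_right_mono 2) auto
  finally show ?thesis by (simp only: power_mult_distrib[of "\<Sum>i\<le>k. \<alpha> i"] sq)
qed

end

text \<open>The terms are compared one by one. The constants arise as \<open>4 * sqrt 2\<close> from
  \<open>p powr p \<le> 4\<close> and a power of 2 at most \<open>sqrt 2\<close>,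
  \<open>16 * sqrt 2\<close> from two factors 4 and \<open>sqrt p\<close>, and
  \<open>4 * sqrt 3\<close> from \<open>sqrt (12 * \<Omega>)\<close>. The term with
  \<open>\<delta>\<close> needs only 24.\<close>

lemma explicit_threshold_le:
  fixes p L \<sigma> R \<delta> D \<Omega> \<kappa> :: real
  assumes p: "1 \<le> p" "p \<le> 2" and nn: "0 \<le> L" "0 \<le> \<sigma>" "0 \<le> R" "0 \<le> \<delta>" "0 \<le> D" "0 \<le> \<Omega>"
    and \<kappa>: "1 \<le> \<kappa>"
  shows "L * R\<^sup>2 * p powr p * 2 powr ((2 * p - 3) / 2) / (\<kappa> + p) powr p
        + (1 + \<Omega>) * \<sigma> * R * 2 powr ((3 + 2 * p) / 4) * sqrt p
            * (\<kappa> + p + 2) powr (p - 1 / 2) / (\<kappa> + p) powr p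
        + 2 powr (2 * p - 1) * (((\<kappa> + p) / p) powr (p - 1) + 1) * \<delta>
        + 2 * D * \<sigma> * sqrt (6 * \<Omega> * p) / sqrt (\<kappa> + p)
      \<le> 4 * sqrt 2 * L * R\<^sup>2 / \<kappa> powr p
        + 16 * sqrt 2 * (1 + \<Omega>) * \<sigma> * R / sqrt \<kappa>
        + 48 * \<kappa> powr (p - 1) * \<delta>
        + 4 * sqrt 3 * D * \<sigma> * sqrt \<Omega> / sqrt \<kappa>"
proof (intro add_mono)
  have two: "2 powr e \<le> 2 powr e'" if "e \<le> e'" for e e' :: real
    using that by (intro powr_mono) auto
  have kp: "0 < \<kappa> + p" using p \<kappa> by simp
  have pp: "p powr p \<le> 4"
  proof -
    have "p powr p \<le> 2 powr p" using p by (intro powr_mono2) auto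
    also have "\<dots> \<le> 2 powr 2" using p by (intro two)
    finally show ?thesis by simp
  qed
  have half: "2 powr (1 / 2) = sqrt 2" by (simp add: powr_half_sqrt)
  show "L * R\<^sup>2 * p powr p * 2 powr ((2 * p - 3) / 2) / (\<kappa> + p) powr p
      \<le> 4 * sqrt 2 * L * R\<^sup>2 / \<kappa> powr p"
  proof (rule frac_le)
    have "2 powr ((2 * p - 3) / 2) \<le> sqrt 2"
      unfolding half[symmetric] using p by (intro two) auto
    then have "L * R\<^sup>2 * (p powr p * 2 powr ((2 * p - 3) / 2)) \<le> L * R\<^sup>2 * (4 * sqrt 2)"
      using nn pp by (intro mult_left_mono mult_mono) auto
    then show "L * R\<^sup>2 * p powr p * 2 powr ((2 * p - 3) / 2) \<le> 4 * sqrt 2 * L * R\<^sup>2"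
      by (simp add: mult_ac)
    show "\<kappa> powr p \<le> (\<kappa> + p) powr p" using p \<kappa> by (intro powr_mono2) auto
  qed (use nn \<kappa> in auto)
  show "(1 + \<Omega>) * \<sigma> * R * 2 powr ((3 + 2 * p) / 4) * sqrt p
      * (\<kappa> + p + 2) powr (p - 1 / 2) / (\<kappa> + p) powr p \<le> 16 * sqrt 2 * (1 + \<Omega>) * \<sigma> * R / sqrt \<kappa>"
  proof -
    have c: "2 powr ((3 + 2 * p) / 4) \<le> 4"
      using two[of "(3 + 2 * p) / 4" 2] p by simp
    have "(\<kappa> + p + 2) powr (p - 1 / 2) \<le> (2 * (\<kappa> + p)) powr (p - 1 / 2)"
      using p \<kappa> by (intro powr_mono2) auto
    also have "\<dots> = 2 powr (p - 1 / 2) * (\<kappa> + p) powr (p - 1 / 2)"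
      by (rule powr_mult)
    also have "\<dots> \<le> 4 * (\<kappa> + p) powr (p - 1 / 2)"
      using two[of "p - 1 / 2" 2] p by (intro mult_right_mono) auto
    finally have d: "(\<kappa> + p + 2) powr (p - 1 / 2) \<le> 4 * (\<kappa> + p) powr (p - 1 / 2)" .
    have "2 powr ((3 + 2 * p) / 4) * sqrt p * (\<kappa> + p + 2) powr (p - 1 / 2)
        \<le> 4 * sqrt 2 * (4 * (\<kappa> + p) powr (p - 1 / 2))"
      using p by (intro mult_mono c d) auto
    then have "2 powr ((3 + 2 * p) / 4) * sqrt p * (\<kappa> + p + 2) powr (p - 1 / 2) / (\<kappa> + p) powr p
        \<le> 4 * sqrt 2 * (4 * (\<kappa> + p) powr (p - 1 / 2)) / (\<kappa> + p) powr p"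
      by (intro divide_right_mono) auto
    also have "\<dots> = 16 * sqrt 2 * ((\<kappa> + p) powr (p - 1 / 2) / (\<kappa> + p) powr p)" by simp
    also have "(\<kappa> + p) powr (p - 1 / 2) / (\<kappa> + p) powr p = (\<kappa> + p) powr (- (1 / 2))"
      by (simp flip: powr_diff)
    also have "\<dots> = 1 / sqrt (\<kappa> + p)"
      unfolding powr_minus using kp by (simp add: powr_half_sqrt inverse_eq_divide)
    also have "16 * sqrt 2 * (1 / sqrt (\<kappa> + p)) \<le> 16 * sqrt 2 * (1 / sqrt \<kappa>)"
      using p \<kappa> by (intro mult_left_mono frac_le) auto
    finally have "(1 + \<Omega>) * \<sigma> * R
        * (2 powr ((3 + 2 * p) / 4) * sqrt p * (\<kappa> + p + 2) powr (p - 1 / 2) / (\<kappa> + p) powr p)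
      \<le> (1 + \<Omega>) * \<sigma> * R * (16 * sqrt 2 * (1 / sqrt \<kappa>))"
      using nn by (intro mult_left_mono) auto
    then show ?thesis
      by (simp add: mult_ac del: distrib_left_numeral distrib_right_numeral)
  qed
  show "2 powr (2 * p - 1) * (((\<kappa> + p) / p) powr (p - 1) + 1) * \<delta> \<le> 48 * \<kappa> powr (p - 1) * \<delta>"
  proof (rule mult_right_mono)
    have c: "2 powr (2 * p - 1) \<le> 8"
      using two[of "2 * p - 1" 3] p by simp
    \<comment> \<open>Both \<open>\<kappa>\<close> and \<open>p\<close> are at least 1, so each is
      at most their product and \<open>(\<kappa> + p) / p\<close> is at most
      \<open>2 * \<kappa>\<close>.\<close>
    have "\<kappa> * 1 \<le> \<kappa> * p" "1 * p \<le> \<kappa> * p"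
      using p \<kappa> by (intro mult_left_mono mult_right_mono; simp)+
    then have "\<kappa> + p \<le> 2 * \<kappa> * p" by linarith
    then have "((\<kappa> + p) / p) powr (p - 1) \<le> (2 * \<kappa>) powr (p - 1)"
      using p \<kappa> by (intro powr_mono2) (auto simp: divide_simps)
    also have "\<dots> = 2 powr (p - 1) * \<kappa> powr (p - 1)"
      using \<kappa> by (simp add: powr_mult)
    also have "\<dots> \<le> 2 * \<kappa> powr (p - 1)"
      using two[of "p - 1" 1] p by (intro mult_right_mono) auto
    finally have "((\<kappa> + p) / p) powr (p - 1) + 1 \<le> 3 * \<kappa> powr (p - 1)"
      using ge_one_powr_ge_zero[OF \<kappa>, of "p - 1"] p by linarith
    then have "2 powr (2 * p - 1) * (((\<kappa> + p) / p) powr (p - 1) + 1) \<le> 8 * (3 * \<kappa> powr (p - 1))"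
      using c by (intro mult_mono) auto
    also have "\<dots> \<le> 48 * \<kappa> powr (p - 1)" by simp
    finally show "2 powr (2 * p - 1) * (((\<kappa> + p) / p) powr (p - 1) + 1) \<le> 48 * \<kappa> powr (p - 1)" .
  qed (use nn in auto)
  show "2 * D * \<sigma> * sqrt (6 * \<Omega> * p) / sqrt (\<kappa> + p) \<le> 4 * sqrt 3 * D * \<sigma> * sqrt \<Omega> / sqrt \<kappa>"
  proof (rule frac_le)
    have "sqrt (6 * \<Omega> * p) \<le> sqrt (2\<^sup>2 * 3 * \<Omega>)"
      using p nn mult_left_mono[of p 2 "6 * \<Omega>"] by (intro real_sqrt_le_mono) (auto simp: mult_ac)
    also have "\<dots> = 2 * sqrt 3 * sqrt \<Omega>"
      unfolding real_sqrt_mult real_sqrt_abs by simp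
    finally have "2 * D * \<sigma> * sqrt (6 * \<Omega> * p) \<le> 2 * D * \<sigma> * (2 * sqrt 3 * sqrt \<Omega>)"
      using nn by (intro mult_left_mono) auto
    then show "2 * D * \<sigma> * sqrt (6 * \<Omega> * p) \<le> 4 * sqrt 3 * D * \<sigma> * sqrt \<Omega>" by simp
  qed (use nn p \<kappa> in auto)
qed

section \<open>The high-probability bound\<close>

locale sigm = iid_noise M \<xi> P + sigm_parameters p a b L \<sigma> R \<alpha> \<beta> B
  for M :: "'o measure" and \<xi> :: "nat \<Rightarrow> 'o \<Rightarrow> 'w" and P :: "'w measure"
    and p a b L \<sigma> R :: real and \<alpha> \<beta> B :: "nat \<Rightarrow> real" +
  fixes E Q :: "'e::real_normed_vector set" and f h d fo :: "'e \<Rightarrow> real"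
    and go :: "'e \<Rightarrow> 'e \<Rightarrow>\<^sub>L real" and F :: "'e \<Rightarrow> 'w \<Rightarrow> real" and G :: "'e \<Rightarrow> 'w \<Rightarrow> 'e \<Rightarrow>\<^sub>L real"
    and \<delta> D :: real and x0 xs :: 'e and x y z xh w :: "nat \<Rightarrow> 'o \<Rightarrow> 'e"
  assumes E: "finite E" "span E = UNIV"
    and f: "convex_on Q f" "f \<in> borel_measurable (restrict_space borel Q)"
    and h: "convex_on Q h" "h \<in> borel_measurable (restrict_space borel Q)"
    and xs: "xs \<in> Q" "2 * d xs \<le> R\<^sup>2"
    and \<delta>: "0 \<le> \<delta>" and D: "0 < D" "\<And>u v. u \<in> Q \<Longrightarrow> v \<in> Q \<Longrightarrow> norm (u - v) \<le> D"
    and inexact: "inexact_oracle Q f L \<delta> fo go"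
    and prox: "prox_function Q d x0"
    and approx: "stochastic_approximation Q P \<sigma> fo go F G"
    and light: "light_tail Q P \<sigma> go G"
    and run: "\<And>\<omega>. \<omega> \<in> space M \<Longrightarrow> sigm_run Q d h \<alpha> \<beta> B G (\<lambda>i. \<xi> i \<omega>)
        (\<lambda>i. x i \<omega>) (\<lambda>i. y i \<omega>) (\<lambda>i. z i \<omega>) (\<lambda>i. xh i \<omega>) (\<lambda>i. w i \<omega>)"
begin

text \<open>Known before \<open>\<xi> i\<close> is drawn, which is what gives \<open>drift i\<close>
  zero conditional mean.\<close>

definition anchor :: "nat \<Rightarrow> 'o \<Rightarrow> 'e" where
  "anchor i \<omega> = (case i of 0 \<Rightarrow> x 0 \<omega> | Suc j \<Rightarrow> z j \<omega>)"

text \<open>The fresh sample is a separate argument, so that it can be integrated under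
  \<open>P\<close> with the past frozen; on the actual path it is
  \<open>\<xi> i \<omega>\<close>.\<close>

definition noise :: "nat \<Rightarrow> 'o \<times> 'w \<Rightarrow> 'e \<Rightarrow>\<^sub>L real" where
  "noise i = (\<lambda>(\<omega>, s). G (x i \<omega>) s - go (x i \<omega>))"

lemma convex_Q: "convex Q"
  using prox by (simp add: prox_function_def strongly_convex_on_def)

lemma beta_pos: "0 < \<beta> i"
  using L L_le_beta[of i] by linarith

lemmas feasible = sigm_run_feasible[OF convex_Q run alpha_pos alpha_le_B B_le_sum_alpha]

lemma adapted:
  "x n \<in> measurable (past n) (restrict_space borel Q)"
  "y n \<in> measurable (past (Suc n)) (restrict_space borel Q)"
  "z n \<in> measurable (past (Suc n)) (restrict_space borel Q)"
  using sigm_run_adapted[OF E h(1) prox _ alpha_pos alpha_le_B B_le_sum_alpha beta_pos run] approx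
  by (auto simp: stochastic_approximation_def)

lemma anchor_adapted: "anchor n \<in> measurable (past n) (restrict_space borel Q)"
  using adapted(1)[of 0] adapted(3)[of "n - 1"]
  by (cases n) (simp_all add: anchor_def[abs_def])

lemma anchor_in_Q: "\<omega> \<in> space M \<Longrightarrow> anchor n \<omega> \<in> Q"
  using feasible(1)[of \<omega> 0] feasible(3)[of \<omega> "n - 1"] by (cases n) (simp_all add: anchor_def)

lemma noise_adapted: "noise n \<in> borel_measurable (past n \<Otimes>\<^sub>M P)"
proof -
  have "(\<lambda>p. (x n (fst p), snd p)) \<in> measurable (past n \<Otimes>\<^sub>M P) (restrict_space borel Q \<Otimes>\<^sub>M P)"
    by (intro measurable_Pair measurable_compose[OF measurable_fst adapted(1)] measurable_snd)
  from measurable_compose[OF this borel_measurable_oracle_noise[OF E prob_space_noise approx]]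
  show ?thesis by (simp add: noise_def split_beta)
qed

lemma norm_noise_adapted: "(\<lambda>p. norm (noise n p)) \<in> borel_measurable (past n \<Otimes>\<^sub>M P)"
  by (rule measurable_compose[OF noise_adapted borel_measurable_continuous_onI])
    (intro continuous_intros)

lemma norm_noise_measurable: "(\<lambda>\<omega>. norm (noise n (\<omega>, \<xi> n \<omega>))) \<in> borel_measurable M"
  by (rule measurable_past_imp[OF borel_measurable_past_noise[OF norm_noise_adapted lessI]])

lemma noise_light_tail:
  assumes "\<omega> \<in> space M"
  shows "(\<integral>\<^sup>+s. ennreal (exp ((norm (noise n (\<omega>, s)) / \<sigma>)\<^sup>2)) \<partial>P) \<le> ennreal (exp 1)"
  using light feasible(1)[OF assms, of n] by (simp add: light_tail_def noise_def power_divide)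

lemma noise_light_tail_marginal:
  "(\<integral>\<^sup>+\<omega>. ennreal (exp ((norm (noise n (\<omega>, \<xi> n \<omega>)) / \<sigma>)\<^sup>2)) \<partial>M) \<le> ennreal (exp 1)"
proof -
  have "(\<lambda>p. ennreal (exp ((norm (noise n p) / \<sigma>)\<^sup>2))) \<in> borel_measurable (past n \<Otimes>\<^sub>M P)"
    using norm_noise_adapted[of n] by measurable
  then have "(\<integral>\<^sup>+\<omega>. ennreal (exp ((norm (noise n (\<omega>, \<xi> n \<omega>)) / \<sigma>)\<^sup>2)) \<partial>M)
      = (\<integral>\<^sup>+\<omega>. \<integral>\<^sup>+s. ennreal (exp ((norm (noise n (\<omega>, s)) / \<sigma>)\<^sup>2)) \<partial>P \<partial>M)"
    by (rule nn_integral_past_noise)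
  also have "\<dots> \<le> (\<integral>\<^sup>+\<omega>. ennreal (exp 1) \<partial>M)"
    by (intro nn_integral_mono noise_light_tail)
  finally show ?thesis by (simp add: emeasure_space_1)
qed

text \<open>For every frozen past the second moment of the noise is at most
  \<open>\<sigma>\<^sup>2 = 0\<close>. Integrating over the past gives one null set per step, and
  there are countably many steps.\<close>

lemma AE_noise_eq_0:
  assumes "\<sigma> = 0"
  shows "AE \<omega> in M. \<forall>n. noise n (\<omega>, \<xi> n \<omega>) = 0"
  unfolding AE_all_countable
proof
  fix n
  have "(\<lambda>p. ennreal ((norm (noise n p))\<^sup>2)) \<in> borel_measurable (past n \<Otimes>\<^sub>M P)"
    using norm_noise_adapted[of n] by measurable
  then have "(\<integral>\<^sup>+\<omega>. ennreal ((norm (noise n (\<omega>, \<xi> n \<omega>)))\<^sup>2) \<partial>M)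
      = (\<integral>\<^sup>+\<omega>. \<integral>\<^sup>+s. ennreal ((norm (noise n (\<omega>, s)))\<^sup>2) \<partial>P \<partial>M)"
    by (rule nn_integral_past_noise)
  also have "\<dots> \<le> (\<integral>\<^sup>+\<omega>. 0 \<partial>M)"
  proof (intro nn_integral_mono)
    fix \<omega> assume "\<omega> \<in> space M"
    then show "(\<integral>\<^sup>+s. ennreal ((norm (noise n (\<omega>, s)))\<^sup>2) \<partial>P) \<le> 0"
      using approx feasible(1)[of \<omega> n] assms by (simp add: stochastic_approximation_def noise_def)
  qed
  finally have "(\<integral>\<^sup>+\<omega>. ennreal ((norm (noise n (\<omega>, \<xi> n \<omega>)))\<^sup>2) \<partial>M) = 0" by simp
  then have "AE \<omega> in M. ennreal ((norm (noise n (\<omega>, \<xi> n \<omega>)))\<^sup>2) = 0"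
    using nn_integral_0_iff_AE[OF measurable_compose[OF
          borel_measurable_power[OF norm_noise_measurable] measurable_ennreal], of n 2]
    by simp
  then show "AE \<omega> in M. noise n (\<omega>, \<xi> n \<omega>) = 0"
    by eventually_elim (simp add: ennreal_eq_0_iff)
qed

definition drift :: "nat \<Rightarrow> 'o \<times> 'w \<Rightarrow> real" where
  "drift i = (\<lambda>(\<omega>, s). \<alpha> i * noise i (\<omega>, s) (xs - anchor i \<omega>))"

lemma drift_adapted: "drift i \<in> borel_measurable (past i \<Otimes>\<^sub>M P)"
proof -
  have "anchor i \<in> borel_measurable (past i)"
    using anchor_adapted[of i] by (simp add: measurable_restrict_space2_iff)
  then have "(\<lambda>\<omega>. 1 *\<^sub>R xs + (- 1) *\<^sub>R anchor i \<omega>) \<in> borel_measurable (past i)"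
    by (rule borel_measurable_add_scaleR_finite_dim[OF E borel_measurable_const])
  then have "(\<lambda>\<omega>. xs - anchor i \<omega>) \<in> borel_measurable (past i)"
    by simp
  then have "(\<lambda>p. xs - anchor i (fst p)) \<in> borel_measurable (past i \<Otimes>\<^sub>M P)"
    by (rule measurable_compose[OF measurable_fst])
  then have "(\<lambda>p. noise i p (xs - anchor i (fst p))) \<in> borel_measurable (past i \<Otimes>\<^sub>M P)"
    by (rule borel_measurable_blinfun_apply_finite_dim[OF E
          borel_measurable_blinfun_eval[OF noise_adapted]])
  then have "(\<lambda>p. \<alpha> i * noise i p (xs - anchor i (fst p))) \<in> borel_measurable (past i \<Otimes>\<^sub>M P)"
    by (rule borel_measurable_times[OF borel_measurable_const])
  then show ?thesis unfolding drift_def split_def by simp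
qed

lemma run_estimate:
  assumes \<omega>: "\<omega> \<in> space M"
    and e: "\<And>i r. 0 \<le> r \<Longrightarrow>
      norm (noise i (\<omega>, \<xi> i \<omega>)) * r \<le> (a * \<beta> (i - 1) - L) / 2 * r\<^sup>2 + e i"
  shows "(\<Sum>i\<le>k. \<alpha> i) * (f (y k \<omega>) + h (y k \<omega>) - (f xs + h xs))
    \<le> \<beta> k * R\<^sup>2 / 2 + \<delta> * (\<Sum>i\<le>k. B i) + (\<Sum>i\<le>k. B i * e i)
      + (\<Sum>i\<le>k. drift i (\<omega>, \<xi> i \<omega>))"
proof -
  have "(\<Sum>i\<le>k. \<alpha> i) * (f (y k \<omega>) + h (y k \<omega>) - (f xs + h xs))
    \<le> \<beta> k * d xs + (\<Sum>i\<le>k. B i * (\<delta> + e i)) + (\<Sum>i\<le>k. \<alpha> i * (G (x i \<omega>) (\<xi> i \<omega>) - go (x i \<omega>))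
        (xs - (case i of 0 \<Rightarrow> x 0 \<omega> | Suc j \<Rightarrow> z j \<omega>)))"
    by (rule sigm_estimate[OF f(1) h(1) prox inexact run[OF \<omega>] xs(1) alpha_pos _ B alpha_le_B
          B_le_sum_alpha B_0 _ beta_mono])
      (use a_ge_1 beta_pos e in \<open>auto simp: noise_def intro: less_imp_le\<close>)
  moreover have "\<beta> k * d xs \<le> \<beta> k * (R\<^sup>2 / 2)"
    using beta_pos[of k] xs by (intro mult_left_mono) auto
  ultimately show ?thesis
    by (simp add: drift_def noise_def anchor_def distrib_left sum.distrib sum_distrib_left mult.commute)
qed

lemma step_gap_pos:
  assumes "0 < \<sigma>"
  shows "0 < a * \<beta> (i - 1) - L"
proof -
  have "0 < a * (b * \<sigma> / R) * (real i + p) powr (p - 1 / 2)"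
    using a_ge_1 b_pos assms R p by simp
  then show ?thesis using step_gap[of i] by linarith
qed

section \<open>Probabilities of the two exceptional events\<close>

lemma prob_noise_square:
  assumes \<sigma>0: "0 < \<sigma>"
  shows "\<P>(\<omega> in M. (1 + \<Omega>) * (\<sigma>\<^sup>2 * (\<Sum>i\<le>k. B i / (2 * (a * \<beta> (i - 1) - L))))
    \<le> (\<Sum>i\<le>k. B i / (2 * (a * \<beta> (i - 1) - L)) * (norm (noise i (\<omega>, \<xi> i \<omega>)))\<^sup>2)) \<le> exp (- \<Omega>)"
proof -
  \<comment> \<open>The factor \<open>\<sigma>\<^sup>2\<close> is moved into the weights so that the
    variables become \<open>(norm noise / \<sigma>)\<^sup>2\<close>, whose exponential moments are
    at most \<open>exp 1\<close>.\<close>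
  define c where "c i = \<sigma>\<^sup>2 * (B i / (2 * (a * \<beta> (i - 1) - L)))" for i
  have c: "0 < c i" for i
    unfolding c_def using \<sigma>0 step_gap_pos[OF \<sigma>0, of i] alpha_pos[of i] alpha_le_B[of i]
    by (intro mult_pos_pos divide_pos_pos) auto
  have "\<P>(\<omega> in M. (1 + \<Omega>) * (\<Sum>i<Suc k. c i)
      \<le> (\<Sum>i<Suc k. c i * (norm (noise i (\<omega>, \<xi> i \<omega>)) / \<sigma>)\<^sup>2)) \<le> exp (- \<Omega>)"
  proof (rule prob_weighted_sum_light_tail)
    show "(\<lambda>\<omega>. (norm (noise i (\<omega>, \<xi> i \<omega>)) / \<sigma>)\<^sup>2) \<in> borel_measurable M" for i
      using norm_noise_measurable[of i] by measurable
    show "0 < (\<Sum>i<Suc k. c i)" by (intro sum_pos c) auto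
  qed (use noise_light_tail_marginal c in \<open>auto intro: less_imp_le\<close>)
  moreover have "c i * (norm (noise i (\<omega>, \<xi> i \<omega>)) / \<sigma>)\<^sup>2
      = B i / (2 * (a * \<beta> (i - 1) - L)) * (norm (noise i (\<omega>, \<xi> i \<omega>)))\<^sup>2" for i \<omega>
    unfolding c_def using \<sigma>0 by (simp add: power_divide)
  ultimately show ?thesis
    by (simp only: lessThan_Suc_atMost c_def sum_distrib_left[symmetric])
qed

text \<open>Boundedness of \<open>Q\<close> enters here: \<open>xs - anchor i \<omega>\<close> has
  norm at most \<open>D\<close>, so \<open>drift i\<close> inherits the light tail of the noise with
  scale \<open>\<alpha> i * (D * \<sigma>)\<close>.\<close>

lemma prob_drift:
  assumes \<sigma>0: "0 < \<sigma>" and t: "0 \<le> t" "5 * \<Omega> * (\<Sum>i\<le>k. (\<alpha> i * (D * \<sigma>))\<^sup>2) \<le> t\<^sup>2"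
  shows "\<P>(\<omega> in M. t \<le> (\<Sum>i\<le>k. drift i (\<omega>, \<xi> i \<omega>))) \<le> exp (- \<Omega>)"
proof -
  have "\<P>(\<omega> in M. t \<le> (\<Sum>i<Suc k. drift i (\<omega>, \<xi> i \<omega>))) \<le> exp (- \<Omega>)"
  proof (rule prob_martingale_sum_subgaussian[where s = "\<lambda>i. \<alpha> i * (D * \<sigma>)"])
    show "drift i \<in> borel_measurable (past i \<Otimes>\<^sub>M P)" for i by (rule drift_adapted)
    show "0 < \<alpha> i * (D * \<sigma>)" for i using alpha_pos[of i] D \<sigma>0 by simp
    show "5 * \<Omega> * (\<Sum>i<Suc k. (\<alpha> i * (D * \<sigma>))\<^sup>2) \<le> t\<^sup>2"
      using t by (simp only: lessThan_Suc_atMost)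
    fix i \<omega> assume \<omega>: "\<omega> \<in> space M"
    interpret P: prob_space P by (rule prob_space_noise)
    have xQ: "x i \<omega> \<in> Q" by (rule feasible(1)[OF \<omega>])
    show "has_bochner_integral P (\<lambda>s. drift i (\<omega>, s)) 0"
    proof -
      define u where "u = xs - anchor i \<omega>"
      have "has_bochner_integral P (\<lambda>s. G (x i \<omega>) s u) (go (x i \<omega>) u)"
        using approx xQ by (simp add: stochastic_approximation_def)
      moreover have "has_bochner_integral P (\<lambda>s. go (x i \<omega>) u) (go (x i \<omega>) u)"
        by (simp add: has_bochner_integral_iff P.prob_space)
      ultimately have "has_bochner_integral P (\<lambda>s. \<alpha> i * (G (x i \<omega>) s u - go (x i \<omega>) u))
          (\<alpha> i * (go (x i \<omega>) u - go (x i \<omega>) u))"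
        by (intro has_bochner_integral_mult_right has_bochner_integral_diff)
      then show ?thesis by (simp add: drift_def noise_def u_def blinfun.diff_left)
    qed
    show "(\<integral>\<^sup>+s. ennreal (exp ((drift i (\<omega>, s) / (\<alpha> i * (D * \<sigma>)))\<^sup>2)) \<partial>P) \<le> ennreal (exp 1)"
    proof (rule order_trans[OF nn_integral_mono noise_light_tail[OF \<omega>, of i]])
      fix s
      have "\<bar>drift i (\<omega>, s)\<bar> \<le> \<alpha> i * (norm (noise i (\<omega>, s)) * D)"
      proof -
        have "\<bar>noise i (\<omega>, s) (xs - anchor i \<omega>)\<bar> \<le> norm (noise i (\<omega>, s)) * norm (xs - anchor i \<omega>)"
          using norm_blinfun[of "noise i (\<omega>, s)"] by simp
        also have "\<dots> \<le> norm (noise i (\<omega>, s)) * D"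
          by (intro mult_left_mono D xs anchor_in_Q \<omega>) simp
        finally show ?thesis
          using alpha_pos[of i] by (simp add: drift_def abs_mult)
      qed
      then have "\<bar>drift i (\<omega>, s)\<bar> / (\<alpha> i * (D * \<sigma>)) \<le> \<alpha> i * (norm (noise i (\<omega>, s)) * D) / (\<alpha> i * (D * \<sigma>))"
        using alpha_pos[of i] D \<sigma>0 by (intro divide_right_mono) auto
      also have "\<dots> = norm (noise i (\<omega>, s)) / \<sigma>"
        using alpha_pos[of i] D by simp
      finally have "\<bar>drift i (\<omega>, s) / (\<alpha> i * (D * \<sigma>))\<bar> \<le> norm (noise i (\<omega>, s)) / \<sigma>"
        using alpha_pos[of i] D \<sigma>0 by (simp add: abs_divide abs_mult)
      then have "(drift i (\<omega>, s) / (\<alpha> i * (D * \<sigma>)))\<^sup>2 \<le> (norm (noise i (\<omega>, s)) / \<sigma>)\<^sup>2"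
        by (rule abs_le_square_iff[THEN iffD1, OF order_trans[OF _ abs_ge_self]])
      then show "ennreal (exp ((drift i (\<omega>, s) / (\<alpha> i * (D * \<sigma>)))\<^sup>2))
          \<le> ennreal (exp ((norm (noise i (\<omega>, s)) / \<sigma>)\<^sup>2))"
        by (intro ennreal_leI) simp
    qed
  qed (use t in auto)
  then show ?thesis by (simp only: lessThan_Suc_atMost)
qed

text \<open>A convex function can take non-measurable values on the boundary of \<open>Q\<close>,
  hence the separate measurability assumptions on \<open>f\<close> and \<open>h\<close>.\<close>

lemma gap_measurable: "(\<lambda>\<omega>. f (y k \<omega>) + h (y k \<omega>) - (f xs + h xs)) \<in> borel_measurable M"
proof -
  have "y k \<in> measurable M (restrict_space borel Q)"
    by (rule measurable_past_imp[OF adapted(2)])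
  then show ?thesis
    using measurable_compose[OF _ f(2)] measurable_compose[OF _ h(2)]
    by (intro borel_measurable_diff borel_measurable_add) auto
qed

text \<open>Budget of the estimate: the growing part of \<open>\<beta> k\<close> and the variance
  sum \<open>V\<close> each take at most \<open>N / 2\<close>, and
  \<open>N / 2 + (1 + \<Omega>) * (N / 2) \<le> (1 + \<Omega>) * N\<close>. The remaining terms
  match those of \<open>T\<close> one by one.\<close>

lemma threshold_sufficient:
  fixes k :: nat
  assumes \<Omega>: "0 \<le> \<Omega>"
  defines "T \<equiv> L * R\<^sup>2 * p powr p * 2 powr ((2 * p - 3) / 2) / (real k + p) powr p
        + (1 + \<Omega>) * \<sigma> * R * 2 powr ((3 + 2 * p) / 4) * sqrt p
            * (real k + p + 2) powr (p - 1 / 2) / (real k + p) powr p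
        + 2 powr (2 * p - 1) * (((real k + p) / p) powr (p - 1) + 1) * \<delta>
        + 2 * D * \<sigma> * sqrt (6 * \<Omega> * p) / sqrt (real k + p)"
    and "V \<equiv> \<sigma>\<^sup>2 * (\<Sum>i\<le>k. B i / (2 * (a * \<beta> (i - 1) - L)))"
    and "t \<equiv> (\<Sum>i\<le>k. \<alpha> i) * (2 * (D * \<sigma>) * sqrt (6 * \<Omega> * p) / sqrt (real k + p))"
  shows "\<beta> k * R\<^sup>2 / 2 + \<delta> * (\<Sum>i\<le>k. B i) + (1 + \<Omega>) * V + t \<le> (\<Sum>i\<le>k. \<alpha> i) * T"
proof -
  define A where "A = (\<Sum>i\<le>k. \<alpha> i)"
  define r where "r = ((real k + p) / p) powr (p - 1)"
  define S where "S = \<sigma> * R * 2 powr ((3 + 2 * p) / 4) * sqrt p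
      * (real k + p + 2) powr (p - 1 / 2) / (real k + p) powr p"
  define N where "N = b * \<sigma> * R * (real k + p + 2) powr (p - 1 / 2)"
  have A: "0 < A" unfolding A_def by (rule sum_alpha_pos)
  have N: "0 \<le> N" unfolding N_def using b_pos \<sigma> R by simp
  have NS: "N \<le> A * S"
    unfolding N_def A_def S_def by (rule stochastic_term)
  have "\<beta> k * R\<^sup>2 / 2 = L * R\<^sup>2 / 2 + b * \<sigma> * R * (real k + p + 1) powr (p - 1 / 2) / 2"
    using R by (simp add: \<beta> distrib_left distrib_right power2_eq_square diff_divide_distrib add_divide_distrib)
  moreover have "b * \<sigma> * R * (real k + p + 1) powr (p - 1 / 2) \<le> N"
    unfolding N_def using b_pos \<sigma> R p by (intro mult_left_mono powr_mono2) auto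
  ultimately have 1: "\<beta> k * R\<^sup>2 / 2 \<le> L * R\<^sup>2 / 2 + N / 2" by linarith
  have V: "V \<le> N / 2"
    unfolding V_def N_def using variance_term[of k] \<sigma> by (cases "\<sigma> = 0") auto
  have "(1 + \<Omega>) * V \<le> (1 + \<Omega>) * (N / 2)"
    using \<Omega> V by (intro mult_left_mono) auto
  moreover have "0 \<le> \<Omega> * N" using \<Omega> N by simp
  ultimately have "N / 2 + (1 + \<Omega>) * V \<le> (1 + \<Omega>) * N"
    by (simp add: algebra_simps)
  also have "\<dots> \<le> (1 + \<Omega>) * (A * S)"
    using \<Omega> NS by (intro mult_left_mono) auto
  finally have 2: "N / 2 + (1 + \<Omega>) * V \<le> A * ((1 + \<Omega>) * S)"
    by (simp add: mult_ac)
  have "1 \<le> 2 powr (2 * p - 1)" using p by (intro ge_one_powr_ge_zero) auto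
  moreover have "0 \<le> r" by (simp add: r_def)
  ultimately have "1 * (r + 0) \<le> 2 powr (2 * p - 1) * (r + 1)" by (intro mult_mono) auto
  then have "A * r \<le> A * (2 powr (2 * p - 1) * (r + 1))" using A by simp
  then have "(\<Sum>i\<le>k. B i) \<le> A * (2 powr (2 * p - 1) * (r + 1))"
    using sum_B_le[of k] by (simp add: A_def r_def)
  then have "\<delta> * (\<Sum>i\<le>k. B i) \<le> \<delta> * (A * (2 powr (2 * p - 1) * (r + 1)))"
    using \<delta> by (rule mult_left_mono)
  then have 3: "\<delta> * (\<Sum>i\<le>k. B i) \<le> A * (2 powr (2 * p - 1) * (r + 1) * \<delta>)"
    by (simp only: mult_ac)
  have "A * T = A * (L * R\<^sup>2 * p powr p * 2 powr ((2 * p - 3) / 2) / (real k + p) powr p)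
      + A * ((1 + \<Omega>) * S) + A * (2 powr (2 * p - 1) * (r + 1) * \<delta>) + t"
    unfolding T_def t_def A_def[symmetric] r_def[symmetric] S_def
    by (simp only: distrib_left mult.assoc times_divide_eq_right)
  then show ?thesis
    using 1 2 3 deterministic_term[of k] unfolding A_def[symmetric] by linarith
qed

text \<open>Outside the events \<open>E1\<close> and \<open>E2\<close> the path estimate stays
  within the threshold. Each has probability at most \<open>exp (- \<Omega>)\<close>, so the union
  bound gives 2, within the claimed 3.\<close>

lemma prob_gap_le:
  assumes \<Omega>: "0 \<le> \<Omega>"
  shows "\<P>(\<omega> in M. f (y k \<omega>) + h (y k \<omega>) - (f xs + h xs) >
        L * R\<^sup>2 * p powr p * 2 powr ((2 * p - 3) / 2) / (real k + p) powr p
        + (1 + \<Omega>) * \<sigma> * R * 2 powr ((3 + 2 * p) / 4) * sqrt p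
            * (real k + p + 2) powr (p - 1 / 2) / (real k + p) powr p
        + 2 powr (2 * p - 1) * (((real k + p) / p) powr (p - 1) + 1) * \<delta>
        + 2 * D * \<sigma> * sqrt (6 * \<Omega> * p) / sqrt (real k + p)) \<le> 3 * exp (- \<Omega>)"
    (is "\<P>(\<omega> in M. ?gap \<omega> > ?T) \<le> _")
proof -
  define A where "A = (\<Sum>i\<le>k. \<alpha> i)"
  define V where "V = \<sigma>\<^sup>2 * (\<Sum>i\<le>k. B i / (2 * (a * \<beta> (i - 1) - L)))"
  define t where "t = A * (2 * (D * \<sigma>) * sqrt (6 * \<Omega> * p) / sqrt (real k + p))"
  have A: "0 < A" unfolding A_def by (rule sum_alpha_pos)
  have t: "0 \<le> t" unfolding t_def using A D \<sigma> \<Omega> p by simp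
  have T: "\<beta> k * R\<^sup>2 / 2 + \<delta> * (\<Sum>i\<le>k. B i) + (1 + \<Omega>) * V + t \<le> A * ?T"
    unfolding V_def t_def A_def by (rule threshold_sufficient[OF \<Omega>])
  have scale: "A * ?T < A * ?gap \<omega>" if "?T < ?gap \<omega>" for \<omega>
    using that A by (rule mult_strict_left_mono)
  show ?thesis
  proof (cases "\<sigma> = 0")
    case True
    have "AE \<omega> in M. \<not> ?gap \<omega> > ?T"
      using AE_noise_eq_0[OF True] AE_space
    proof eventually_elim
      case (elim \<omega>)
      have "A * ?gap \<omega> \<le> \<beta> k * R\<^sup>2 / 2 + \<delta> * (\<Sum>i\<le>k. B i) + (\<Sum>i\<le>k. B i * 0)
          + (\<Sum>i\<le>k. drift i (\<omega>, \<xi> i \<omega>))"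
        unfolding A_def
      proof (rule run_estimate)
        fix i and r :: real
        have "0 \<le> a * \<beta> (i - 1) - L"
          using step_gap[of i] True by simp
        then show "norm (noise i (\<omega>, \<xi> i \<omega>)) * r \<le> (a * \<beta> (i - 1) - L) / 2 * r\<^sup>2 + 0"
          using elim by simp
      qed (use elim in simp)
      moreover have "(\<Sum>i\<le>k. drift i (\<omega>, \<xi> i \<omega>)) = 0"
        using elim by (simp add: drift_def)
      ultimately have "A * ?gap \<omega> \<le> A * ?T"
        using T t True by (simp add: V_def)
      then show ?case using scale[of \<omega>] by linarith
    qed
    then have "\<P>(\<omega> in M. ?gap \<omega> > ?T) = 0"
      by (subst prob_eq_0_AE) auto
    then show ?thesis by simp
  next
    case False
    then have \<sigma>0: "0 < \<sigma>" using \<sigma> by simp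
    define c where "c i = B i / (2 * (a * \<beta> (i - 1) - L))" for i
    define E1 where "E1 = {\<omega>\<in>space M. (1 + \<Omega>) * V \<le> (\<Sum>i\<le>k. c i * (norm (noise i (\<omega>, \<xi> i \<omega>)))\<^sup>2)}"
    define E2 where "E2 = {\<omega>\<in>space M. t \<le> (\<Sum>i\<le>k. drift i (\<omega>, \<xi> i \<omega>))}"
    have "E1 \<in> events"
      unfolding E1_def using norm_noise_measurable by measurable
    moreover have "E2 \<in> events"
    proof -
      have "(\<lambda>\<omega>. drift i (\<omega>, \<xi> i \<omega>)) \<in> borel_measurable M" for i
        by (rule measurable_past_imp[OF borel_measurable_past_noise[OF drift_adapted lessI]])
      then show ?thesis unfolding E2_def by measurable
    qed
    moreover have "{\<omega>\<in>space M. ?gap \<omega> > ?T} \<subseteq> E1 \<union> E2"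
    proof (rule subsetI, rule ccontr)
      fix \<omega> assume "\<omega> \<in> {\<omega>\<in>space M. ?gap \<omega> > ?T}" and n: "\<omega> \<notin> E1 \<union> E2"
      then have \<omega>: "\<omega> \<in> space M" and gap: "?gap \<omega> > ?T" by auto
      have "A * ?gap \<omega> \<le> \<beta> k * R\<^sup>2 / 2 + \<delta> * (\<Sum>i\<le>k. B i)
          + (\<Sum>i\<le>k. B i * ((norm (noise i (\<omega>, \<xi> i \<omega>)))\<^sup>2 / (2 * (a * \<beta> (i - 1) - L))))
          + (\<Sum>i\<le>k. drift i (\<omega>, \<xi> i \<omega>))"
        unfolding A_def
      proof (rule run_estimate[OF \<omega>])
        fix i and r :: real
        define m n where "m = a * \<beta> (i - 1) - L" and "n = norm (noise i (\<omega>, \<xi> i \<omega>))"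
        have m: "0 < m" unfolding m_def by (rule step_gap_pos[OF \<sigma>0])
        \<comment> \<open>Young's inequality by completing the square, with the whole gap
          \<open>m\<close> as curvature; this determines the denominators
          \<open>2 * (a * \<beta> (i - 1) - L)\<close>.\<close>
        have "0 \<le> (m * r - n)\<^sup>2 / (2 * m)" using m by simp
        also have "\<dots> = m / 2 * r\<^sup>2 + n\<^sup>2 / (2 * m) - n * r"
          using m by (simp add: power2_eq_square field_simps)
        finally show "n * r \<le> m / 2 * r\<^sup>2 + n\<^sup>2 / (2 * m)" by simp
      qed
      also have "(\<Sum>i\<le>k. B i * ((norm (noise i (\<omega>, \<xi> i \<omega>)))\<^sup>2 / (2 * (a * \<beta> (i - 1) - L))))
          = (\<Sum>i\<le>k. c i * (norm (noise i (\<omega>, \<xi> i \<omega>)))\<^sup>2)"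
        by (simp add: c_def)
      finally have "A * ?gap \<omega> \<le> A * ?T"
        using n \<omega> T unfolding E1_def E2_def by simp
      then show False using scale[OF gap] by linarith
    qed
    ultimately have "\<P>(\<omega> in M. ?gap \<omega> > ?T) \<le> prob E1 + prob E2"
      by (meson finite_measure_mono measure_Un_le order_trans sets.Un)
    also have "prob E1 \<le> exp (- \<Omega>)"
      unfolding E1_def V_def c_def by (rule prob_noise_square[OF \<sigma>0])
    also have "prob E2 \<le> exp (- \<Omega>)"
      unfolding E2_def
    proof (rule prob_drift[OF \<sigma>0 t])
      show "5 * \<Omega> * (\<Sum>i\<le>k. (\<alpha> i * (D * \<sigma>))\<^sup>2) \<le> t\<^sup>2"
        unfolding t_def A_def by (rule deviation_term[OF \<Omega>])
    qed
    finally show ?thesis using exp_gt_zero[of "- \<Omega>"] by linarith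
  qed
qed

end

theorem theorem2p2:
  fixes Q :: "'e::real_normed_vector set"
    and f h \<phi> d fo :: "'e \<Rightarrow> real"
    and go :: "'e \<Rightarrow> 'e \<Rightarrow>\<^sub>L real"
    and P :: "'w measure"
    and F :: "'e \<Rightarrow> 'w \<Rightarrow> real"
    and G :: "'e \<Rightarrow> 'w \<Rightarrow> 'e \<Rightarrow>\<^sub>L real"
    and M :: "'o measure"
    and \<xi> :: "nat \<Rightarrow> 'o \<Rightarrow> 'w"
    and L \<delta> \<sigma> D R p a b \<Omega> :: real
    and \<alpha> \<beta> B :: "nat \<Rightarrow> real"
    and x0 xstar :: 'e
    and x y z xh w :: "nat \<Rightarrow> 'o \<Rightarrow> 'e"
    and k :: nat
  assumes \<phi>: "\<phi> = (\<lambda>u. f u + h u)"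
    and finite_dim: "\<exists>E::'e set. finite E \<and> span E = UNIV"
    and Q: "closed Q" "convex Q"
    and f: "convex_on Q f" "f \<in> borel_measurable (restrict_space borel Q)"
    and h: "convex_on Q h" "h \<in> borel_measurable (restrict_space borel Q)"
    and xstar: "is_arg_min \<phi> (\<lambda>u. u \<in> Q) xstar"
    and params: "L > 0" "\<delta> \<ge> 0" "\<sigma> \<ge> 0"
    and oracle_inexact: "inexact_oracle Q f L \<delta> fo go"
    and prox: "prox_function Q d x0"
    and M: "prob_space M"
    and noise_iid: "prob_space.indep_vars M (\<lambda>_. P) \<xi> UNIV" "\<And>i. distr M P (\<xi> i) = P"
    and oracle_stochastic: "stochastic_approximation Q P \<sigma> fo go F G"
    and light: "light_tail Q P \<sigma> go G"
    and D: "bounded Q" "D > 0" "\<And>u v. u \<in> Q \<Longrightarrow> v \<in> Q \<Longrightarrow> norm (u - v) \<le> D"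
    and p: "1 \<le> p" "p \<le> 2"
    and a: "a = 2 powr ((2 * p - 1) / 2)"
    and b: "b = 2 powr ((5 - 2 * p) / 4) * p powr ((1 - 2 * p) / 2)"
    and R: "R > 0" "sqrt (2 * d xstar) \<le> R"
    and \<alpha>: "\<And>i. \<alpha> i = 1 / a * ((real i + p) / p) powr (p - 1)"
    and \<beta>: "\<And>i. \<beta> i = L + b * \<sigma> / R * (real i + p + 1) powr ((2 * p - 1) / 2)"
    and B: "\<And>i. B i = a * (\<alpha> i)\<^sup>2"
    and run: "\<And>\<omega>. \<omega> \<in> space M \<Longrightarrow>
      sigm_run Q d h \<alpha> \<beta> B G (\<lambda>i. \<xi> i \<omega>)
        (\<lambda>i. x i \<omega>) (\<lambda>i. y i \<omega>) (\<lambda>i. z i \<omega>) (\<lambda>i. xh i \<omega>) (\<lambda>i. w i \<omega>)"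
    and \<Omega>: "\<Omega> \<ge> 0"
    and k: "k \<ge> 1"
  shows
    "\<P>(\<omega> in M. \<phi> (y k \<omega>) - \<phi> xstar >
        4 * sqrt 2 * L * R\<^sup>2 / real k powr p
        + 16 * sqrt 2 * (1 + \<Omega>) * \<sigma> * R / sqrt (real k)
        + 48 * real k powr (p - 1) * \<delta>
        + 4 * sqrt 3 * D * \<sigma> * sqrt \<Omega> / sqrt (real k))
     \<le> \<P>(\<omega> in M. \<phi> (y k \<omega>) - \<phi> xstar >
        L * R\<^sup>2 * p powr p * 2 powr ((2 * p - 3) / 2) / (real k + p) powr p
        + (1 + \<Omega>) * \<sigma> * R * 2 powr ((3 + 2 * p) / 4) * sqrt p
            * (real k + p + 2) powr (p - 1 / 2) / (real k + p) powr p
        + 2 powr (2 * p - 1) * (((real k + p) / p) powr (p - 1) + 1) * \<delta>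
        + 2 * D * \<sigma> * sqrt (6 * \<Omega> * p) / sqrt (real k + p))
     \<and> \<P>(\<omega> in M. \<phi> (y k \<omega>) - \<phi> xstar >
        L * R\<^sup>2 * p powr p * 2 powr ((2 * p - 3) / 2) / (real k + p) powr p
        + (1 + \<Omega>) * \<sigma> * R * 2 powr ((3 + 2 * p) / 4) * sqrt p
            * (real k + p + 2) powr (p - 1 / 2) / (real k + p) powr p
        + 2 powr (2 * p - 1) * (((real k + p) / p) powr (p - 1) + 1) * \<delta>
        + 2 * D * \<sigma> * sqrt (6 * \<Omega> * p) / sqrt (real k + p))
     \<le> 3 * exp (- \<Omega>)"
proof -
  let ?gap = "\<lambda>\<omega>. \<phi> (y k \<omega>) - \<phi> xstar"
  let ?T1 = "4 * sqrt 2 * L * R\<^sup>2 / real k powr p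
        + 16 * sqrt 2 * (1 + \<Omega>) * \<sigma> * R / sqrt (real k)
        + 48 * real k powr (p - 1) * \<delta>
        + 4 * sqrt 3 * D * \<sigma> * sqrt \<Omega> / sqrt (real k)"
  let ?T2 = "L * R\<^sup>2 * p powr p * 2 powr ((2 * p - 3) / 2) / (real k + p) powr p
        + (1 + \<Omega>) * \<sigma> * R * 2 powr ((3 + 2 * p) / 4) * sqrt p
            * (real k + p + 2) powr (p - 1 / 2) / (real k + p) powr p
        + 2 powr (2 * p - 1) * (((real k + p) / p) powr (p - 1) + 1) * \<delta>
        + 2 * D * \<sigma> * sqrt (6 * \<Omega> * p) / sqrt (real k + p)"
  have threshold: "?T2 \<le> ?T1"
    using params R(1) D(2) \<Omega> k by (intro explicit_threshold_le p) auto
  obtain E :: "'e set" where E: "finite E" "span E = UNIV"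
    using finite_dim by blast
  have "2 * d xstar \<le> R\<^sup>2"
    using R(2) by (rule sqrt_le_D)
  moreover have "xstar \<in> Q"
    using xstar by (simp add: is_arg_min_def)
  ultimately interpret sigm M \<xi> P p a b L \<sigma> R \<alpha> \<beta> B E Q f h d fo go F G \<delta> D x0 xstar x y z xh w
    by (intro sigm.intro iid_noise.intro iid_noise_axioms.intro sigm_parameters.intro sigm_axioms.intro
        assms E) auto
  \<comment> \<open>Monotonicity requires the larger event to be measurable, since a non-measurable
    set has measure 0 by convention.\<close>
  have "?gap \<in> borel_measurable M"
    unfolding \<phi> by (rule gap_measurable)
  then have "{\<omega>\<in>space M. ?gap \<omega> > ?T2} \<in> events"
    by measurable
  moreover have "{\<omega>\<in>space M. ?gap \<omega> > ?T1} \<subseteq> {\<omega>\<in>space M. ?gap \<omega> > ?T2}"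
    using threshold by auto
  ultimately have "\<P>(\<omega> in M. ?gap \<omega> > ?T1) \<le> \<P>(\<omega> in M. ?gap \<omega> > ?T2)"
    by (intro finite_measure_mono)
  moreover have "\<P>(\<omega> in M. ?gap \<omega> > ?T2) \<le> 3 * exp (- \<Omega>)"
    unfolding \<phi> by (rule prob_gap_le[OF \<Omega>])
  ultimately show ?thesis by blast
qed

end
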